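(* Let $\mathcal{F}$ be a family of ordered pairs $(f,g)$ of nonnegative measurable functions on $\mathbb{R}^n$. Suppose that for some $p_0$, $0<p_0<\infty$, and for every weight $\omega\in A_\infty^{\rho,\infty}$, $$\int_{\mathbb{R}^n}f(x)^{p_0}\omega(x)\,dx\le C\int_{\mathbb{R}^n}g(x)^{p_0}\omega(x)\,dx,\qquad (f,g)\in\mathcal{F}.$$ Then: (1) For all $0<p<\infty$ and $\omega\in A_\infty^{\rho,\infty}$, $$\int_{\mathbb{R}^n}f(x)^{p}\omega(x)\,dx\le C\int_{\mathbb{R}^n}g(x)^{p}\omega(x)\,dx,\qquad (f,g)\in\mathcal{F}.$$ (2) For all $0<p<\infty$, $0<s\le\infty$ and $\omega\in A_\infty^{\rho,\infty}$, $$\|f\|_{L^{p,s}(\omega)}\le C\|g\|_{L^{p,s}(\omega)},\qquad (f,g)\in\mathcal{F}.$$ (3) For all $0<p,q<\infty$ and $\omega\in A_\infty^{\rho,\infty}$, $$\Big\|\Big(\sum_j f_j^q\Big)^{1/q}\Big\|_{L^p(\omega)}\le C\Big\|\Big(\sum_j g_j^q\Big)^{1/q}\Big\|_{L^p(\omega)},\qquad \{(f_j,g_j)\}_j\subset\mathcal{F}.$$ (4) For all $0<p,q<\infty$, $0<s\le\infty$ and $\omega\in A_\infty^{\rho,\infty}$, $$\Big\|\Big(\sum_j f_j^q\Big)^{1/q}\Big\|_{L^{p,s}(\omega)}\le C\Big\|\Big(\sum_j g_j^q\Big)^{1/q}\Big\|_{L^{p,s}(\omega)},\qquad \{(f_j,g_j)\}_j\subset\mathcal{F}.$$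 All inequalities (in the hypothesis and the conclusions) are understood according to the convention stated in the context: they hold for those pairs (or sequences of pairs) whose left-hand side is finite, with $C$ depending only on the exponents and the $A_\infty^{\rho,\infty}$ constant of $\omega$.
   Context: Let $n\ge3$. For $1<q<\infty$, a nonnegative function $V\in L^q_{\rm loc}(\mathbb{R}^n)$ belongs to $B_q$ if there is $C>0$ with $\left(\frac1{|B|}\int_{B}V^q\right)^{1/q}\le C\,\frac1{|B|}\int_{B}V$ for every ball $B$. Standing assumption: $V\in B_{n/2}$ and $V\not\equiv0$. Define $\rho(x)=\sup\{r>0:\ r^{2-n}\int_{B(x,r)}V(y)\,dy\le1\}\in(0,\infty)$. For a ball $B=B(x_0,r)$ and $\theta\ge0$, $\Psi_\theta(B)=(1+r/\rho(x_0))^\theta$, and $M_{V,\theta}f(x)=\sup_{B\ni x}\frac1{\Psi_\theta(B)|B|}\int_B|f|$ (supremum over balls containing $x$). A weight is a positive locally integrable function. For $1<p<\infty$, a weight $\omega$ is in $A_p^{\rho,\theta}$ if $\big(\frac1{\Psi_\theta(B)|B|}\int_B\omega\big)\big(\frac1{\Psi_\theta(B)|B|}\int_B\omega^{-\frac1{p-1}}\big)^{p-1}\le K$ for all balls $B$ and some constant $K$; $\omega\in A_1^{\rho,\theta}$ if $M_{V,\theta}\omega\le K\omega$ a.e. The least such $K$ is the $A_p^{\rho,\theta}$ constant of $\omega$. Put $A_p^{\rho,\infty}=\bigcup_{\theta\ge0}A_p^{\rho,\theta}$ and $A_\infty^{\rho,\infty}=\bigcup_{p\ge1}A_p^{\rho,\infty}$.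 Convention: an inequality "for $(f,g)\in\mathcal{F}$" means that it holds for every $(f,g)\in\mathcal F$ for which the left-hand side is finite, with a constant $C$ depending only on the exponents involved and on the $A_\infty^{\rho,\infty}$ constant of $\omega$; the latter means that for any given $t\ge1$, $\theta\ge0$, $K>0$, the same $C$ can be used for all $\omega$ with $A_t^{\rho,\theta}$ constant at most $K$. The same convention applies to vector-valued inequalities for sequences $\{(f_j,g_j)\}_j$ of pairs from $\mathcal{F}$. $L^{p,s}(\omega)$ is the Lorentz space with respect to the measure $\omega(x)\,dx$. *)

theory Defs
  imports "HOL-Analysis.Analysis"
begin

section \<open>Preliminaries\<close>

text \<open>
  Nonnegative functions whose integrals, sums or suprema may be infinite take values in
  \<^typ>\<open>ennreal\<close>. The power below is only ever used with exponent \<open>a > 0\<close>,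
  so that \<open>\<infinity>\<close> to the power \<open>a\<close> is \<open>\<infinity>\<close> and \<open>0\<close> to the power \<open>a\<close> is \<open>0\<close>.
\<close>

definition epowr :: "ennreal \<Rightarrow> real \<Rightarrow> ennreal" where
  "epowr x a = (if x = \<infinity> then \<infinity> else ennreal (enn2real x powr a))"

definition locally_integrable :: "(real^'n \<Rightarrow> real) \<Rightarrow> bool" where
  "locally_integrable f \<longleftrightarrow> (\<forall>K. compact K \<longrightarrow> set_integrable lebesgue K f)"


section \<open>The reverse Hoelder class and the critical radius\<close>

definition reverse_Holder :: "real \<Rightarrow> (real^'n \<Rightarrow> real) set" where
  "reverse_Holder q = {V. V \<in> borel_measurable lebesgue \<and> (\<forall>x. 0 \<le> V x) \<and>
     locally_integrable (\<lambda>x. V x powr q) \<and>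
     (\<exists>C>0. \<forall>x r. 0 < r \<longrightarrow>
        ((LINT y:ball x r|lebesgue. V y powr q) / measure lebesgue (ball x r)) powr (1 / q)
          \<le> C * ((LINT y:ball x r|lebesgue. V y) / measure lebesgue (ball x r)))}"

text \<open>
  A supremum of reals: the set is nonempty and bounded above when \<open>V\<close> belongs to the reverse
  Hoelder class of exponent \<open>n/2\<close>, \<open>n \<ge> 3\<close>, and does not vanish almost everywhere.
\<close>

definition crit_radius :: "(real^'n \<Rightarrow> real) \<Rightarrow> real^'n \<Rightarrow> real" where
  "crit_radius V x =
     Sup {r. 0 < r \<and> r powr (2 - real CARD('n)) * (LINT y:ball x r|lebesgue. V y) \<le> 1}"


section \<open>Weights adapted to the critical radius\<close>

definition Psi :: "(real^'n \<Rightarrow> real) \<Rightarrow> real \<Rightarrow> real^'n \<Rightarrow> real \<Rightarrow> real" where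
  "Psi V \<theta> x\<^sub>0 r = (1 + r / crit_radius V x\<^sub>0) powr \<theta>"

definition Psi_average ::
  "(real^'n \<Rightarrow> real) \<Rightarrow> real \<Rightarrow> (real^'n \<Rightarrow> real) \<Rightarrow> real^'n \<Rightarrow> real \<Rightarrow> ennreal" where
  "Psi_average V \<theta> f x\<^sub>0 r =
     (\<integral>\<^sup>+y\<in>ball x\<^sub>0 r. ennreal \<bar>f y\<bar> \<partial>lebesgue)
       / ennreal (Psi V \<theta> x\<^sub>0 r * measure lebesgue (ball x\<^sub>0 r))"

definition maximal_fun ::
  "(real^'n \<Rightarrow> real) \<Rightarrow> real \<Rightarrow> (real^'n \<Rightarrow> real) \<Rightarrow> real^'n \<Rightarrow> ennreal" where
  "maximal_fun V \<theta> f x =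
     (SUP (x\<^sub>0, r) \<in> {(x\<^sub>0, r). 0 < r \<and> x \<in> ball x\<^sub>0 r}. Psi_average V \<theta> f x\<^sub>0 r)"

definition weight :: "(real^'n \<Rightarrow> real) \<Rightarrow> bool" where
  "weight \<omega> \<longleftrightarrow> (\<forall>x. 0 < \<omega> x) \<and> locally_integrable \<omega>"

definition Ap_condition ::
  "(real^'n \<Rightarrow> real) \<Rightarrow> real \<Rightarrow> real \<Rightarrow> (real^'n \<Rightarrow> real) \<Rightarrow> ennreal \<Rightarrow> bool" where
  "Ap_condition V \<theta> p \<omega> K \<longleftrightarrow>
     (if p = 1 then AE x in lebesgue. maximal_fun V \<theta> \<omega> x \<le> K * ennreal (\<omega> x)
      else \<forall>x\<^sub>0 r. 0 < r \<longrightarrow>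
        Psi_average V \<theta> \<omega> x\<^sub>0 r
          * epowr (Psi_average V \<theta> (\<lambda>x. \<omega> x powr (- 1 / (p - 1))) x\<^sub>0 r) (p - 1) \<le> K)"

definition A_p :: "(real^'n \<Rightarrow> real) \<Rightarrow> real \<Rightarrow> real \<Rightarrow> (real^'n \<Rightarrow> real) set" where
  "A_p V \<theta> p = {\<omega>. weight \<omega> \<and> (\<exists>K<\<infinity>. Ap_condition V \<theta> p \<omega> K)}"

definition Ap_const ::
  "(real^'n \<Rightarrow> real) \<Rightarrow> real \<Rightarrow> real \<Rightarrow> (real^'n \<Rightarrow> real) \<Rightarrow> ennreal" where
  "Ap_const V \<theta> p \<omega> = Inf {K. Ap_condition V \<theta> p \<omega> K}"

definition A_infty :: "(real^'n \<Rightarrow> real) \<Rightarrow> (real^'n \<Rightarrow> real) set" where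
  "A_infty V = (\<Union>p\<in>{1..}. \<Union>\<theta>\<in>{0..}. A_p V \<theta> p)"


section \<open>Weighted Lebesgue and Lorentz norms\<close>

definition weighted :: "(real^'n \<Rightarrow> real) \<Rightarrow> (real^'n) measure" where
  "weighted \<omega> = density lebesgue (\<lambda>x. ennreal (\<omega> x))"

definition Lp_norm :: "'a measure \<Rightarrow> real \<Rightarrow> ('a \<Rightarrow> ennreal) \<Rightarrow> ennreal" where
  "Lp_norm M p f = epowr (\<integral>\<^sup>+x. epowr (f x) p \<partial>M) (1 / p)"

definition decr_rearrangement :: "'a measure \<Rightarrow> ('a \<Rightarrow> ennreal) \<Rightarrow> real \<Rightarrow> ennreal" where
  "decr_rearrangement M f t = Inf {l. emeasure M {x \<in> space M. l < f x} \<le> ennreal t}"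

definition Lorentz_norm :: "'a measure \<Rightarrow> real \<Rightarrow> ennreal \<Rightarrow> ('a \<Rightarrow> ennreal) \<Rightarrow> ennreal" where
  "Lorentz_norm M p s f =
     (if s = \<infinity> then SUP t\<in>{0<..}. ennreal (t powr (1 / p)) * decr_rearrangement M f t
      else epowr (\<integral>\<^sup>+t\<in>{0<..}.
             epowr (ennreal (t powr (1 / p)) * decr_rearrangement M f t) (enn2real s)
               * ennreal (1 / t) \<partial>lborel) (1 / enn2real s))"


section \<open>Families of pairs and estimates with uniform constants\<close>

text \<open>
  Sequences of pairs from \<open>F\<close>, finite or infinite: the index set \<open>J\<close> is any set of natural numbers,
  and \<open>h j\<close> is relevant only for \<open>j \<in> J\<close>.
\<close>

definition pair_seqs :: "'a set \<Rightarrow> (nat set \<times> (nat \<Rightarrow> 'a)) set" where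
  "pair_seqs F = {(J, h). \<forall>j\<in>J. h j \<in> F}"

definition lq_sum :: "real \<Rightarrow> nat set \<Rightarrow> (nat \<Rightarrow> 'a \<Rightarrow> ennreal) \<Rightarrow> 'a \<Rightarrow> ennreal" where
  "lq_sum q J f x = epowr (\<Sum>\<^sub>\<infinity>j\<in>J. epowr (f j x) q) (1 / q)"

text \<open>
  The inequality \<open>lhs \<omega> i \<le> C * rhs \<omega> i\<close> for all weights \<open>\<omega>\<close> in \<^const>\<open>A_infty\<close> and all \<open>i \<in> I\<close>
  with finite left-hand side, where \<open>C\<close> depends on \<open>\<omega>\<close> only through \<open>t\<close>, \<open>\<theta>\<close> and a bound \<open>K\<close> on its
  \<open>A\<^sub>t\<close> constant. Since \<^const>\<open>A_infty\<close> is the union of the classes \<^const>\<open>A_p\<close>, every weight in it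
  is covered for suitable \<open>t\<close>, \<open>\<theta>\<close>, \<open>K\<close>.
\<close>

definition A_infty_estimate ::
  "(real^'n \<Rightarrow> real) \<Rightarrow> 'i set \<Rightarrow> ((real^'n \<Rightarrow> real) \<Rightarrow> 'i \<Rightarrow> ennreal)
     \<Rightarrow> ((real^'n \<Rightarrow> real) \<Rightarrow> 'i \<Rightarrow> ennreal) \<Rightarrow> bool" where
  "A_infty_estimate V I lhs rhs \<longleftrightarrow>
     (\<forall>t\<ge>1. \<forall>\<theta>\<ge>0. \<forall>K>0. \<exists>C>0. \<forall>\<omega> \<in> A_infty V.
        \<omega> \<in> A_p V \<theta> t \<and> Ap_const V \<theta> t \<omega> \<le> ennreal K \<longrightarrow>
        (\<forall>i\<in>I. lhs \<omega> i < \<infinity> \<longrightarrow> lhs \<omega> i \<le> ennreal C * rhs \<omega> i))"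

end

(* Rubio de Francia extrapolation. The class A_p with respect to the critical radius is self-dual up
   to a change of the growth exponent, so Lerner's pointwise bound of the maximal operator by the
   composition of two weighted maximal operators, each of weak type (1,1) by the Vitali covering
   lemma, makes the maximal operator bounded on L^q(u) for u in A_q once the power of the gauge
   1 + r/rho(x) in it is large. Iterating this operator
   yields, for every h, a majorant W of comparable norm which is an A_1 weight.
   To lower the exponent p_0 to p, the hypothesis is applied to the weight W^(-beta) w, where W
   majorizes f^(p/q) + g^(p/q). To raise it from a small p_1 to p, it is applied to a majorant H of
   f^(p - p_1) w. For the Lorentz norms, H majorizes the restriction of w to a level set {f > l} and
   is bounded in two dual spaces at once; interpolating between them bounds f* pointwise by a
   geometric sum of dyadic dilates of g*. The vector-valued inequalities are the scalar ones for the
   family of l^q sums, which satisfies the hypothesis with p_0 = q. *)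
theory Submission
  imports Defs
begin

section \<open>Powers of extended nonnegative reals\<close>

text \<open>All constants have to be uniform over weights with the same class data, so each is fixed
  from \<open>q\<close>, \<open>N\<close>, \<open>K\<close> before a weight is chosen. Powers of the
  gauge are not optimised: duality, doubling and A_1 factors each cost some power, and the maximal
  operator is divided by a power large enough to pay for all of them. The potential acts through the
  gauge, which needs a positive critical radius; this is where membership in B_(n/2) is used, once
  to find an admissible radius and once to bound the admissible radii. In the Lebesgue estimates
  Young's inequality leaves a small multiple of the left-hand side on the right, where it is
  absorbed. This needs the left-hand side to be finite, and for the same reason finiteness is
  checked before the hypothesis is used with an auxiliary weight. Raising the exponent from p_1
  requires p / p_1 > q: then u in A_q also lies in A_(p/p_1), and the maximal operator is bounded on
  the dual space in which the majorant is built. As p_0 may be too large for this, it is first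
  lowered to a p_1 that depends on q.\<close>

lemma epowr_top [simp]: "epowr top a = top"
  by (simp add: epowr_def)

lemma epowr_zero [simp]: "epowr 0 a = 0"
  by (simp add: epowr_def)

lemma epowr_one [simp]: "epowr 1 a = 1"
  by (simp add: epowr_def)

lemma epowr_ennreal: "0 \<le> x \<Longrightarrow> epowr (ennreal x) a = ennreal (x powr a)"
  by (simp add: epowr_def)

lemma epowr_one_right [simp]: "epowr x 1 = x"
  by (cases x) (auto simp: epowr_ennreal)

lemma epowr_mult: "epowr (x * y) a = epowr x a * epowr y a"
proof (cases x; cases y)
  fix r s assume *: "0 \<le> r" "x = ennreal r" "0 \<le> s" "y = ennreal s"
  then show ?thesis
    by (simp add: epowr_ennreal powr_mult flip: ennreal_mult)
next
  fix r assume *: "0 \<le> r" "x = ennreal r" "y = top"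
  then show ?thesis
    by (cases "r = 0") (auto simp: epowr_ennreal ennreal_mult_top)
next
  fix r assume *: "0 \<le> r" "y = ennreal r" "x = top"
  then show ?thesis
    by (cases "r = 0") (auto simp: epowr_ennreal ennreal_top_mult)
qed auto

text \<open>Unconditional because 0 and infinity are fixed by every power, whatever the sign of the
  exponent.\<close>

lemma epowr_epowr [simp]: "epowr (epowr x a) b = epowr x (a * b)"
  by (cases x) (auto simp: epowr_ennreal powr_powr)

lemma epowr_add: "epowr x (a + b) = epowr x a * epowr x b"
proof (cases x)
  case (real r)
  then show ?thesis
    by (simp add: epowr_ennreal powr_add flip: ennreal_mult)
qed simp

lemma epowr_eq_top_iff [simp]: "epowr x a = top \<longleftrightarrow> x = top"
  by (cases x) (auto simp: epowr_ennreal)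

lemma epowr_less_top_iff [simp]: "epowr x a < top \<longleftrightarrow> x < top"
  by (simp add: less_top[symmetric])

lemma epowr_eq_zero_iff [simp]: "epowr x a = 0 \<longleftrightarrow> x = 0"
  by (cases x) (auto simp: epowr_ennreal)

lemma epowr_pos_iff [simp]: "0 < epowr x a \<longleftrightarrow> 0 < x"
  by (simp add: zero_less_iff_neq_zero)

lemma epowr_zero_right: "x \<noteq> 0 \<Longrightarrow> x \<noteq> top \<Longrightarrow> epowr x 0 = 1"
  by (cases x) (auto simp: epowr_ennreal)

lemma epowr_mono: "0 \<le> a \<Longrightarrow> x \<le> y \<Longrightarrow> epowr x a \<le> epowr y a"
  by (cases x; cases y) (auto simp: epowr_ennreal top_unique intro!: ennreal_leI powr_mono2)

lemma epowr_le_iff: "0 < a \<Longrightarrow> epowr x a \<le> y \<longleftrightarrow> x \<le> epowr y (1 / a)"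
  using epowr_mono[of a x "epowr y (1/a)"] epowr_mono[of "1/a" "epowr x a" y] by auto

text \<open>Since \<open>epowr\<close> fixes 0 and infinity also for negative exponents, the order
  is reversed only on finite positive arguments. Weights are therefore kept strictly between 0 and
  infinity throughout.\<close>

lemma epowr_antimono: "a \<le> 0 \<Longrightarrow> x \<le> y \<Longrightarrow> y < top \<Longrightarrow> 0 < x \<Longrightarrow> epowr y a \<le> epowr x a"
  by (cases x; cases y) (auto simp: epowr_ennreal top_unique intro!: ennreal_leI powr_mono2')

lemma epowr_measurable [measurable]:
  assumes [measurable]: "f \<in> borel_measurable M"
  shows "(\<lambda>x. epowr (f x) a) \<in> borel_measurable M"
  unfolding epowr_def infinity_ennreal_def by measurable

lemma epowr_cancel: "0 < x \<Longrightarrow> x < top \<Longrightarrow> a + b = 0 \<Longrightarrow> epowr x a * epowr x b = 1"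
  using epowr_add[of x a b] epowr_zero_right[of x] by auto

lemma epowr_add_le:
  assumes "0 \<le> a" shows "epowr (x + y) a \<le> epowr 2 a * (epowr x a + epowr y a)"
proof -
  have "x + y \<le> 2 * max x y"
    by (simp add: mult_2 add_mono)
  then have "epowr (x + y) a \<le> epowr 2 a * epowr (max x y) a"
    using epowr_mono[OF assms] by (metis epowr_mult)
  also have "\<dots> \<le> epowr 2 a * (epowr x a + epowr y a)"
    by (intro mult_left_mono) (auto simp: max_def intro: add_increasing add_increasing2)
  finally show ?thesis .
qed

text \<open>Both factors are bounded by powers of the maximum, and the exponents add up to
  1.\<close>

lemma epowr_Young:
  assumes "0 < s" "s < 1"
  shows "epowr x s * epowr y (1 - s) \<le> x + y"
proof -
  have "epowr x s * epowr y (1 - s) \<le> epowr (max x y) s * epowr (max x y) (1 - s)"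
    using assms by (intro mult_mono epowr_mono) auto
  also have "\<dots> = max x y"
    by (simp flip: epowr_add)
  also have "\<dots> \<le> x + y"
    by (auto simp: max_def intro: add_increasing add_increasing2)
  finally show ?thesis .
qed

text \<open>Scaling x by \<open>C\<close> and y by \<epsilon> leaves the left side unchanged when
  C^s \<epsilon>^(1-s) = 1. The small factor is what later allows a term to be absorbed.\<close>

lemma epowr_Young_eps:
  assumes "0 < s" "s < 1" "0 < \<epsilon>"
  obtains C where "0 < C" "\<And>x y. epowr x s * epowr y (1 - s) \<le> ennreal C * x + ennreal \<epsilon> * y"
proof
  define C where "C = \<epsilon> powr (- ((1 - s) / s))"
  show "0 < C"
    using assms by (simp add: C_def)
  fix x y
  have "epowr (ennreal C) s * epowr (ennreal \<epsilon>) (1 - s) = ennreal (\<epsilon> powr (- (1 - s)) * \<epsilon> powr (1 - s))"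
    using assms by (simp add: C_def epowr_ennreal powr_powr ennreal_mult)
  also have "\<dots> = 1"
    using assms by (simp flip: powr_add)
  finally have *: "epowr (ennreal C) s * epowr (ennreal \<epsilon>) (1 - s) = 1" .
  have "epowr x s * epowr y (1 - s)
      = (epowr (ennreal C) s * epowr (ennreal \<epsilon>) (1 - s)) * (epowr x s * epowr y (1 - s))"
    by (simp add: *)
  also have "\<dots> = epowr (ennreal C * x) s * epowr (ennreal \<epsilon> * y) (1 - s)"
    by (simp add: epowr_mult mult_ac)
  also have "\<dots> \<le> ennreal C * x + ennreal \<epsilon> * y"
    by (rule epowr_Young[OF assms(1,2)])
  finally show "epowr x s * epowr y (1 - s) \<le> ennreal C * x + ennreal \<epsilon> * y" .
qed

text \<open>Only Young's inequality without its weights is used, whence the constant \<open>2\<close>.\<close>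

lemma nn_integral_Hoelder:
  assumes [measurable]: "f \<in> borel_measurable M" "g \<in> borel_measurable M" and s: "0 < s" "s < 1"
  shows "(\<integral>\<^sup>+x. epowr (f x) s * epowr (g x) (1 - s) \<partial>M)
    \<le> 2 * (epowr (\<integral>\<^sup>+x. f x \<partial>M) s * epowr (\<integral>\<^sup>+x. g x \<partial>M) (1 - s))"
proof -
  define F G where "F = (\<integral>\<^sup>+x. f x \<partial>M)" and "G = (\<integral>\<^sup>+x. g x \<partial>M)"
  consider "F = 0" | "G = 0" | "F \<noteq> 0" "G \<noteq> 0" "F = top \<or> G = top"
    | "0 < F" "F < top" "0 < G" "G < top"
    using zero_less_iff_neq_zero less_top by metis
  then show ?thesis
  proof cases
    case 1
    then have "AE x in M. f x = 0"
      by (simp add: F_def nn_integral_0_iff_AE)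
    then have "AE x in M. epowr (f x) s * epowr (g x) (1 - s) = 0"
      by eventually_elim simp
    then have "(\<integral>\<^sup>+x. epowr (f x) s * epowr (g x) (1 - s) \<partial>M) = 0"
      by (subst nn_integral_0_iff_AE) auto
    then show ?thesis
      by simp
  next
    case 2
    then have "AE x in M. g x = 0"
      by (simp add: G_def nn_integral_0_iff_AE)
    then have "AE x in M. epowr (f x) s * epowr (g x) (1 - s) = 0"
      by eventually_elim simp
    then have "(\<integral>\<^sup>+x. epowr (f x) s * epowr (g x) (1 - s) \<partial>M) = 0"
      by (subst nn_integral_0_iff_AE) auto
    then show ?thesis
      by simp
  next
    case 3
    then have "epowr F s * epowr G (1 - s) = top"
      by (auto simp: ennreal_mult_top ennreal_top_mult)
    then show ?thesis
      by (simp add: F_def G_def ennreal_mult_top)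
  next
    case 4
    \<comment> \<open>Young's inequality is applied to f / F and g / G, whose integrals are 1, so
      the two terms add up to 2.\<close>
    define k where "k = epowr F s * epowr G (1 - s)"
    have inv: "F * inverse F = 1" "G * inverse G = 1"
      using 4 by (auto simp flip: divide_ennreal_def simp: ennreal_divide_self)
    have "(\<integral>\<^sup>+x. epowr (f x) s * epowr (g x) (1 - s) \<partial>M)
        \<le> (\<integral>\<^sup>+x. k * (inverse F * f x + inverse G * g x) \<partial>M)"
    proof (rule nn_integral_mono)
      fix x
      have "epowr (f x) s * epowr (g x) (1 - s)
         = epowr (F * inverse F * f x) s * epowr (G * inverse G * g x) (1 - s)"
        by (simp add: inv)
      also have "\<dots> = k * (epowr (inverse F * f x) s * epowr (inverse G * g x) (1 - s))"
        by (simp add: k_def epowr_mult mult_ac)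
      also have "\<dots> \<le> k * (inverse F * f x + inverse G * g x)"
        by (intro mult_left_mono epowr_Young s) auto
      finally show "epowr (f x) s * epowr (g x) (1 - s) \<le> k * (inverse F * f x + inverse G * g x)" .
    qed
    also have "\<dots> = k * (inverse F * F + inverse G * G)"
      by (simp add: nn_integral_cmult nn_integral_add F_def G_def)
    also have "\<dots> = 2 * k"
      using inv by (simp add: mult_ac one_add_one)
    finally show ?thesis
      by (simp add: k_def F_def G_def)
  qed
qed

text \<open>A substitute for Minkowski's inequality that holds for every positive exponent. One half
  of the power of c_n stays inside the sum, which then dominates each of its terms; the other half
  makes the remaining series converge.\<close>

lemma epowr_suminf_le:
  assumes "0 < \<sigma>"
  shows "epowr (\<Sum>n. c n * a n) \<sigma>
    \<le> epowr (\<Sum>n. epowr (c n) (1/2)) \<sigma> * (\<Sum>n. epowr (c n) (\<sigma>/2) * epowr (a n) \<sigma>)"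
proof -
  define T where "T = (\<Sum>n. epowr (c n) (\<sigma>/2) * epowr (a n) \<sigma>)"
  have "c n * a n \<le> epowr (c n) (1/2) * epowr T (1/\<sigma>)" for n
  proof -
    have "epowr (c n) (\<sigma>/2) * epowr (a n) \<sigma> \<le> T"
      unfolding T_def
      using sum_le_suminf[of "\<lambda>n. epowr (c n) (\<sigma>/2) * epowr (a n) \<sigma>" "{n}"] by auto
    then have "epowr (epowr (c n) (1/2) * a n) \<sigma> \<le> T"
      by (simp add: epowr_mult)
    then have "epowr (c n) (1/2) * a n \<le> epowr T (1/\<sigma>)"
      using assms by (simp add: epowr_le_iff)
    then have "epowr (c n) (1/2) * (epowr (c n) (1/2) * a n) \<le> epowr (c n) (1/2) * epowr T (1/\<sigma>)"
      by (rule mult_left_mono) simp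
    moreover have "epowr (c n) (1/2) * (epowr (c n) (1/2) * a n) = c n * a n"
      by (simp flip: epowr_add mult.assoc)
    ultimately show ?thesis
      by simp
  qed
  then have "(\<Sum>n. c n * a n) \<le> (\<Sum>n. epowr (c n) (1/2) * epowr T (1/\<sigma>))"
    by (intro suminf_le) auto
  also have "\<dots> = (\<Sum>n. epowr (c n) (1/2)) * epowr T (1/\<sigma>)"
    by simp
  finally have "epowr (\<Sum>n. c n * a n) \<sigma> \<le> epowr ((\<Sum>n. epowr (c n) (1/2)) * epowr T (1/\<sigma>)) \<sigma>"
    using assms by (intro epowr_mono) auto
  then show ?thesis
    using assms by (simp add: epowr_mult T_def)
qed

text \<open>
  The substitution \<open>l = exp (- u)\<close> turns the layer cake formula into an integral with a smooth
  density, also for \<open>0 < a < 1\<close>.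
\<close>

lemma epowr_layer_cake:
  assumes "0 < a"
  shows "(\<integral>\<^sup>+u. (if ennreal (exp (- u)) \<le> y then ennreal (a * exp (- a * u)) else 0) \<partial>lborel)
    = epowr y a"
proof -
  have fin: "(\<integral>\<^sup>+u. ennreal (a * exp (- a * u)) * indicator {u. ennreal (exp (- u)) \<le> ennreal r} u \<partial>lborel)
      = ennreal (r powr a)" if "0 < r" for r
  proof -
    have "{u. ennreal (exp (- u)) \<le> ennreal r} = {- ln r ..}"
      using that by (auto simp: ln_ge_iff[symmetric] minus_le_iff)
    moreover have "(\<integral>\<^sup>+u. ennreal (a * exp (- a * u)) * indicator {- ln r ..} u \<partial>lborel)
       = ennreal (0 - (- exp (- a * (- ln r))))"
    proof (rule nn_integral_FTC_atLeast)
      show "((\<lambda>u. - exp (- a * u)) \<longlongrightarrow> 0) at_top"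
        using assms by real_asymp
    qed (use assms in \<open>auto intro!: derivative_eq_intros\<close>)
    ultimately show ?thesis
      using that by (simp add: powr_def)
  qed
  have "(\<integral>\<^sup>+u. (if ennreal (exp (- u)) \<le> y then ennreal (a * exp (- a * u)) else 0) \<partial>lborel)
    = (\<integral>\<^sup>+u. ennreal (a * exp (- a * u)) * indicator {u. ennreal (exp (- u)) \<le> y} u \<partial>lborel)"
    by (intro nn_integral_cong) simp
  also have "\<dots> = epowr y a"
  proof (cases y)
    case (real r)
    show ?thesis
    proof (cases "r = 0")
      case True
      then have "{u. ennreal (exp (- u)) \<le> y} = {}"
        using real by auto
      then show ?thesis
        using real True by simp
    next
      case False
      then show ?thesis
        using real fin[of r] by (simp add: epowr_ennreal)
    qed
  next
    \<comment> \<open>Comparison with the finite value r = b^(1/a) shows that the integral over the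
      whole line is at least b, for every b.\<close>
    case top
    have "(\<integral>\<^sup>+u. ennreal (a * exp (- a * u)) \<partial>lborel) \<ge> ennreal b" if "b > 0" for b
    proof -
      have "ennreal b = (\<integral>\<^sup>+u. ennreal (a * exp (- a * u))
          * indicator {u. ennreal (exp (- u)) \<le> ennreal (b powr (1 / a))} u \<partial>lborel)"
        using that assms by (subst fin) (auto simp: powr_powr)
      also have "\<dots> \<le> (\<integral>\<^sup>+u. ennreal (a * exp (- a * u)) \<partial>lborel)"
        by (intro nn_integral_mono) (auto simp: indicator_def)
      finally show ?thesis .
    qed
    note ge = this
    have "(\<integral>\<^sup>+u. ennreal (a * exp (- a * u)) \<partial>lborel) = top"
    proof (cases "\<integral>\<^sup>+u. ennreal (a * exp (- a * u)) \<partial>lborel")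
      case (real r)
      then show ?thesis
        using ge[of "r + 1"] by simp
    qed
    then show ?thesis
      using top by simp
  qed
  finally show ?thesis .
qed

section \<open>Maximal operators with a gauge\<close>

lemma sigma_finite_lebesgue: "sigma_finite_measure (lebesgue :: 'a::euclidean_space measure)"
proof
  show "\<exists>A::'a set set. countable A \<and> A \<subseteq> sets lebesgue \<and> \<Union>A = space lebesgue
      \<and> (\<forall>a\<in>A. emeasure lebesgue a \<noteq> \<infinity>)"
  proof (intro exI conjI)
    show "\<Union>(range (\<lambda>n::nat. cball 0 (real n))) = (space lebesgue :: 'a set)"
      by (auto intro: real_arch_simple)
    show "\<forall>a\<in>range (\<lambda>n::nat. cball (0::'a) (real n)). emeasure lebesgue a \<noteq> \<infinity>"
      using fmeasurableD2[OF lmeasurable_cball] by auto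
  qed auto
qed

lemma ball_sets_lebesgue [measurable, simp]: "ball (c :: 'a::euclidean_space) r \<in> sets lebesgue"
  by (simp add: fmeasurableD)

lemma open_sets_lebesgue: "open (S :: 'a::euclidean_space set) \<Longrightarrow> S \<in> sets lebesgue"
  by (intro sets_completionI_sets) (auto intro: borel_open)

text \<open>Only an inequality, since the left side is 0 when y is 0 or infinite.\<close>

lemma ennreal_divide_mult_le: "x / y * y \<le> (x::ennreal)"
proof (cases "y = 0 \<or> y = top")
  case False
  then show ?thesis
    by (simp add: ennreal_mult_divide_eq mult.commute ennreal_times_divide)
qed auto

lemma ennreal_divide_mono: "a \<le> b \<Longrightarrow> d \<le> c \<Longrightarrow> a / c \<le> b / (d::ennreal)"
proof -
  assume "a \<le> b" "d \<le> c"
  have "inverse c \<le> inverse d"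
  proof (cases c; cases d)
    fix r s assume "0 \<le> r" "c = ennreal r" "0 \<le> s" "d = ennreal s"
    then show ?thesis
      using \<open>d \<le> c\<close> by (cases "s = 0") (auto simp: inverse_ennreal)
  qed (use \<open>d \<le> c\<close> in \<open>auto simp: top_unique\<close>)
  then show ?thesis
    using \<open>a \<le> b\<close> by (simp add: divide_ennreal_def mult_mono)
qed

section \<open>Integrals over balls\<close>

definition ball_int :: "('a::euclidean_space \<Rightarrow> ennreal) \<Rightarrow> 'a \<Rightarrow> real \<Rightarrow> ennreal" where
  "ball_int u c r = (\<integral>\<^sup>+y\<in>ball c r. u y \<partial>lebesgue)"

lemma ball_int_mono: "(\<And>y. y \<in> ball c r \<Longrightarrow> u y \<le> v y) \<Longrightarrow> ball_int u c r \<le> ball_int v c r"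
  unfolding ball_int_def by (intro nn_integral_mono) (auto simp: indicator_def)

lemma ball_int_add:
  assumes [measurable]: "u \<in> borel_measurable lebesgue" "v \<in> borel_measurable lebesgue"
  shows "ball_int (\<lambda>x. u x + v x) c r = ball_int u c r + ball_int v c r"
  unfolding ball_int_def by (simp add: distrib_right nn_integral_add)

lemma ball_int_cmult:
  assumes [measurable]: "u \<in> borel_measurable lebesgue"
  shows "ball_int (\<lambda>x. k * u x) c r = k * ball_int u c r"
  unfolding ball_int_def by (simp add: mult.assoc nn_integral_cmult)

lemma ball_int_pos:
  assumes [measurable]: "u \<in> borel_measurable lebesgue" and "\<And>x. 0 < u x" "0 < r"
  shows "0 < ball_int u c r"
proof (rule ccontr)
  assume "\<not> 0 < ball_int u c r"
  then have "AE y in lebesgue. u y * indicator (ball c r) y = 0"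
    unfolding ball_int_def by (subst (asm) not_gr_zero, subst (asm) nn_integral_0_iff_AE) auto
  then have "AE y in lebesgue. y \<notin> ball c r"
    by eventually_elim (use assms(2) in \<open>auto simp: indicator_def zero_less_iff_neq_zero split: if_splits\<close>)
  then have "ball c r \<in> null_sets lebesgue"
    by (simp add: AE_iff_null_sets)
  then have "measure lebesgue (ball c r) = 0"
    by (simp add: measure_eq_0_null_sets)
  then show False
    using content_ball_pos[OF \<open>0 < r\<close>, of c] by simp
qed

text \<open>Abstracts 1 + r / rho(x). The factor 5 is the dilation of the Vitali covering
  lemma.\<close>

locale ball_gauge =
  fixes d :: "'a::euclidean_space \<Rightarrow> real \<Rightarrow> real"
  assumes gauge_ge_one: "0 < r \<Longrightarrow> 1 \<le> d x r"
    and gauge_dilate: "0 < r \<Longrightarrow> d x (5 * r) \<le> 5 * d x r"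
begin

text \<open>The numerator integrates F against Lebesgue measure, so the maximal function of g with
  respect to the measure \<nu> dx is \<open>maxop\<close> applied to g \<nu>. With this
  normalisation the usual operator (\<nu> = 1) and the weighted ones act on the same functions,
  which suits their composition.\<close>

definition maxop :: "real \<Rightarrow> ('a \<Rightarrow> ennreal) \<Rightarrow> ('a \<Rightarrow> ennreal) \<Rightarrow> 'a \<Rightarrow> ennreal" where
  "maxop N \<nu> F x = (SUP (c, r) \<in> {(c, r). 0 < r \<and> x \<in> ball c r}.
     ball_int F c r / (ennreal (d c r powr N) * ball_int \<nu> c r))"

lemma maxop_upper:
  "0 < r \<Longrightarrow> x \<in> ball c r \<Longrightarrow>
    ball_int F c r / (ennreal (d c r powr N) * ball_int \<nu> c r) \<le> maxop N \<nu> F x"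
  unfolding maxop_def by (rule SUP_upper2[of "(c, r)"]) auto

lemma maxop_least:
  assumes "\<And>c r. 0 < r \<Longrightarrow> x \<in> ball c r \<Longrightarrow>
    ball_int F c r / (ennreal (d c r powr N) * ball_int \<nu> c r) \<le> B"
  shows "maxop N \<nu> F x \<le> B"
  unfolding maxop_def using assms by (auto intro!: SUP_least)

lemma less_maxop_iff:
  "l < maxop N \<nu> F x \<longleftrightarrow>
    (\<exists>c r. 0 < r \<and> x \<in> ball c r \<and> l < ball_int F c r / (ennreal (d c r powr N) * ball_int \<nu> c r))"
  unfolding maxop_def less_SUP_iff by simp

text \<open>The operator is uncentred: a ball that witnesses the bound at one of its points does so
  at all of them, so the set is a union of open balls.\<close>

lemma open_less_maxop: "open {x. l < maxop N \<nu> F x}"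
proof -
  have "{x. l < maxop N \<nu> F x} = (\<Union>(c, r)\<in>{(c, r). 0 < r \<and>
      l < ball_int F c r / (ennreal (d c r powr N) * ball_int \<nu> c r)}. ball c r)"
    by (auto simp: less_maxop_iff) blast
  then show ?thesis
    by auto
qed

lemma maxop_measurable [measurable]: "maxop N \<nu> F \<in> borel_measurable lebesgue"
  using open_less_maxop
  by (intro borel_measurableI_greater) (auto intro!: open_sets_lebesgue)

lemma maxop_mono: "(\<And>y. F y \<le> G y) \<Longrightarrow> maxop N \<nu> F x \<le> maxop N \<nu> G x"
  by (rule maxop_least, rule order_trans[OF _ maxop_upper])
     (auto intro!: ennreal_divide_mono ball_int_mono)

text \<open>Doubling up to a power of the gauge. The exponent \<open>N\<close> is the one by which
  \<open>maxop\<close> divides, so the loss cancels exactly in the weak type estimate.\<close>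

definition gauge_doubling :: "real \<Rightarrow> real \<Rightarrow> ('a \<Rightarrow> ennreal) \<Rightarrow> bool" where
  "gauge_doubling N D \<nu> \<longleftrightarrow> 0 \<le> N \<and> 0 < D \<and> \<nu> \<in> borel_measurable lebesgue \<and> (\<forall>x. 0 < \<nu> x) \<and>
    (\<forall>c r. 0 < r \<longrightarrow> ball_int \<nu> c r < top \<and>
      ball_int \<nu> c (5 * r) \<le> ennreal (D * d c r powr N) * ball_int \<nu> c r)"

text \<open>For a ball B whose quotient exceeds l, doubling gives l \<nu>(5B) at most D times the
  integral of F over B, the gauge powers cancelling. Vitali selects disjoint balls whose dilates
  cover the level set.\<close>

lemma maxop_weak_type:
  assumes \<nu>: "gauge_doubling N D \<nu>" and [measurable]: "F \<in> borel_measurable lebesgue"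
  shows "l * (\<integral>\<^sup>+x. \<nu> x * indicator {x. l < maxop N \<nu> F x} x \<partial>lebesgue)
    \<le> ennreal D * (\<integral>\<^sup>+x. F x \<partial>lebesgue)"
proof -
  have [measurable]: "\<nu> \<in> borel_measurable lebesgue" and D: "0 < D"
    using \<nu> by (auto simp: gauge_doubling_def)
  \<comment> \<open>The covering lemma wants bounded radii; the bound k is removed at the end by
    monotone convergence.\<close>
  define R where "R c r = ball_int F c r / (ennreal (d c r powr N) * ball_int \<nu> c r)" for c r
  define I where "I k = {i. 0 < snd i \<and> snd i \<le> real k \<and> l < R (fst i) (snd i)}" for k :: nat
  define S where "S k = (\<Union>i\<in>I k. ball (fst i) (snd i))" for k
  have S_meas [measurable]: "S k \<in> sets lebesgue" for k
    unfolding S_def by (intro open_sets_lebesgue) auto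
  have "incseq S"
    unfolding S_def I_def by (intro monoI UN_mono) auto
  have S_UN: "{x. l < maxop N \<nu> F x} = (\<Union>k. S k)"
  proof -
    have "x \<in> (\<Union>k. S k)" if "0 < r" "x \<in> ball c r" "l < R c r" for x c r
      using that real_arch_simple[of r] by (force simp: S_def I_def)
    then show ?thesis
      unfolding less_maxop_iff S_def I_def R_def by (auto, blast)
  qed
  define m where "m = density lebesgue \<nu>"
  have m_eq: "emeasure m X = (\<integral>\<^sup>+x. \<nu> x * indicator X x \<partial>lebesgue)" if "X \<in> sets lebesgue" for X
    using that by (simp add: m_def emeasure_density)
  have bound: "l * emeasure m (S k) \<le> ennreal D * (\<integral>\<^sup>+x. F x \<partial>lebesgue)" for k
  proof -
    obtain C where C: "countable C" "C \<subseteq> I k"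
      "pairwise (\<lambda>i j. disjnt (ball (fst i) (snd i)) (ball (fst j) (snd j))) C"
      "S k \<subseteq> (\<Union>i\<in>C. ball (fst i) (5 * snd i))"
    proof (rule Vitali_covering_lemma_balls)
      show "S k \<subseteq> (\<Union>i\<in>I k. ball (fst i) (snd i))"
        by (simp add: S_def)
      show "0 < snd i \<and> snd i \<le> real k" if "i \<in> I k" for i
        using that by (simp add: I_def)
    qed
    have "emeasure m (S k) \<le> (\<integral>\<^sup>+x. (\<integral>\<^sup>+i. \<nu> x * indicator (ball (fst i) (5 * snd i)) x \<partial>count_space C) \<partial>lebesgue)"
      unfolding m_eq[OF S_meas]
    proof (rule nn_integral_mono)
      fix x
      show "\<nu> x * indicator (S k) x \<le> (\<integral>\<^sup>+i. \<nu> x * indicator (ball (fst i) (5 * snd i)) x \<partial>count_space C)"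
      proof (cases "x \<in> S k")
        case True
        then obtain i where i: "i \<in> C" "x \<in> ball (fst i) (5 * snd i)"
          using C(4) by blast
        then show ?thesis
          using nn_integral_ge_point[OF i(1), of "\<lambda>i. \<nu> x * indicator (ball (fst i) (5 * snd i)) x"] True
          by simp
      qed simp
    qed
    also have "\<dots> = (\<integral>\<^sup>+i. ball_int \<nu> (fst i) (5 * snd i) \<partial>count_space C)"
      unfolding ball_int_def by (rule nn_integral_count_space_nn_integral) (use C in auto)
    finally have "l * emeasure m (S k) \<le> l * (\<integral>\<^sup>+i. ball_int \<nu> (fst i) (5 * snd i) \<partial>count_space C)"
      by (rule mult_left_mono) simp
    also have "\<dots> = (\<integral>\<^sup>+i. l * ball_int \<nu> (fst i) (5 * snd i) \<partial>count_space C)"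
      by (simp add: nn_integral_cmult)
    also have "\<dots> \<le> (\<integral>\<^sup>+i. ennreal D * ball_int F (fst i) (snd i) \<partial>count_space C)"
    proof (rule nn_integral_mono)
      fix i assume "i \<in> space (count_space C)"
      then have i: "0 < snd i" "l < R (fst i) (snd i)"
        using C by (auto simp: I_def)
      obtain c r where cr: "i = (c, r)"
        by (cases i)
      have "l * ball_int \<nu> c (5 * r) \<le> R c r * (ennreal (D * d c r powr N) * ball_int \<nu> c r)"
        using \<nu> i cr by (intro mult_mono) (auto simp: gauge_doubling_def)
      also have "\<dots> = ennreal D * (R c r * (ennreal (d c r powr N) * ball_int \<nu> c r))"
        using D by (simp add: ennreal_mult mult_ac)
      also have "\<dots> \<le> ennreal D * ball_int F c r"
        unfolding R_def by (intro mult_left_mono ennreal_divide_mult_le) simp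
      finally show "l * ball_int \<nu> (fst i) (5 * snd i) \<le> ennreal D * ball_int F (fst i) (snd i)"
        by (simp add: cr)
    qed
    also have "\<dots> = ennreal D * (\<integral>\<^sup>+i. emeasure (density lebesgue F) (ball (fst i) (snd i)) \<partial>count_space C)"
      by (simp add: nn_integral_cmult emeasure_density ball_int_def)
    also have "(\<integral>\<^sup>+i. emeasure (density lebesgue F) (ball (fst i) (snd i)) \<partial>count_space C)
       = emeasure (density lebesgue F) (\<Union>i\<in>C. ball (fst i) (snd i))"
      using C by (intro emeasure_UN_countable[symmetric])
        (auto simp: disjoint_family_on_def pairwise_def disjnt_def)
    also have "\<dots> \<le> emeasure (density lebesgue F) (space lebesgue)"
      by (rule emeasure_mono) auto
    also have "\<dots> = (\<integral>\<^sup>+x. F x \<partial>lebesgue)"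
      by (simp add: emeasure_density)
    finally show ?thesis
      by (simp add: mult_left_mono)
  qed
  have "(\<integral>\<^sup>+x. \<nu> x * indicator {x. l < maxop N \<nu> F x} x \<partial>lebesgue) = emeasure m (\<Union>k. S k)"
    by (subst m_eq) (auto simp: S_UN)
  also have "\<dots> = (SUP k. emeasure m (S k))"
    using \<open>incseq S\<close> by (intro SUP_emeasure_incseq[symmetric]) (auto simp: m_def)
  finally show ?thesis
    using bound by (simp add: SUP_mult_left_ennreal SUP_le_iff)
qed

text \<open>The part of g below k has \<nu>-average at most k, and the gauge power in the
  denominator is at least 1.\<close>

lemma maxop_le_add:
  assumes [measurable]: "g \<in> borel_measurable lebesgue" and \<nu>: "gauge_doubling N D \<nu>"
  shows "maxop N \<nu> (\<lambda>x. g x * \<nu> x) x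
    \<le> maxop N \<nu> (\<lambda>x. (if k \<le> g x then g x * \<nu> x else 0)) x + k"
proof (rule maxop_least)
  fix c r assume r: "0 < r" "x \<in> ball c r"
  have [measurable]: "\<nu> \<in> borel_measurable lebesgue" and fin: "ball_int \<nu> c r < top" and "0 \<le> N"
    using \<nu> r by (auto simp: gauge_doubling_def)
  have pos: "0 < ball_int \<nu> c r"
    using \<nu> r by (intro ball_int_pos) (auto simp: gauge_doubling_def)
  let ?h = "\<lambda>x. (if k \<le> g x then g x * \<nu> x else 0)"
  let ?w = "ennreal (d c r powr N) * ball_int \<nu> c r"
  have d1: "1 \<le> d c r powr N"
    using gauge_ge_one[OF r(1), of c] \<open>0 \<le> N\<close> by (simp add: ge_one_powr_ge_zero)
  have "ball_int (\<lambda>x. g x * \<nu> x) c r \<le> ball_int (\<lambda>x. ?h x + k * \<nu> x) c r"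
    by (intro ball_int_mono) (auto intro: mult_right_mono)
  also have "\<dots> = ball_int ?h c r + k * ball_int \<nu> c r"
    by (simp add: ball_int_add ball_int_cmult)
  finally have "ball_int (\<lambda>x. g x * \<nu> x) c r / ?w \<le> (ball_int ?h c r + k * ball_int \<nu> c r) / ?w"
    by (rule divide_right_mono_ennreal)
  also have "\<dots> = ball_int ?h c r / ?w + k * ball_int \<nu> c r / ?w"
    by (rule add_divide_distrib_ennreal)
  also have "\<dots> \<le> maxop N \<nu> ?h x + k"
  proof (rule add_mono)
    have "k * ball_int \<nu> c r / ?w \<le> k * ball_int \<nu> c r / (1 * ball_int \<nu> c r)"
      using d1 by (intro ennreal_divide_mono mult_right_mono) auto
    also have "\<dots> = k"
      using pos fin by (simp add: ennreal_mult_divide_eq)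
    finally show "k * ball_int \<nu> c r / ?w \<le> k" .
  qed (rule maxop_upper[OF r])
  finally show "ball_int (\<lambda>x. g x * \<nu> x) c r / ?w \<le> maxop N \<nu> ?h x + k" .
qed

text \<open>Marcinkiewicz interpolation between the weak type bound and the trivial bound for
  bounded functions: at each level only the part of g above a fixed fraction of that level
  counts.\<close>

lemma maxop_strong_type:
  assumes \<nu>: "gauge_doubling N D \<nu>" and [measurable]: "g \<in> borel_measurable lebesgue" and q: "1 < q"
  shows "(\<integral>\<^sup>+x. epowr (maxop N \<nu> (\<lambda>x. g x * \<nu> x) x) q * \<nu> x \<partial>lebesgue)
    \<le> ennreal (2 * D * q / (q - 1) * 4 powr (q - 1)) * (\<integral>\<^sup>+x. epowr (g x) q * \<nu> x \<partial>lebesgue)"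
proof -
  have [measurable]: "\<nu> \<in> borel_measurable lebesgue" and D: "0 < D"
    using \<nu> by (auto simp: gauge_doubling_def)
  interpret pair_sigma_finite "lebesgue :: 'a measure" "lborel :: real measure"
    by (intro pair_sigma_finite.intro sigma_finite_lebesgue sigma_finite_lborel)
  let ?m = "maxop N \<nu> (\<lambda>x. g x * \<nu> x)"
  have level: "(\<integral>\<^sup>+x. (if ennreal (exp (- u)) \<le> ?m x then \<nu> x else 0) \<partial>lebesgue)
      \<le> ennreal (2 * D * exp u) * (\<integral>\<^sup>+x. (if ennreal (exp (- u)) \<le> 4 * g x then g x * \<nu> x else 0) \<partial>lebesgue)" for u
  proof -
    \<comment> \<open>The level is 4k. Removing the part of g below k leaves a maximal function of
      at least 3k, which exceeds 2k strictly, as the weak type bound demands.\<close>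
    define k where "k = exp (- u) / 4"
    define h where "h = (\<lambda>x. (if ennreal k \<le> g x then g x * \<nu> x else 0))"
    have [measurable]: "h \<in> borel_measurable lebesgue"
      unfolding h_def by measurable
    have k: "0 < k" and k4: "exp (- u) = 4 * k"
      by (auto simp: k_def)
    have "ennreal (2 * k) < maxop N \<nu> h x" if "ennreal (4 * k) \<le> ?m x" for x
    proof -
      have le: "ennreal (4 * k) \<le> maxop N \<nu> h x + ennreal k"
        using order_trans[OF that maxop_le_add[OF _ \<nu>, of g x "ennreal k"]] by (simp add: h_def)
      show ?thesis
      proof (cases "maxop N \<nu> h x")
        case (real r)
        then have "4 * k \<le> r + k"
          using le k by (simp flip: ennreal_plus)
        then show ?thesis
          using real k by (simp add: ennreal_less_iff)
      qed simp
    qed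
    then have "(\<integral>\<^sup>+x. (if ennreal (exp (- u)) \<le> ?m x then \<nu> x else 0) \<partial>lebesgue)
       \<le> (\<integral>\<^sup>+x. \<nu> x * indicator {x. ennreal (2 * k) < maxop N \<nu> h x} x \<partial>lebesgue)"
      by (intro nn_integral_mono) (auto simp: k4)
    also have "\<dots> = ennreal (1 / (2 * k)) * (ennreal (2 * k) *
        (\<integral>\<^sup>+x. \<nu> x * indicator {x. ennreal (2 * k) < maxop N \<nu> h x} x \<partial>lebesgue))"
      using k by (simp add: mult.assoc[symmetric] ennreal_mult[symmetric])
    also have "\<dots> \<le> ennreal (1 / (2 * k)) * (ennreal D * (\<integral>\<^sup>+x. h x \<partial>lebesgue))"
      by (intro mult_left_mono maxop_weak_type[OF \<nu>]) auto
    also have "\<dots> = ennreal (1 / (2 * k) * D) * (\<integral>\<^sup>+x. h x \<partial>lebesgue)"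
      using k D by (subst ennreal_mult) (auto simp: mult.assoc)
    also have "1 / (2 * k) * D = 2 * D * exp u"
      by (simp add: k_def exp_minus field_simps)
    also have "h = (\<lambda>x. (if ennreal (exp (- u)) \<le> 4 * g x then g x * \<nu> x else 0))"
    proof
      fix x
      have "ennreal k \<le> g x \<longleftrightarrow> 4 * ennreal k \<le> 4 * g x"
        by (subst ennreal_mult_le_mult_iff) auto
      also have "4 * ennreal k = ennreal (exp (- u))"
        using k by (simp add: k4 ennreal_mult)
      finally show "h x = (if ennreal (exp (- u)) \<le> 4 * g x then g x * \<nu> x else 0)"
        by (simp add: h_def)
    qed
    finally show ?thesis .
  qed
  define P where "P = 2 * D * q / (q - 1)"
  have P: "0 < P"
    using D q by (simp add: P_def)
  have "(\<integral>\<^sup>+x. epowr (?m x) q * \<nu> x \<partial>lebesgue)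
      = (\<integral>\<^sup>+x. (\<integral>\<^sup>+u. (if ennreal (exp (- u)) \<le> ?m x then ennreal (q * exp (- q * u)) else 0) * \<nu> x \<partial>lborel) \<partial>lebesgue)"
    using q by (subst nn_integral_multc) (auto simp: epowr_layer_cake simp del: mult_minus_left)
  also have "\<dots> = (\<integral>\<^sup>+u. (\<integral>\<^sup>+x. (if ennreal (exp (- u)) \<le> ?m x then ennreal (q * exp (- q * u)) else 0) * \<nu> x \<partial>lebesgue) \<partial>lborel)"
    by (rule Fubini'[symmetric]) measurable
  also have "\<dots> = (\<integral>\<^sup>+u. ennreal (q * exp (- q * u)) * (\<integral>\<^sup>+x. (if ennreal (exp (- u)) \<le> ?m x then \<nu> x else 0) \<partial>lebesgue) \<partial>lborel)"
    by (subst nn_integral_cmult[symmetric]) (auto intro!: nn_integral_cong)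
  also have "\<dots> \<le> (\<integral>\<^sup>+u. ennreal (q * exp (- q * u)) * (ennreal (2 * D * exp u) *
      (\<integral>\<^sup>+x. (if ennreal (exp (- u)) \<le> 4 * g x then g x * \<nu> x else 0) \<partial>lebesgue)) \<partial>lborel)"
    by (intro nn_integral_mono mult_left_mono level) auto
  also have "\<dots> = (\<integral>\<^sup>+u. (\<integral>\<^sup>+x. ennreal P * ((if ennreal (exp (- u)) \<le> 4 * g x then ennreal ((q - 1) * exp (- (q - 1) * u)) else 0)
      * (g x * \<nu> x)) \<partial>lebesgue) \<partial>lborel)"
  proof (rule nn_integral_cong)
    fix u :: real
    \<comment> \<open>The weak type bound contributes exp u, the reciprocal of the level; this
      lowers the exponent of the layer cake density from q to q - 1.\<close>
    have "exp (- q * u) * exp u = exp (- (q - 1) * u)"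
      by (simp add: algebra_simps flip: exp_add)
    moreover have "P * (q - 1) = 2 * D * q"
      using q by (simp add: P_def)
    ultimately have "q * exp (- q * u) * (2 * D * exp u) = P * ((q - 1) * exp (- (q - 1) * u))"
      by (simp add: mult_ac) (simp add: mult.assoc[symmetric])
    then have *: "ennreal (q * exp (- q * u)) * ennreal (2 * D * exp u) = ennreal P * ennreal ((q - 1) * exp (- (q - 1) * u))"
      using q D P by (simp flip: ennreal_mult)
    show "ennreal (q * exp (- q * u)) * (ennreal (2 * D * exp u) *
        (\<integral>\<^sup>+x. (if ennreal (exp (- u)) \<le> 4 * g x then g x * \<nu> x else 0) \<partial>lebesgue))
      = (\<integral>\<^sup>+x. ennreal P * ((if ennreal (exp (- u)) \<le> 4 * g x then ennreal ((q - 1) * exp (- (q - 1) * u)) else 0)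
        * (g x * \<nu> x)) \<partial>lebesgue)"
      unfolding mult.assoc[symmetric] *
      by (subst nn_integral_cmult[symmetric]) (auto intro!: nn_integral_cong simp: mult_ac)
  qed
  also have "\<dots> = (\<integral>\<^sup>+x. (\<integral>\<^sup>+u. ennreal P * ((if ennreal (exp (- u)) \<le> 4 * g x then ennreal ((q - 1) * exp (- (q - 1) * u)) else 0)
      * (g x * \<nu> x)) \<partial>lborel) \<partial>lebesgue)"
    by (rule Fubini') measurable
  \<comment> \<open>The inner integral is the layer cake formula for 4 g with exponent q - 1; the
    remaining factor g restores the exponent q.\<close>
  also have "\<dots> = (\<integral>\<^sup>+x. ennreal P * (epowr (4 * g x) (q - 1) * (g x * \<nu> x)) \<partial>lebesgue)"
    using q by (simp add: nn_integral_cmult nn_integral_multc epowr_layer_cake del: mult_minus_left minus_diff_eq)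
  also have "\<dots> = (\<integral>\<^sup>+x. ennreal (P * 4 powr (q - 1)) * (epowr (g x) q * \<nu> x) \<partial>lebesgue)"
  proof (rule nn_integral_cong)
    fix x
    have "epowr (4 * g x) (q - 1) * g x = ennreal (4 powr (q - 1)) * epowr (g x) q"
      using epowr_add[of "g x" "q - 1" 1] epowr_ennreal[of 4 "q - 1"] by (simp add: epowr_mult mult.assoc)
    then show "ennreal P * (epowr (4 * g x) (q - 1) * (g x * \<nu> x)) = ennreal (P * 4 powr (q - 1)) * (epowr (g x) q * \<nu> x)"
      using P by (simp add: ennreal_mult mult_ac)
  qed
  finally show ?thesis
    by (simp add: P_def nn_integral_cmult)
qed

end

section \<open>Weights and the boundedness of the maximal operator\<close>

lemma ennreal_divide_conv_mult: "0 < a \<Longrightarrow> x / ennreal a = x * ennreal (1 / a)"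
  by (simp add: divide_ennreal_def inverse_ennreal inverse_eq_divide)

lemma emeasure_ball_real: 
  "0 < r \<Longrightarrow> \<exists>b>0. emeasure lebesgue (ball (c::'a::euclidean_space) r) = ennreal b"
  by (intro exI[of _ "measure lebesgue (ball c r)"] conjI)
     (auto simp: content_ball_pos emeasure_eq_measure2 fmeasurableD2)

lemma emeasure_ball_dilate:
  assumes "0 < k"
  shows "emeasure lebesgue (ball (c::'a::euclidean_space) (k * r))
    = ennreal (k ^ DIM('a)) * emeasure lebesgue (ball c r)"
proof -
  have "emeasure lebesgue (ball c r) = ennreal (measure lebesgue (ball c r))" for r
    by (simp add: emeasure_eq_measure2 fmeasurableD2)
  then show ?thesis
    using assms by (cases "0 \<le> r")
      (auto simp: content_ball power_mult_distrib mult_ac ennreal_mult[symmetric] mult_nonneg_nonpos mult_less_0_iff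
        ball_empty)
qed

text \<open>This is u^(1-q') with q' = q / (q - 1), the weight for which the dual of L^q(u) under
  the unweighted pairing is L^(q') of it.\<close>

definition dual_weight :: "real \<Rightarrow> ('a \<Rightarrow> ennreal) \<Rightarrow> 'a \<Rightarrow> ennreal" where
  "dual_weight q u x = epowr (u x) (- 1 / (q - 1))"

lemma dual_weight_measurable [measurable]:
  "u \<in> borel_measurable M \<Longrightarrow> dual_weight q u \<in> borel_measurable M"
  unfolding dual_weight_def[abs_def] by (rule epowr_measurable)

lemma dual_weight_pos [simp]: "0 < dual_weight q u x \<longleftrightarrow> 0 < u x"
  and dual_weight_less_top [simp]: "dual_weight q u x < top \<longleftrightarrow> u x < top"
  by (simp_all add: dual_weight_def)

lemma dual_weight_dual: "1 < q \<Longrightarrow> dual_weight (q / (q - 1)) (dual_weight q u) = u"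
proof -
  assume q: "1 < q"
  then have "q / (q - 1) - 1 = 1 / (q - 1)"
    by (simp add: field_simps)
  moreover have "(1 - q) / (q - 1) = - 1"
    using q by (simp add: field_simps)
  ultimately show ?thesis
    using q by (intro ext) (simp add: dual_weight_def)
qed

context ball_gauge
begin

text \<open>
  The condition \<open>A\<^sub>q\<close> with the averages cleared of denominators. The exponent \<open>N\<close> collects all powers
  of the gauge, so \<open>\<theta>\<close> in the original definition corresponds to \<open>N = \<theta> q\<close>.
\<close>

definition muckenhoupt :: "real \<Rightarrow> real \<Rightarrow> real \<Rightarrow> ('a \<Rightarrow> ennreal) \<Rightarrow> bool" where
  "muckenhoupt q N K u \<longleftrightarrow> 0 \<le> N \<and> 0 < K \<and> u \<in> borel_measurable lebesgue \<and> (\<forall>x. 0 < u x \<and> u x < top) \<and>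
     (\<forall>c r. 0 < r \<longrightarrow> ball_int u c r * epowr (ball_int (dual_weight q u) c r) (q - 1)
        \<le> ennreal (K * d c r powr N) * epowr (emeasure lebesgue (ball c r)) q)"

lemma muckenhoupt_measurable: "muckenhoupt q N K u \<Longrightarrow> u \<in> borel_measurable lebesgue"
  by (simp add: muckenhoupt_def)

lemma muckenhoupt_pos: "muckenhoupt q N K u \<Longrightarrow> 0 < u x"
  by (simp add: muckenhoupt_def)

lemma muckenhoupt_finite: "muckenhoupt q N K u \<Longrightarrow> u x < top"
  by (simp add: muckenhoupt_def)

lemma muckenhoupt_ineq:
  "muckenhoupt q N K u \<Longrightarrow> 0 < r \<Longrightarrow> ball_int u c r * epowr (ball_int (dual_weight q u) c r) (q - 1)
     \<le> ennreal (K * d c r powr N) * epowr (emeasure lebesgue (ball c r)) q"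
  by (simp add: muckenhoupt_def)

text \<open>The A_q inequality raised to the power 1 / (q - 1); hence the growth exponent is divided
  by q - 1.\<close>

lemma muckenhoupt_dual:
  assumes u: "muckenhoupt q N K u" and q: "1 < q"
  shows "muckenhoupt (q / (q - 1)) (N / (q - 1)) (K powr (1 / (q - 1))) (dual_weight q u)"
proof -
  have q': "q / (q - 1) - 1 = 1 / (q - 1)"
    using q by (simp add: field_simps)
  have "ball_int (dual_weight q u) c r * epowr (ball_int u c r) (1 / (q - 1))
     \<le> ennreal (K powr (1 / (q - 1)) * d c r powr (N / (q - 1)))
       * epowr (emeasure lebesgue (ball c r)) (q / (q - 1))" if r: "0 < r" for c r
  proof -
    have "ball_int (dual_weight q u) c r * epowr (ball_int u c r) (1 / (q - 1))
      = epowr (ball_int u c r * epowr (ball_int (dual_weight q u) c r) (q - 1)) (1 / (q - 1))"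
      using q by (simp add: epowr_mult mult_ac)
    also have "\<dots> \<le> epowr (ennreal (K * d c r powr N) * epowr (emeasure lebesgue (ball c r)) q) (1 / (q - 1))"
      using q by (intro epowr_mono muckenhoupt_ineq[OF u r]) auto
    also have "\<dots> = ennreal (K powr (1 / (q - 1)) * d c r powr (N / (q - 1)))
       * epowr (emeasure lebesgue (ball c r)) (q / (q - 1))"
      using u gauge_ge_one[OF r, of c] by (simp add: muckenhoupt_def epowr_mult epowr_ennreal powr_mult powr_powr)
    finally show ?thesis .
  qed
  then show ?thesis
    using u q by (auto simp: muckenhoupt_def dual_weight_dual q')
qed

text \<open>Local integrability is a consequence of the A_q inequality: its right side is finite and
  the dual factor is positive.\<close>

lemma muckenhoupt_ball_finite:
  assumes u: "muckenhoupt q N K u" and q: "1 < q" and r: "0 < r"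
  shows "ball_int u c r < top"
proof -
  have "0 < ball_int (dual_weight q u) c r"
    using u r by (intro ball_int_pos) (auto simp: muckenhoupt_def)
  moreover have "ball_int u c r * epowr (ball_int (dual_weight q u) c r) (q - 1) < top"
  proof -
    have "ennreal (K * d c r powr N) * epowr (emeasure lebesgue (ball c r)) q < top"
      using emeasure_ball_real[OF r, of c] by (auto simp: ennreal_mult_less_top)
    then show ?thesis
      using muckenhoupt_ineq[OF u r] by (rule order_le_less_trans[rotated])
  qed
  ultimately show ?thesis
    by (auto simp: ennreal_mult_less_top)
qed

text \<open>Hoelder for 1 = u^(1/q) v^(1-1/q) on the ball B, with v the dual weight, gives |B|^q at
  most 2^q u(B) v(5B)^(q-1). Multiplying by u(5B) and using A_q on 5B yields the claim: 5^N comes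
  from the gauge of 5B and 5^(q n) from |5B|^q, where n is the dimension.\<close>

lemma muckenhoupt_doubling:
  assumes u: "muckenhoupt q N K u" and q: "1 < q"
  shows "gauge_doubling N (2 powr q * K * 5 powr N * 5 powr (q * DIM('a))) u"
proof -
  have u_meas [measurable]: "u \<in> borel_measurable lebesgue" and K: "0 < K" and N: "0 \<le> N"
    using u by (auto simp: muckenhoupt_def)
  have "ball_int u c (5 * r) \<le> ennreal (2 powr q * K * 5 powr N * 5 powr (q * DIM('a)) * d c r powr N) * ball_int u c r"
    if r: "0 < r" for c r
  proof -
    let ?v = "dual_weight q u"
    define b where "b = emeasure lebesgue (ball c r)"
    have b: "0 < b" "b < top"
      using emeasure_ball_real[OF r, of c] by (auto simp: b_def)
    have "b = (\<integral>\<^sup>+x. epowr (u x * indicator (ball c r) x) (1 / q) * epowr (?v x * indicator (ball c r) x) (1 - 1 / q) \<partial>lebesgue)"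
      unfolding b_def
    proof (subst nn_integral_indicator[symmetric], simp, rule nn_integral_cong)
      fix x
      have "1 / q = (1 - 1 / q) / (q - 1)"
        using q by (simp add: field_simps)
      then have "epowr (u x) (1 / q) * epowr (?v x) (1 - 1 / q) = 1"
        using u by (auto simp: dual_weight_def muckenhoupt_def intro!: epowr_cancel)
      then show "indicator (ball c r) x = epowr (u x * indicator (ball c r) x) (1 / q) * epowr (?v x * indicator (ball c r) x) (1 - 1 / q)"
        by (auto simp: indicator_def)
    qed
    also have "\<dots> \<le> 2 * (epowr (ball_int u c r) (1 / q) * epowr (ball_int ?v c r) (1 - 1 / q))"
      unfolding ball_int_def using q by (intro nn_integral_Hoelder) auto
    finally have "epowr b q \<le> epowr (2 * (epowr (ball_int u c r) (1 / q) * epowr (ball_int ?v c r) (1 - 1 / q))) q"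
      using q by (intro epowr_mono) auto
    also have "\<dots> = epowr 2 q * ball_int u c r * epowr (ball_int ?v c r) (q - 1)"
      using q by (simp add: epowr_mult mult.assoc left_diff_distrib)
    also have "\<dots> \<le> epowr 2 q * ball_int u c r * epowr (ball_int ?v c (5 * r)) (q - 1)"
      unfolding ball_int_def using q r
      by (intro mult_left_mono epowr_mono nn_integral_mono) (auto simp: indicator_def)
    finally have "ball_int u c (5 * r) * epowr b q
      \<le> ball_int u c (5 * r) * (epowr 2 q * ball_int u c r * epowr (ball_int ?v c (5 * r)) (q - 1))"
      by (rule mult_left_mono) simp
    also have "\<dots> = epowr 2 q * ball_int u c r * (ball_int u c (5 * r) * epowr (ball_int ?v c (5 * r)) (q - 1))"
      by (simp add: mult_ac)
    also have "\<dots> \<le> epowr 2 q * ball_int u c r * (ennreal (K * d c (5 * r) powr N) * epowr (emeasure lebesgue (ball c (5 * r))) q)"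
      using r by (intro mult_left_mono muckenhoupt_ineq[OF u]) auto
    also have "\<dots> \<le> epowr 2 q * ball_int u c r * (ennreal (K * (5 * d c r) powr N) * epowr (emeasure lebesgue (ball c (5 * r))) q)"
      using r K N gauge_dilate[OF r, of c] gauge_ge_one[of "5 * r" c]
      by (intro mult_left_mono mult_right_mono ennreal_leI powr_mono2) auto
    also have "\<dots> = ennreal (2 powr q * K * 5 powr N * 5 powr (q * DIM('a)) * d c r powr N) * ball_int u c r * epowr b q"
    proof -
      have "epowr (emeasure lebesgue (ball c (5 * r))) q = ennreal (5 powr (q * DIM('a))) * epowr b q"
      proof -
        have "emeasure lebesgue (ball c (5 * r)) = ennreal (5 ^ DIM('a)) * b"
          using emeasure_ball_dilate[of 5 c r] by (simp add: b_def)
        then show ?thesis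
          by (simp only: epowr_mult) (simp add: epowr_ennreal powr_powr mult.commute flip: powr_realpow)
      qed
      moreover have "epowr 2 q = ennreal (2 powr q)"
        using epowr_ennreal[of 2 q] by simp
      ultimately show ?thesis
        using K gauge_ge_one[OF r, of c] by (simp add: powr_mult ennreal_mult mult_ac)
    qed
    finally show ?thesis
      using b by (subst (asm) (1 2) mult.commute[of _ "epowr b q"]) (simp add: ennreal_mult_le_mult_iff less_top[symmetric])
  qed
  then show ?thesis
    using u K N muckenhoupt_ball_finite[OF u q] by (auto simp: gauge_doubling_def muckenhoupt_def)
qed

abbreviation maxop1 :: "real \<Rightarrow> ('a \<Rightarrow> ennreal) \<Rightarrow> 'a \<Rightarrow> ennreal" where
  "maxop1 N \<equiv> maxop N (\<lambda>_. 1)"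

lemma ball_int_one [simp]: "ball_int (\<lambda>_. 1) c r = emeasure lebesgue (ball c r)"
  by (simp add: ball_int_def)

text \<open>
  The \<open>A\<^sub>q\<close> condition turns the Lebesgue average of \<open>f\<close> over a ball into an average with respect to the
  dual weight. The inner maximal function exceeds the latter on the whole ball, so its power may be
  averaged over the ball with respect to \<open>u\<close>.
\<close>

lemma maxop1_Lerner:
  assumes u: "muckenhoupt q N K u" and q: "1 < q"
    and \<theta>: "\<theta> * (q - 1) = N + N\<^sub>1 + N\<^sub>2 * (q - 1)"
  shows "epowr (maxop1 \<theta> f x) (q - 1)
    \<le> ennreal K * maxop N\<^sub>1 u (\<lambda>y. epowr (maxop N\<^sub>2 (dual_weight q u) f y) (q - 1)) x"
proof -
  let ?v = "dual_weight q u"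
  let ?F = "\<lambda>y. epowr (maxop N\<^sub>2 ?v f y) (q - 1)"
  have u_meas [measurable]: "u \<in> borel_measurable lebesgue" and K: "0 < K"
    using u by (auto simp: muckenhoupt_def)
  have "epowr (ball_int f c r / (ennreal (d c r powr \<theta>) * ball_int (\<lambda>_. 1) c r)) (q - 1)
      \<le> ennreal K * maxop N\<^sub>1 u ?F x" if r: "0 < r" "x \<in> ball c r" for c r
  proof -
    define \<delta> I where "\<delta> = d c r" and "I = ball_int f c r"
    have \<delta>: "1 \<le> \<delta>"
      using gauge_ge_one[OF r(1)] by (simp add: \<delta>_def)
    obtain b where b: "0 < b" "emeasure lebesgue (ball c r) = ennreal b"
      using emeasure_ball_real[OF r(1)] by blast
    obtain U where U: "0 < U" "ball_int u c r = ennreal U"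
      using muckenhoupt_ball_finite[OF u q r(1), of c] ball_int_pos[of u r c] muckenhoupt_pos[OF u] r
      by (cases "ball_int u c r") auto
    obtain W where W: "0 < W" "ball_int ?v c r = ennreal W"
      using muckenhoupt_ball_finite[OF muckenhoupt_dual[OF u q] _ r(1), of c] ball_int_pos[of ?v r c] muckenhoupt_pos[OF u] r q
      by (cases "ball_int ?v c r") auto
    have UW: "U * W powr (q - 1) \<le> K * \<delta> powr N * b powr q"
      using muckenhoupt_ineq[OF u r(1), of c] U W b K \<delta>
      by (simp add: epowr_ennreal \<delta>_def ennreal_mult[symmetric])
    have "epowr (I / (ennreal (\<delta> powr N\<^sub>2) * ennreal W)) (q - 1) * ennreal b \<le> ball_int ?F c r"
    proof -
      have "epowr (I / (ennreal (\<delta> powr N\<^sub>2) * ennreal W)) (q - 1) * ennreal b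
        = ball_int (\<lambda>_. epowr (I / (ennreal (\<delta> powr N\<^sub>2) * ennreal W)) (q - 1) * 1) c r"
        by (subst ball_int_cmult) (auto simp: b)
      also have "\<dots> \<le> ball_int ?F c r"
        using maxop_upper[OF r(1), of _ c f N\<^sub>2 ?v] q W
        by (intro ball_int_mono) (auto simp: I_def \<delta>_def intro!: epowr_mono)
      finally show ?thesis .
    qed
    then have "epowr (I / (ennreal (\<delta> powr N\<^sub>2) * ennreal W)) (q - 1) * ennreal b / (ennreal (\<delta> powr N\<^sub>1) * ennreal U)
        \<le> ball_int ?F c r / (ennreal (\<delta> powr N\<^sub>1) * ennreal U)"
      by (rule divide_right_mono_ennreal)
    also have "\<dots> \<le> maxop N\<^sub>1 u ?F x"
      using maxop_upper[OF r, of ?F N\<^sub>1 u] by (simp add: \<delta>_def U)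
    finally have *: "ennreal K * (epowr (I / (ennreal (\<delta> powr N\<^sub>2) * ennreal W)) (q - 1) * ennreal b / (ennreal (\<delta> powr N\<^sub>1) * ennreal U))
       \<le> ennreal K * maxop N\<^sub>1 u ?F x"
      by (rule mult_left_mono) simp
    have "epowr (I / (ennreal (\<delta> powr \<theta>) * ennreal b)) (q - 1)
        = epowr I (q - 1) * ennreal (1 / (\<delta> powr (\<theta> * (q - 1)) * b powr (q - 1)))"
      using \<delta> b by (simp add: ennreal_mult[symmetric] ennreal_divide_conv_mult epowr_mult epowr_ennreal powr_divide powr_mult powr_powr)
    also have "\<dots> \<le> epowr I (q - 1) * ennreal (K * (1 / (\<delta> powr (N\<^sub>2 * (q - 1)) * W powr (q - 1)) * b * (1 / (\<delta> powr N\<^sub>1 * U))))"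
    \<comment> \<open>The A_q inequality \<open>UW\<close> bounds 1 / b^(q-1) by K b \<delta>^N / (U
      W^(q-1)); the three gauge powers add up to \<theta> (q - 1).\<close>
    proof (intro mult_left_mono ennreal_leI)
      have "b powr q = b powr (q - 1) * b"
        using b powr_add[of b "q - 1" 1] by simp
      then have "U * W powr (q - 1) * (\<delta> powr (N\<^sub>2 * (q - 1)) * \<delta> powr N\<^sub>1)
        \<le> K * b * (b powr (q - 1)) * (\<delta> powr N * (\<delta> powr (N\<^sub>2 * (q - 1)) * \<delta> powr N\<^sub>1))"
        using mult_right_mono[OF UW, of "\<delta> powr (N\<^sub>2 * (q - 1)) * \<delta> powr N\<^sub>1"] by (simp add: mult_ac)
      moreover have "\<delta> powr (\<theta> * (q - 1)) = \<delta> powr N * (\<delta> powr (N\<^sub>2 * (q - 1)) * \<delta> powr N\<^sub>1)"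
        by (simp add: \<theta> powr_add mult_ac)
      ultimately show "1 / (\<delta> powr (\<theta> * (q - 1)) * b powr (q - 1))
          \<le> K * (1 / (\<delta> powr (N\<^sub>2 * (q - 1)) * W powr (q - 1)) * b * (1 / (\<delta> powr N\<^sub>1 * U)))"
        using \<delta> b U W by (simp add: divide_simps mult_ac)
    qed auto
    also have "\<dots> = ennreal K * (epowr (I / (ennreal (\<delta> powr N\<^sub>2) * ennreal W)) (q - 1) * ennreal b / (ennreal (\<delta> powr N\<^sub>1) * ennreal U))"
    proof -
      have "epowr (I / (ennreal (\<delta> powr N\<^sub>2) * ennreal W)) (q - 1)
          = epowr I (q - 1) * ennreal (1 / (\<delta> powr (N\<^sub>2 * (q - 1)) * W powr (q - 1)))"
        using \<delta> W by (simp add: ennreal_mult[symmetric] ennreal_divide_conv_mult epowr_mult epowr_ennreal powr_divide powr_mult powr_powr)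
      moreover have "X / (ennreal (\<delta> powr N\<^sub>1) * ennreal U) = X * ennreal (1 / (\<delta> powr N\<^sub>1 * U))" for X
        using \<delta> U by (simp add: ennreal_mult[symmetric] ennreal_divide_conv_mult)
      moreover have "ennreal (K * (1 / (\<delta> powr (N\<^sub>2 * (q - 1)) * W powr (q - 1)) * b * (1 / (\<delta> powr N\<^sub>1 * U))))
          = ennreal K * (ennreal (1 / (\<delta> powr (N\<^sub>2 * (q - 1)) * W powr (q - 1))) * ennreal b * ennreal (1 / (\<delta> powr N\<^sub>1 * U)))"
      proof -
        have *: "ennreal (K * (s * b * t)) = ennreal K * (ennreal s * ennreal b * ennreal t)" if "0 \<le> s" "0 \<le> t" for s t
          using K b that by (simp add: ennreal_mult)
        show ?thesis
          by (rule *) (use U in auto)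
      qed
      ultimately show ?thesis
        by (simp only: mult_ac)
    qed
    also note *
    finally show ?thesis
      by (simp add: b I_def \<delta>_def)
  qed
  \<comment> \<open>The power q - 1 is moved to the right side before the supremum over balls is
    taken, so that the least upper bound property applies to \<open>maxop1\<close> itself.\<close>
  then have "maxop1 \<theta> f x \<le> epowr (ennreal K * maxop N\<^sub>1 u ?F x) (1 / (q - 1))"
    using q by (intro maxop_least) (simp add: epowr_le_iff)
  then show ?thesis
    using q by (simp add: epowr_le_iff)
qed

text \<open>The constant is written as a q-th power so that \<open>B\<close> bounds the operator
  norm on L^q(u) and the same \<open>B\<close> can serve several exponents.\<close>

definition maxop_bounded :: "real \<Rightarrow> real \<Rightarrow> real \<Rightarrow> ('a \<Rightarrow> ennreal) \<Rightarrow> bool" where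
  "maxop_bounded \<theta> B q u \<longleftrightarrow> (\<forall>f\<in>borel_measurable lebesgue.
     (\<integral>\<^sup>+x. epowr (maxop1 \<theta> f x) q * u x \<partial>lebesgue) \<le> epowr (ennreal B) q * (\<integral>\<^sup>+x. epowr (f x) q * u x \<partial>lebesgue))"

text \<open>The gauge is at least 1. Bounds obtained with different exponents can therefore be
  merged at the larger one.\<close>

lemma maxop1_antimono: "\<theta> \<le> \<theta>' \<Longrightarrow> maxop1 \<theta>' f x \<le> maxop1 \<theta> f x"
  by (rule maxop_least, rule order_trans[OF _ maxop_upper])
     (auto intro!: ennreal_divide_mono mult_right_mono ennreal_leI powr_mono gauge_ge_one)

lemma maxop_bounded_mono:
  assumes "maxop_bounded \<theta> B q u" "\<theta> \<le> \<theta>'" "B \<le> B'" "0 \<le> q"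
  shows "maxop_bounded \<theta>' B' q u"
  unfolding maxop_bounded_def
proof
  fix f :: "'a \<Rightarrow> ennreal" assume f: "f \<in> borel_measurable lebesgue"
  have "(\<integral>\<^sup>+x. epowr (maxop1 \<theta>' f x) q * u x \<partial>lebesgue) \<le> (\<integral>\<^sup>+x. epowr (maxop1 \<theta> f x) q * u x \<partial>lebesgue)"
    using assms by (intro nn_integral_mono mult_right_mono epowr_mono maxop1_antimono) auto
  also have "\<dots> \<le> epowr (ennreal B) q * (\<integral>\<^sup>+x. epowr (f x) q * u x \<partial>lebesgue)"
    using assms f by (auto simp: maxop_bounded_def)
  also have "\<dots> \<le> epowr (ennreal B') q * (\<integral>\<^sup>+x. epowr (f x) q * u x \<partial>lebesgue)"
    using assms by (intro mult_right_mono epowr_mono ennreal_leI) auto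
  finally show "(\<integral>\<^sup>+x. epowr (maxop1 \<theta>' f x) q * u x \<partial>lebesgue) \<le> epowr (ennreal B') q * (\<integral>\<^sup>+x. epowr (f x) q * u x \<partial>lebesgue)" .
qed

text \<open>The pointwise bound raised to the power q' turns M^(q-1) into M^q. The outer operator is
  bounded on L^(q')(u), the inner one on L^q of the dual weight. The number 3 counts the A_q
  inequality and the doubling of u, which cost N each, and the doubling of the dual weight, which
  costs (q - 1) N / (q - 1).\<close>

theorem muckenhoupt_maxop_bounded:
  assumes q: "1 < q" and N: "0 \<le> N" and K: "0 < K"
  obtains B where "0 < B" "\<And>u. muckenhoupt q N K u \<Longrightarrow> maxop_bounded (3 * N / (q - 1)) B q u"
proof -
  define q' where "q' = q / (q - 1)"
  have q': "1 < q'"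
    using q by (simp add: q'_def)
  \<comment> \<open>\<open>D1\<close> and \<open>D2\<close> are the doubling constants of u and of
    its dual weight, \<open>C1\<close> and \<open>C2\<close> the strong type constants of the outer
    and the inner operator.\<close>
  define D1 where "D1 = 2 powr q * K * 5 powr N * 5 powr (q * DIM('a))"
  define D2 where "D2 = 2 powr q' * K powr (1 / (q - 1)) * 5 powr (N / (q - 1)) * 5 powr (q' * DIM('a))"
  define C1 where "C1 = 2 * D1 * q' / (q' - 1) * 4 powr (q' - 1)"
  define C2 where "C2 = 2 * D2 * q / (q - 1) * 4 powr (q - 1)"
  have C: "0 < C1" "0 < C2"
    using q q' K by (auto simp: C1_def C2_def D1_def D2_def)
  define A where "A = K powr q' * C1 * C2"
  have A: "0 < A"
    using C K by (simp add: A_def)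
  show thesis
  proof
    show "0 < A powr (1 / q)"
      using A by simp
    fix u assume u: "muckenhoupt q N K u"
    show "maxop_bounded (3 * N / (q - 1)) (A powr (1 / q)) q u"
      unfolding maxop_bounded_def
    proof
      fix f :: "'a \<Rightarrow> ennreal" assume f [measurable]: "f \<in> borel_measurable lebesgue"
      let ?v = "dual_weight q u"
      define G where "G y = maxop (N / (q - 1)) ?v f y" for y
      have G_meas [measurable]: "G \<in> borel_measurable lebesgue"
        unfolding G_def[abs_def] by measurable
      have u_meas [measurable]: "u \<in> borel_measurable lebesgue"
        using u by (simp add: muckenhoupt_def)
      have u_pos: "0 < u x" "u x < top" for x
        using u by (auto simp: muckenhoupt_def)
      \<comment> \<open>The strong type bound concerns functions of the form g \<nu>, so each
        argument is rewritten as (f \<nu>^(-1)) \<nu>.\<close>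
      have cancel: "epowr (u x) (-1) * u x = 1" "epowr (?v x) (-1) * ?v x = 1" for x
        using epowr_cancel[of "u x" "-1" 1] epowr_cancel[of "?v x" "-1" 1] u_pos by simp_all
      have "(\<integral>\<^sup>+x. epowr (maxop1 (3 * N / (q - 1)) f x) q * u x \<partial>lebesgue)
          \<le> (\<integral>\<^sup>+x. ennreal (K powr q') * (epowr (maxop N u (\<lambda>y. epowr (G y) (q - 1)) x) q' * u x) \<partial>lebesgue)"
      proof (rule nn_integral_mono)
        fix x
        have "epowr (maxop1 (3 * N / (q - 1)) f x) q = epowr (epowr (maxop1 (3 * N / (q - 1)) f x) (q - 1)) q'"
          using q by (simp add: q'_def)
        also have "\<dots> \<le> epowr (ennreal K * maxop N u (\<lambda>y. epowr (G y) (q - 1)) x) q'"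
          unfolding G_def using q q' by (intro epowr_mono maxop1_Lerner[OF u]) auto
        also have "\<dots> = ennreal (K powr q') * epowr (maxop N u (\<lambda>y. epowr (G y) (q - 1)) x) q'"
          using K by (simp add: epowr_mult epowr_ennreal)
        finally show "epowr (maxop1 (3 * N / (q - 1)) f x) q * u x
            \<le> ennreal (K powr q') * (epowr (maxop N u (\<lambda>y. epowr (G y) (q - 1)) x) q' * u x)"
          unfolding mult.assoc[symmetric] by (rule mult_right_mono) simp
      qed
      also have "\<dots> = ennreal (K powr q') * (\<integral>\<^sup>+x. epowr (maxop N u (\<lambda>y. (epowr (G y) (q - 1) * epowr (u y) (-1)) * u y) x) q' * u x \<partial>lebesgue)"
        by (subst nn_integral_cmult) (auto simp: mult.assoc cancel)
      also have "\<dots> \<le> ennreal (K powr q') * (ennreal C1 * (\<integral>\<^sup>+x. epowr (epowr (G x) (q - 1) * epowr (u x) (-1)) q' * u x \<partial>lebesgue))"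
        unfolding C1_def D1_def
        by (intro mult_left_mono maxop_strong_type muckenhoupt_doubling[OF u q] q') auto
      also have "(\<integral>\<^sup>+x. epowr (epowr (G x) (q - 1) * epowr (u x) (-1)) q' * u x \<partial>lebesgue)
          = (\<integral>\<^sup>+x. epowr (G x) q * ?v x \<partial>lebesgue)"
      proof (rule nn_integral_cong)
        fix x
        have "- q' + 1 = - 1 / (q - 1)"
          using q by (simp add: q'_def field_simps)
        then have "epowr (u x) (- q') * u x = ?v x"
          using epowr_add[of "u x" "-q'" 1] by (simp add: dual_weight_def)
        then show "epowr (epowr (G x) (q - 1) * epowr (u x) (-1)) q' * u x = epowr (G x) q * ?v x"
          using q by (simp add: epowr_mult mult.assoc q'_def)
      qed
      also have "\<dots> = (\<integral>\<^sup>+x. epowr (maxop (N / (q - 1)) ?v (\<lambda>y. (f y * epowr (?v y) (-1)) * ?v y) x) q * ?v x \<partial>lebesgue)"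
        by (simp add: mult.assoc cancel G_def[abs_def])
      also have "ennreal (K powr q') * (ennreal C1 * \<dots>)
         \<le> ennreal (K powr q') * (ennreal C1 * (ennreal C2 * (\<integral>\<^sup>+x. epowr (f x * epowr (?v x) (-1)) q * ?v x \<partial>lebesgue)))"
        unfolding C2_def D2_def using muckenhoupt_doubling[OF muckenhoupt_dual[OF u q]] q'
        by (intro mult_left_mono maxop_strong_type q) (auto simp: q'_def)
      also have "(\<integral>\<^sup>+x. epowr (f x * epowr (?v x) (-1)) q * ?v x \<partial>lebesgue) = (\<integral>\<^sup>+x. epowr (f x) q * u x \<partial>lebesgue)"
      proof (rule nn_integral_cong)
        fix x
        have "epowr (?v x) (- q) * ?v x = epowr (?v x) (- (q - 1))"
          using epowr_add[of "?v x" "-q" 1] by simp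
        also have "\<dots> = u x"
          using q by (simp add: dual_weight_def minus_divide_left[symmetric] del: minus_diff_eq)
        finally show "epowr (f x * epowr (?v x) (-1)) q * ?v x = epowr (f x) q * u x"
          by (simp add: epowr_mult mult.assoc)
      qed
      also have "ennreal (K powr q') * (ennreal C1 * (ennreal C2 * (\<integral>\<^sup>+x. epowr (f x) q * u x \<partial>lebesgue)))
          = epowr (ennreal (A powr (1 / q))) q * (\<integral>\<^sup>+x. epowr (f x) q * u x \<partial>lebesgue)"
      proof -
        have "epowr (ennreal (A powr (1 / q))) q = ennreal (K powr q') * (ennreal C1 * ennreal C2)"
          using A q C by (simp add: epowr_ennreal powr_powr A_def ennreal_mult mult.assoc)
        then show ?thesis
          by (simp add: mult.assoc)
      qed
      finally show "(\<integral>\<^sup>+x. epowr (maxop1 (3 * N / (q - 1)) f x) q * u x \<partial>lebesgue)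
          \<le> epowr (ennreal (A powr (1 / q))) q * (\<integral>\<^sup>+x. epowr (f x) q * u x \<partial>lebesgue)" .
    qed
  qed
qed

end

section \<open>The iteration algorithm of Rubio de Francia\<close>

lemma ball_int_cong_AE: "AE x in lebesgue. f x = g x \<Longrightarrow> ball_int f c r = ball_int g c r"
  unfolding ball_int_def by (rule nn_integral_cong_AE) auto

lemma ball_int_suminf:
  assumes [measurable]: "\<And>n. f n \<in> borel_measurable lebesgue"
  shows "ball_int (\<lambda>x. \<Sum>n. f n x) c r = (\<Sum>n. ball_int (f n) c r)"
proof -
  have "ball_int (\<lambda>x. \<Sum>n. f n x) c r = (\<integral>\<^sup>+x. (\<Sum>n. f n x * indicator (ball c r) x) \<partial>lebesgue)"
    unfolding ball_int_def by simp
  also have "\<dots> = (\<Sum>n. ball_int (f n) c r)"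
    unfolding ball_int_def by (rule nn_integral_suminf) measurable
  finally show ?thesis .
qed

lemma ex_ball_int_pos:
  assumes [measurable]: "h \<in> borel_measurable lebesgue" and nz: "\<not> (AE x in lebesgue. h x = 0)"
  shows "\<exists>n::nat. 0 < ball_int h x (real n + 1)"
proof (rule ccontr)
  assume "\<nexists>n::nat. 0 < ball_int h x (real n + 1)"
  then have "AE y in lebesgue. h y * indicator (ball x (real n + 1)) y = 0" for n :: nat
    unfolding ball_int_def by (subst nn_integral_0_iff_AE[symmetric]) auto
  then have "AE y in lebesgue. \<forall>n::nat. h y * indicator (ball x (real n + 1)) y = 0"
    by (subst AE_all_countable) blast
  then have "AE y in lebesgue. h y = 0"
  proof eventually_elim
    case (elim y)
    obtain n :: nat where "dist x y < real n + 1"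
      using real_arch_simple[of "dist x y"] by (metis less_add_one order_le_less_trans)
    then show ?case
      using elim[rule_format, of n] by auto
  qed
  then show False
    using nz by simp
qed

context ball_gauge
begin

lemma maxop_cong_AE: "AE x in lebesgue. f x = g x \<Longrightarrow> maxop N \<nu> f = maxop N \<nu> g"
  unfolding maxop_def by (auto simp: ball_int_cong_AE[of f g])

lemma maxop_suminf_le:
  assumes [measurable]: "\<And>n. f n \<in> borel_measurable lebesgue"
  shows "maxop N \<nu> (\<lambda>x. \<Sum>n. k n * f n x) x \<le> (\<Sum>n. k n * maxop N \<nu> (f n) x)"
proof (rule maxop_least)
  fix c r assume r: "0 < r" "x \<in> ball c r"
  let ?w = "ennreal (d c r powr N) * ball_int \<nu> c r"
  have "ball_int (\<lambda>x. \<Sum>n. k n * f n x) c r / ?w = (\<Sum>n. k n * (ball_int (f n) c r / ?w))"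
    by (simp add: ball_int_suminf ball_int_cmult ennreal_times_divide)
  also have "\<dots> \<le> (\<Sum>n. k n * maxop N \<nu> (f n) x)"
    by (intro suminf_le mult_left_mono maxop_upper r) auto
  finally show "ball_int (\<lambda>x. \<Sum>n. k n * f n x) c r / ?w \<le> (\<Sum>n. k n * maxop N \<nu> (f n) x)" .
qed

lemma maxop1_pos:
  assumes h [measurable]: "h \<in> borel_measurable lebesgue" and nz: "\<not> (AE x in lebesgue. h x = 0)"
  shows "0 < maxop1 N h x"
proof -
  obtain n :: nat where n: "0 < ball_int h x (real n + 1)"
    using ex_ball_int_pos[OF h nz] by blast
  have "0 < ball_int h x (real n + 1) / (ennreal (d x (real n + 1) powr N) * ball_int (\<lambda>_. 1) x (real n + 1))"
    using n emeasure_ball_real[of "real n + 1" x]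
    by (auto simp: ennreal_zero_less_divide ennreal_mult_less_top)
  also have "\<dots> \<le> maxop1 N h x"
    by (rule maxop_upper) auto
  finally show ?thesis .
qed

text \<open>W is, up to a null set, the sum of (4B)^(-n) M^n h, and applying M shifts the series by
  one term. The ratio is 4B because the norm of the sum is estimated by
  \<open>epowr_suminf_le\<close>, which spends the square roots of the coefficients. W does not
  depend on the space, so one majorant obeys the norm bound in every space on which M has norm at
  most B; the space with index 0 serves to make W finite almost everywhere.\<close>

theorem Rubio_de_Francia:
  assumes B: "0 < B" and h [measurable]: "h \<in> borel_measurable lebesgue" and nz: "\<not> (AE x in lebesgue. h x = 0)"
    and q\<^sub>0: "1 \<le> q\<^sub>0" "maxop_bounded \<theta> B q\<^sub>0 u\<^sub>0" "(\<integral>\<^sup>+x. epowr (h x) q\<^sub>0 * u\<^sub>0 x \<partial>lebesgue) < top"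
    and u\<^sub>0 [measurable]: "u\<^sub>0 \<in> borel_measurable lebesgue" and u\<^sub>0_pos: "\<And>x. 0 < u\<^sub>0 x"
  obtains W where "W \<in> borel_measurable lebesgue" "\<And>x. 0 < W x" "\<And>x. W x < top"
    "AE x in lebesgue. h x \<le> W x" "AE x in lebesgue. maxop1 \<theta> W x \<le> ennreal (4 * B) * W x"
    "\<And>q u. 1 \<le> q \<Longrightarrow> u \<in> borel_measurable lebesgue \<Longrightarrow> maxop_bounded \<theta> B q u \<Longrightarrow>
      (\<integral>\<^sup>+x. epowr (W x) q * u x \<partial>lebesgue) \<le> ennreal (2 powr (q + 1)) * (\<integral>\<^sup>+x. epowr (h x) q * u x \<partial>lebesgue)"
proof -
  define m where "m n = (maxop1 \<theta> ^^ n) h" for n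
  have m_meas [measurable]: "m n \<in> borel_measurable lebesgue" for n
    unfolding m_def by (cases n) auto
  have m_Suc: "maxop1 \<theta> (m n) x = m (Suc n) x" for n x
    by (simp add: m_def)
  define k where "k n = ennreal ((1 / (4 * B)) ^ n)" for n
  define R where "R x = (\<Sum>n. k n * m n x)" for x
  have [measurable]: "R \<in> borel_measurable lebesgue"
    unfolding R_def[abs_def] by measurable
  have R_ge: "h x \<le> R x" for x
    using sum_le_suminf[of "\<lambda>n. k n * m n x" "{0}"] by (simp add: R_def k_def m_def)
  have MR: "maxop1 \<theta> R x \<le> ennreal (4 * B) * R x" for x
  proof -
    have "maxop1 \<theta> R x \<le> (\<Sum>n. k n * maxop1 \<theta> (m n) x)"
      unfolding R_def[abs_def] by (rule maxop_suminf_le) measurable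
    also have "\<dots> = (\<Sum>n. ennreal (4 * B) * (k (Suc n) * m (Suc n) x))"
    proof (rule suminf_cong)
      fix n
      have "k n = ennreal (4 * B) * k (Suc n)"
        using B by (simp add: k_def ennreal_mult[symmetric])
      then show "k n * maxop1 \<theta> (m n) x = ennreal (4 * B) * (k (Suc n) * m (Suc n) x)"
        by (simp add: m_Suc mult.assoc)
    qed
    also have "\<dots> = ennreal (4 * B) * (\<Sum>n. k (Suc n) * m (Suc n) x)"
      by simp
    also have "(\<Sum>n. k (Suc n) * m (Suc n) x) \<le> R x"
    proof (rule suminf_le_const)
      fix n
      have "(\<Sum>i<n. k (Suc i) * m (Suc i) x) = (\<Sum>i\<in>Suc ` {..<n}. k i * m i x)"
        by (simp add: sum.reindex)
      also have "\<dots> \<le> R x"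
        unfolding R_def by (rule sum_le_suminf) auto
      finally show "(\<Sum>i<n. k (Suc i) * m (Suc i) x) \<le> R x" .
    qed simp
    finally show ?thesis
      by (simp add: mult_left_mono)
  qed
  have R_int: "(\<integral>\<^sup>+x. epowr (R x) q * u x \<partial>lebesgue) \<le> ennreal (2 powr (q + 1)) * (\<integral>\<^sup>+x. epowr (h x) q * u x \<partial>lebesgue)"
    if q: "1 \<le> q" and u [measurable]: "u \<in> borel_measurable lebesgue" and bnd: "maxop_bounded \<theta> B q u" for q u
  proof -
    define J where "J = (\<integral>\<^sup>+x. epowr (h x) q * u x \<partial>lebesgue)"
    have m_int: "(\<integral>\<^sup>+x. epowr (m n x) q * u x \<partial>lebesgue) \<le> epowr (ennreal (B ^ n)) q * J" for n
    proof (induction n)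
      case (Suc n)
      have "(\<integral>\<^sup>+x. epowr (m (Suc n) x) q * u x \<partial>lebesgue) \<le> epowr (ennreal B) q * (\<integral>\<^sup>+x. epowr (m n x) q * u x \<partial>lebesgue)"
        using bnd by (simp add: maxop_bounded_def m_Suc[symmetric])
      also have "\<dots> \<le> epowr (ennreal B) q * (epowr (ennreal (B ^ n)) q * J)"
        by (intro mult_left_mono Suc) simp
      also have "\<dots> = epowr (ennreal (B ^ Suc n)) q * J"
        using B by (simp add: mult.assoc[symmetric] epowr_mult[symmetric] ennreal_mult[symmetric])
      finally show ?case .
    qed (simp add: m_def J_def)
    \<comment> \<open>The coefficient is split: B^(-n) normalises the n-th iterate, and 4^(-n) is
      left to make the series converge.\<close>
    define a where "a n x = ennreal ((1 / B) ^ n) * m n x" for n x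
    have [measurable]: "a n \<in> borel_measurable lebesgue" for n
      unfolding a_def[abs_def] by measurable
    have a_int: "(\<integral>\<^sup>+x. epowr (a n x) q * u x \<partial>lebesgue) \<le> J" for n
    proof -
      have "(\<integral>\<^sup>+x. epowr (a n x) q * u x \<partial>lebesgue) = epowr (ennreal ((1 / B) ^ n)) q * (\<integral>\<^sup>+x. epowr (m n x) q * u x \<partial>lebesgue)"
        by (simp add: a_def epowr_mult mult.assoc nn_integral_cmult)
      also have "\<dots> \<le> epowr (ennreal ((1 / B) ^ n)) q * (epowr (ennreal (B ^ n)) q * J)"
        by (intro mult_left_mono m_int) simp
      also have "\<dots> = J"
      proof -
        have "ennreal ((1 / B) ^ n) * ennreal (B ^ n) = 1"
          using B by (simp add: ennreal_mult[symmetric] power_mult_distrib[symmetric])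
        then show ?thesis
          by (simp add: mult.assoc[symmetric] epowr_mult[symmetric])
      qed
      finally show ?thesis .
    qed
    define c where "c n = ennreal ((1 / 4) ^ n)" for n :: nat
    have geom: "(\<Sum>n. ennreal ((1 / 2) ^ n)) = 2"
    proof -
      have "(\<lambda>n. (1 / 2 :: real) ^ n) sums 2"
        using geometric_sums[of "1 / 2 :: real"] by simp
      then have "(\<lambda>n. ennreal ((1 / 2) ^ n)) sums ennreal 2"
        by (subst sums_ennreal) auto
      then show ?thesis
        by (simp only: sums_unique[symmetric]) simp
    qed
    have c_half: "epowr (c n) (1 / 2) = ennreal ((1 / 2) ^ n)" for n
    proof -
      have "((1 / 4 :: real) ^ n) powr (1 / 2) = (((1 / 2) ^ n) powr 2) powr (1 / 2)"
      proof -
        have "((1 / 2 :: real) ^ n) powr 2 = ((1 / 2) ^ 2) ^ n"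
          by (subst powr_numeral) (simp_all only: power_mult[symmetric] mult.commute[of n 2], simp)
        also have "(1 / 2 :: real) ^ 2 = 1 / 4"
          by (simp add: power2_eq_square)
        finally show ?thesis
          by (simp only:)
      qed
      then show ?thesis
        by (simp add: c_def epowr_ennreal powr_powr)
    qed
    \<comment> \<open>Here q >= 1 is used. Both halves of the coefficient are now bounded by 2^(-n);
      they contribute 2^q and 2 to the constant.\<close>
    have c_q: "epowr (c n) (q / 2) \<le> ennreal ((1 / 2) ^ n)" for n
    proof -
      have "epowr (c n) (q / 2) = epowr (epowr (c n) (1 / 2)) q"
        by simp
      also have "\<dots> = ennreal (((1 / 2) ^ n) powr q)"
        by (simp only: c_half) (simp add: epowr_ennreal)
      also have "\<dots> \<le> ennreal (((1 / 2) ^ n) powr 1)"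
        using q by (intro ennreal_leI powr_mono') (auto simp: power_le_one)
      finally show ?thesis
        by simp
    qed
    have "(\<integral>\<^sup>+x. epowr (R x) q * u x \<partial>lebesgue)
        \<le> (\<integral>\<^sup>+x. ennreal (2 powr q) * (\<Sum>n. ennreal ((1 / 2) ^ n) * (epowr (a n x) q * u x)) \<partial>lebesgue)"
    proof (rule nn_integral_mono)
      fix x
      have "k n * m n x = c n * a n x" for n
        using B by (simp add: k_def c_def a_def mult.assoc[symmetric] ennreal_mult[symmetric] power_divide power_mult_distrib)
      then have "epowr (R x) q = epowr (\<Sum>n. c n * a n x) q"
        by (simp add: R_def)
      also have "\<dots> \<le> epowr (\<Sum>n. epowr (c n) (1 / 2)) q * (\<Sum>n. epowr (c n) (q / 2) * epowr (a n x) q)"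
        using q by (intro epowr_suminf_le) simp
      also have "\<dots> \<le> epowr 2 q * (\<Sum>n. ennreal ((1 / 2) ^ n) * epowr (a n x) q)"
        unfolding c_half geom by (intro mult_left_mono suminf_le mult_right_mono c_q) auto
      also have "epowr 2 q = ennreal (2 powr q)"
        using epowr_ennreal[of 2 q] by simp
      finally have "epowr (R x) q * u x \<le> ennreal (2 powr q) * (\<Sum>n. ennreal ((1 / 2) ^ n) * epowr (a n x) q) * u x"
        by (rule mult_right_mono) simp
      then show "epowr (R x) q * u x \<le> ennreal (2 powr q) * (\<Sum>n. ennreal ((1 / 2) ^ n) * (epowr (a n x) q * u x))"
        by (simp add: mult.assoc ennreal_suminf_multc[symmetric])
    qed
    also have "\<dots> = ennreal (2 powr q) * (\<Sum>n. ennreal ((1 / 2) ^ n) * (\<integral>\<^sup>+x. epowr (a n x) q * u x \<partial>lebesgue))"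
      by (simp add: nn_integral_cmult nn_integral_suminf)
    also have "\<dots> \<le> ennreal (2 powr q) * (\<Sum>n. ennreal ((1 / 2) ^ n) * J)"
      by (intro mult_left_mono suminf_le a_int) auto
    also have "\<dots> = ennreal (2 powr q) * 2 * J"
      by (simp add: geom mult.assoc)
    also have "ennreal (2 powr q) * 2 = ennreal (2 powr (q + 1))"
      by (simp add: powr_add ennreal_mult)
    finally show ?thesis
      by (simp add: J_def)
  qed
  \<comment> \<open>Changing R on the null set where it is infinite affects no integral, hence not
    the maximal function either; any positive finite value would do.\<close>
  define W where "W x = (if R x = top then 1 else R x)" for x
  have R_fin: "AE x in lebesgue. R x \<noteq> top"
  proof -
    have "(\<integral>\<^sup>+x. epowr (R x) q\<^sub>0 * u\<^sub>0 x \<partial>lebesgue) < top"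
      using R_int[OF q\<^sub>0(1) u\<^sub>0 q\<^sub>0(2)] q\<^sub>0(3) by (auto simp: ennreal_mult_less_top elim: order_le_less_trans)
    then have "AE x in lebesgue. epowr (R x) q\<^sub>0 * u\<^sub>0 x \<noteq> top"
      by (intro nn_integral_noteq_infinite[unfolded infinity_ennreal_def]) auto
    then show ?thesis
    proof eventually_elim
      case (elim x)
      then show ?case
        using u\<^sub>0_pos[of x] by (auto simp: ennreal_top_mult split: if_splits)
    qed
  qed
  then have RW: "AE x in lebesgue. R x = W x"
    by eventually_elim (simp add: W_def)
  have MRW: "maxop1 \<theta> W = maxop1 \<theta> R"
    by (rule maxop_cong_AE) (use RW in \<open>auto simp: eq_commute\<close>)
  \<comment> \<open>As h is not null, its maximal function is positive at every point, and R
    dominates a multiple of it.\<close>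
  have R_pos: "0 < R x" for x
  proof -
    have "0 < maxop1 \<theta> h x"
      by (rule maxop1_pos[OF h nz])
    also have "\<dots> \<le> maxop1 \<theta> R x"
      by (rule maxop_mono) (rule R_ge)
    also have "\<dots> \<le> ennreal (4 * B) * R x"
      by (rule MR)
    finally show ?thesis
      by (auto simp: zero_less_iff_neq_zero)
  qed
  show thesis
  proof
    show "W \<in> borel_measurable lebesgue"
      unfolding W_def[abs_def] by measurable
    show "0 < W x" "W x < top" for x
      using R_pos[of x] by (auto simp: W_def less_top[symmetric])
    show "AE x in lebesgue. h x \<le> W x"
      using RW by eventually_elim (metis R_ge)
    show "AE x in lebesgue. maxop1 \<theta> W x \<le> ennreal (4 * B) * W x"
      using RW by eventually_elim (metis MR MRW)
    fix q u assume "1 \<le> q" "u \<in> borel_measurable lebesgue" "maxop_bounded \<theta> B q u"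
    moreover have "(\<integral>\<^sup>+x. epowr (W x) q * u x \<partial>lebesgue) = (\<integral>\<^sup>+x. epowr (R x) q * u x \<partial>lebesgue)"
      by (rule nn_integral_cong_AE) (use RW in \<open>eventually_elim, simp\<close>)
    ultimately show "(\<integral>\<^sup>+x. epowr (W x) q * u x \<partial>lebesgue) \<le> ennreal (2 powr (q + 1)) * (\<integral>\<^sup>+x. epowr (h x) q * u x \<partial>lebesgue)"
      using R_int by simp
  qed
qed

end

section \<open>Extrapolation of weighted estimates\<close>

lemma ex_ball_AE:
  assumes "AE x in lebesgue. P x" "0 < r"
  shows "\<exists>y\<in>ball (c::'a::euclidean_space) r. P y"
proof (rule ccontr)
  assume "\<not> (\<exists>y\<in>ball c r. P y)"
  then have "AE x in lebesgue. x \<notin> ball c r"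
    using assms(1) by (auto elim: eventually_mono)
  then have "ball c r \<in> null_sets lebesgue"
    by (simp add: AE_iff_null_sets)
  then have "emeasure lebesgue (ball c r) = 0"
    by (rule null_setsD1)
  then show False
    using emeasure_ball_real[OF \<open>0 < r\<close>, of c] by auto
qed

definition pow_int :: "real \<Rightarrow> ('a::euclidean_space \<Rightarrow> ennreal) \<Rightarrow> ('a \<Rightarrow> ennreal) \<Rightarrow> ennreal" where
  "pow_int p f u = (\<integral>\<^sup>+x. epowr (f x) p * u x \<partial>lebesgue)"

text \<open>The place where a finite left-hand side is indispensable: an infinite a satisfies the
  premise with every c.\<close>

lemma ennreal_absorb_half:
  assumes le: "(a::ennreal) \<le> c + ennreal (1 / 2) * a" and "a < top"
  shows "a \<le> 2 * c"
proof (cases c)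
  case (real s)
  obtain r where r: "0 \<le> r" "a = ennreal r"
    using \<open>a < top\<close> by (cases a) auto
  have eq: "ennreal (s + r / 2) = ennreal s + ennreal (1 / 2) * ennreal r"
    using r real ennreal_mult[of "1 / 2" r] ennreal_plus[of s "r / 2"] by simp
  have "ennreal r \<le> ennreal (s + r / 2)"
    using le unfolding eq r(2) real(2) .
  then have "r \<le> s + r / 2"
    using r real by (subst (asm) ennreal_le_iff) auto
  then have "ennreal r \<le> ennreal (2 * s)"
    by (intro ennreal_leI) simp
  also have "\<dots> = 2 * ennreal s"
    using real by (subst ennreal_mult) auto
  finally show ?thesis
    using r real by simp
qed (simp add: ennreal_mult_top)

section \<open>A_1 weights, their products with A_q weights, and the change of exponent\<close>

context ball_gauge
begin

text \<open>On almost all of a ball, W dominates its own average divided by A and by the gauge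
  power, since the ball competes in the supremum defining the maximal function at each of its
  points.\<close>

lemma A1_ball_lower_bound:
  assumes W [measurable]: "W \<in> borel_measurable lebesgue" and W_pos: "\<And>x. 0 < W x" and W_fin: "\<And>x. W x < top"
    and A: "0 < A" and A1: "AE x in lebesgue. maxop1 \<theta> W x \<le> ennreal A * W x" and r: "0 < r"
  obtains a b where "0 < a" "0 < b" "ball_int W c r = ennreal a" "emeasure lebesgue (ball c r) = ennreal b"
    "AE y in lebesgue. y \<in> ball c r \<longrightarrow> ennreal (a / (A * d c r powr \<theta> * b)) \<le> W y"
proof -
  obtain b where b: "0 < b" "emeasure lebesgue (ball c r) = ennreal b"
    using emeasure_ball_real[OF r] by blast
  have \<delta>: "0 < d c r powr \<theta>"
    using gauge_ge_one[OF r, of c] by simp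
  have upper: "AE y in lebesgue. y \<in> ball c r \<longrightarrow> ball_int W c r * ennreal (1 / (A * d c r powr \<theta> * b)) \<le> W y"
    using A1
  proof eventually_elim
    case (elim y)
    show ?case
    proof
      assume "y \<in> ball c r"
      have "ball_int W c r * ennreal (1 / (A * d c r powr \<theta> * b))
        = ennreal (1 / A) * (ball_int W c r / (ennreal (d c r powr \<theta>) * ball_int (\<lambda>_. 1) c r))"
      proof -
        have "ennreal (1 / A) * ennreal (1 / (d c r powr \<theta> * b)) = ennreal (1 / (A * d c r powr \<theta> * b))"
          using b A by (simp add: ennreal_mult[symmetric] mult.assoc)
        moreover have "ennreal (d c r powr \<theta>) * ball_int (\<lambda>_. 1) c r = ennreal (d c r powr \<theta> * b)"
          using b by (simp only: ball_int_one ennreal_mult powr_ge_zero less_imp_le)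
        ultimately show ?thesis
          using \<delta> b by (simp only: ennreal_divide_conv_mult mult_pos_pos mult.left_commute[of "ennreal (1 / A)"])
      qed
      also have "\<dots> \<le> ennreal (1 / A) * maxop1 \<theta> W y"
        by (intro mult_left_mono maxop_upper r \<open>y \<in> ball c r\<close>) simp
      also have "\<dots> \<le> ennreal (1 / A) * (ennreal A * W y)"
        by (intro mult_left_mono elim) simp
      also have "\<dots> = W y"
        using A by (simp add: mult.assoc[symmetric] ennreal_mult[symmetric])
      finally show "ball_int W c r * ennreal (1 / (A * d c r powr \<theta> * b)) \<le> W y" .
    qed
  qed
  \<comment> \<open>W is finite at this point, which forces its integral over the ball to be
    finite.\<close>
  obtain y where "ball_int W c r * ennreal (1 / (A * d c r powr \<theta> * b)) \<le> W y"
    using ex_ball_AE[OF upper r, of c] by blast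
  then have "ball_int W c r \<noteq> top"
    using W_fin[of y] \<delta> b A by (auto simp: ennreal_top_mult)
  then obtain a where a: "0 < a" "ball_int W c r = ennreal a"
    using ball_int_pos[OF W W_pos r, of c] by (cases "ball_int W c r") auto
  show thesis
  proof
    show "AE y in lebesgue. y \<in> ball c r \<longrightarrow> ennreal (a / (A * d c r powr \<theta> * b)) \<le> W y"
      using upper A b \<delta> a by (simp add: ennreal_mult[symmetric])
  qed (use a b in auto)
qed

text \<open>For exponent 2 the dual weight is 1 / W, which the lower bound for W controls pointwise.
  Fixing the exponent 2 places all majorants in one class of the scale, with constants known in
  advance.\<close>

lemma A1_imp_muckenhoupt:
  assumes W [measurable]: "W \<in> borel_measurable lebesgue" and W_pos: "\<And>x. 0 < W x" and W_fin: "\<And>x. W x < top"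
    and A: "0 < A" and \<theta>: "0 \<le> \<theta>" and A1: "AE x in lebesgue. maxop1 \<theta> W x \<le> ennreal A * W x"
  shows "muckenhoupt 2 \<theta> A W"
proof -
  have "ball_int W c r * epowr (ball_int (dual_weight 2 W) c r) (2 - 1)
        \<le> ennreal (A * d c r powr \<theta>) * epowr (emeasure lebesgue (ball c r)) 2" if r: "0 < r" for c r
  proof -
    obtain a b where ab: "0 < a" "0 < b" "ball_int W c r = ennreal a" "emeasure lebesgue (ball c r) = ennreal b"
      "AE y in lebesgue. y \<in> ball c r \<longrightarrow> ennreal (a / (A * d c r powr \<theta> * b)) \<le> W y"
      using A1_ball_lower_bound[OF W W_pos W_fin A A1 r] by blast
    have \<delta>: "0 < d c r powr \<theta>"
      using gauge_ge_one[OF r, of c] by simp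
    have "ball_int (dual_weight 2 W) c r \<le> (\<integral>\<^sup>+y. ennreal (A * d c r powr \<theta> * b / a) * indicator (ball c r) y \<partial>lebesgue)"
      unfolding ball_int_def
    proof (rule nn_integral_mono_AE)
      show "AE y in lebesgue. dual_weight 2 W y * indicator (ball c r) y \<le> ennreal (A * d c r powr \<theta> * b / a) * indicator (ball c r) y"
        using ab(5)
      proof eventually_elim
        case (elim y)
        have "dual_weight 2 W y \<le> ennreal (A * d c r powr \<theta> * b / a)" if "y \<in> ball c r"
        proof -
          have "dual_weight 2 W y \<le> epowr (ennreal (a / (A * d c r powr \<theta> * b))) (-1)"
            unfolding dual_weight_def using elim that W_fin[of y] ab A \<delta> by (simp add: epowr_antimono)
          also have "\<dots> = ennreal (A * d c r powr \<theta> * b / a)"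
            using ab A \<delta> by (simp add: epowr_ennreal powr_minus)
          finally show ?thesis .
        qed
        then show ?case
          by (auto simp: indicator_def)
      qed
    qed
    also have "\<dots> = ennreal (A * d c r powr \<theta> * b / a) * ennreal b"
      by (simp add: nn_integral_cmult ab(4)[simplified])
    finally have "ball_int W c r * ball_int (dual_weight 2 W) c r \<le> ennreal a * (ennreal (A * d c r powr \<theta> * b / a) * ennreal b)"
      unfolding ab(3) by (rule mult_left_mono) simp
    also have "\<dots> = ennreal (A * d c r powr \<theta>) * epowr (ennreal b) 2"
      using ab(1,2) A by (simp add: ennreal_mult[symmetric] epowr_ennreal powr_numeral power2_eq_square mult_ac)
    finally show ?thesis
      by (simp only: ab(4)) simp
  qed
  then show ?thesis
    using A \<theta> W_pos W_fin by (simp add: muckenhoupt_def)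
qed

text \<open>The easy direction of the factorization of weights. The lower bound for W on a ball
  controls W^(-\<beta>) there, and the dual weight of the product is a geometric mean of W and the
  dual weight of u, so Hoelder applies. The averages of W introduced by the two steps
  cancel.\<close>

lemma muckenhoupt_times_A1:
  assumes u: "muckenhoupt q N K u" and q: "1 < q" and \<beta>: "0 < \<beta>"
    and W [measurable]: "W \<in> borel_measurable lebesgue" and W_pos: "\<And>x. 0 < W x" and W_fin: "\<And>x. W x < top"
    and A: "0 < A" and \<theta>: "0 \<le> \<theta>" and A1: "AE x in lebesgue. maxop1 \<theta> W x \<le> ennreal A * W x"
  shows "muckenhoupt (q + \<beta>) (N + \<theta> * \<beta>) (2 powr (q + \<beta> - 1) * A powr \<beta> * K) (\<lambda>x. epowr (W x) (- \<beta>) * u x)"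
proof -
  define Q where "Q = q + \<beta>"
  have Q: "1 < Q"
    using q \<beta> by (simp add: Q_def)
  let ?w = "\<lambda>x. epowr (W x) (- \<beta>) * u x"
  let ?v = "dual_weight q u"
  have u_meas [measurable]: "u \<in> borel_measurable lebesgue" and K: "0 < K" and N: "0 \<le> N"
    using u by (auto simp: muckenhoupt_def)
  have "ball_int ?w c r * epowr (ball_int (dual_weight Q ?w) c r) (Q - 1)
    \<le> ennreal (2 powr (Q - 1) * A powr \<beta> * K * d c r powr (N + \<theta> * \<beta>)) * epowr (emeasure lebesgue (ball c r)) Q"
    if r: "0 < r" for c r
  proof -
    obtain a b where ab: "0 < a" "0 < b" "ball_int W c r = ennreal a" "emeasure lebesgue (ball c r) = ennreal b"
      "AE y in lebesgue. y \<in> ball c r \<longrightarrow> ennreal (a / (A * d c r powr \<theta> * b)) \<le> W y"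
      using A1_ball_lower_bound[OF W W_pos W_fin A A1 r] by blast
    define \<delta> where "\<delta> = d c r"
    have \<delta>: "0 < \<delta>"
      using gauge_ge_one[OF r, of c] by (simp add: \<delta>_def)
    define w0 where "w0 = a / (A * \<delta> powr \<theta> * b)"
    have w0: "0 < w0"
      using ab A \<delta> by (simp add: w0_def)
    have 1: "ball_int ?w c r \<le> ennreal (w0 powr (- \<beta>)) * ball_int u c r"
      unfolding ball_int_cmult[OF u_meas, symmetric] unfolding ball_int_def
    proof (rule nn_integral_mono_AE)
      show "AE y in lebesgue. ?w y * indicator (ball c r) y \<le> ennreal (w0 powr (- \<beta>)) * u y * indicator (ball c r) y"
        using ab(5)
      proof eventually_elim
        case (elim y)
        have "epowr (W y) (- \<beta>) \<le> epowr (ennreal w0) (- \<beta>)" if "y \<in> ball c r"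
          using elim that W_fin[of y] w0 \<beta> by (intro epowr_antimono) (auto simp: w0_def \<delta>_def)
        then show ?case
          using w0 by (auto simp: indicator_def epowr_ennreal mult_right_mono)
      qed
    qed
    \<comment> \<open>Chosen so that s (Q - 1) = \<beta> and (1 - s)(Q - 1) = q - 1, the exponents
      that W and the dual weight of u must carry.\<close>
    define s where "s = \<beta> / (Q - 1)"
    have s: "0 < s" "s < 1" "1 - s = (q - 1) / (Q - 1)"
      using q \<beta> by (auto simp: s_def Q_def field_simps)
    have dual_eq: "dual_weight Q ?w y = epowr (W y) s * epowr (?v y) (1 - s)" for y
      using q by (simp add: dual_weight_def epowr_mult s(3)) (simp add: s_def)
    have "ball_int (dual_weight Q ?w) c r = (\<integral>\<^sup>+y. epowr (W y * indicator (ball c r) y) s * epowr (?v y * indicator (ball c r) y) (1 - s) \<partial>lebesgue)"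
      unfolding ball_int_def dual_eq by (intro nn_integral_cong) (simp add: indicator_def)
    also have "\<dots> \<le> 2 * (epowr (ennreal a) s * epowr (ball_int ?v c r) (1 - s))"
      unfolding ab(3)[symmetric] unfolding ball_int_def by (rule nn_integral_Hoelder) (use s in auto)
    finally have "epowr (ball_int (dual_weight Q ?w) c r) (Q - 1)
      \<le> epowr (2 * (epowr (ennreal a) s * epowr (ball_int ?v c r) (1 - s))) (Q - 1)"
      using Q by (intro epowr_mono) auto
    also have "\<dots> = epowr 2 (Q - 1) * (epowr (ennreal a) \<beta> * epowr (ball_int ?v c r) (q - 1))"
      unfolding epowr_mult epowr_epowr s(3) using Q by (simp add: s_def)
    also have "\<dots> = ennreal (2 powr (Q - 1) * a powr \<beta>) * epowr (ball_int ?v c r) (q - 1)"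
      using ab(1) epowr_ennreal[of 2 "Q - 1"] by (simp add: epowr_ennreal ennreal_mult mult.assoc)
    finally have "ball_int ?w c r * epowr (ball_int (dual_weight Q ?w) c r) (Q - 1)
      \<le> (ennreal (w0 powr (- \<beta>)) * ball_int u c r) * (ennreal (2 powr (Q - 1) * a powr \<beta>) * epowr (ball_int ?v c r) (q - 1))"
      using 1 by (intro mult_mono) auto
    also have "\<dots> = ennreal (w0 powr (- \<beta>) * (2 powr (Q - 1) * a powr \<beta>)) * (ball_int u c r * epowr (ball_int ?v c r) (q - 1))"
      by (simp add: ennreal_mult mult_ac)
    also have "\<dots> \<le> ennreal (w0 powr (- \<beta>) * (2 powr (Q - 1) * a powr \<beta>)) * (ennreal (K * \<delta> powr N) * epowr (ennreal b) q)"
      unfolding \<delta>_def ab(4)[symmetric] by (intro mult_left_mono muckenhoupt_ineq[OF u r]) simp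
    also have "\<dots> = ennreal (w0 powr (- \<beta>) * (2 powr (Q - 1) * a powr \<beta>) * (K * \<delta> powr N) * b powr q)"
      using K ab(2) by (simp add: epowr_ennreal ennreal_mult[symmetric] mult.assoc)
    also have "w0 powr (- \<beta>) * (2 powr (Q - 1) * a powr \<beta>) * (K * \<delta> powr N) * b powr q
      = 2 powr (Q - 1) * A powr \<beta> * K * \<delta> powr (N + \<theta> * \<beta>) * b powr Q"
    proof -
      have "w0 powr (- \<beta>) * a powr \<beta> = (a / w0) powr \<beta>"
        using w0 ab by (simp add: powr_divide powr_minus field_simps)
      also have "a / w0 = A * \<delta> powr \<theta> * b"
        using ab A \<delta> by (simp add: w0_def)
      also have "\<dots> powr \<beta> = A powr \<beta> * \<delta> powr (\<theta> * \<beta>) * b powr \<beta>"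
        using A ab \<delta> by (simp add: powr_mult powr_powr)
      finally show ?thesis
        by (simp add: Q_def powr_add mult_ac)
    qed
    finally show ?thesis
      using ab(2) A K by (simp only: ab(4)) (simp add: epowr_ennreal ennreal_mult[symmetric] \<delta>_def)
  qed
  then show ?thesis
    using u A K \<theta> \<beta> W_pos W_fin unfolding muckenhoupt_def Q_def[symmetric]
    by (auto simp: ennreal_zero_less_mult_iff ennreal_mult_less_top)
qed

text \<open>The dual weight at r is a power below 1 of the one at q; Hoelder against the constant 1
  costs the factor 2^(r-1).\<close>

lemma muckenhoupt_mono:
  assumes u: "muckenhoupt q N K u" and q: "1 < q" "q < r"
  shows "muckenhoupt r N (2 powr (r - 1) * K) u"
proof -
  have u_meas [measurable]: "u \<in> borel_measurable lebesgue" and K: "0 < K" and N: "0 \<le> N"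
    using u by (auto simp: muckenhoupt_def)
  let ?v = "dual_weight q u"
  have "ball_int u c R * epowr (ball_int (dual_weight r u) c R) (r - 1)
    \<le> ennreal (2 powr (r - 1) * K * d c R powr N) * epowr (emeasure lebesgue (ball c R)) r"
    if R: "0 < R" for c R
  proof -
    obtain b where b: "0 < b" "emeasure lebesgue (ball c R) = ennreal b"
      using emeasure_ball_real[OF R] by blast
    define s where "s = (q - 1) / (r - 1)"
    have s: "0 < s" "s < 1" "1 - s = (r - q) / (r - 1)"
      using q by (auto simp: s_def field_simps)
    have dual_eq: "dual_weight r u y = epowr (?v y) s * epowr 1 (1 - s)" for y
      using q by (simp add: dual_weight_def s_def)
    have "ball_int (dual_weight r u) c R = (\<integral>\<^sup>+y. epowr (?v y * indicator (ball c R) y) s * epowr (1 * indicator (ball c R) y) (1 - s) \<partial>lebesgue)"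
      unfolding ball_int_def dual_eq by (intro nn_integral_cong) (simp add: indicator_def)
    also have "\<dots> \<le> 2 * (epowr (ball_int ?v c R) s * epowr (ball_int (\<lambda>_. 1) c R) (1 - s))"
      unfolding ball_int_def by (rule nn_integral_Hoelder) (use s in auto)
    finally have "epowr (ball_int (dual_weight r u) c R) (r - 1)
      \<le> epowr (2 * (epowr (ball_int ?v c R) s * epowr (ennreal b) (1 - s))) (r - 1)"
      using q unfolding ball_int_one b(2) by (intro epowr_mono) auto
    also have "\<dots> = epowr 2 (r - 1) * (epowr (ball_int ?v c R) (q - 1) * epowr (ennreal b) (r - q))"
      unfolding epowr_mult epowr_epowr s(3) using q by (simp add: s_def)
    finally have "ball_int u c R * epowr (ball_int (dual_weight r u) c R) (r - 1)
       \<le> ball_int u c R * (epowr 2 (r - 1) * (epowr (ball_int ?v c R) (q - 1) * epowr (ennreal b) (r - q)))"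
      by (rule mult_left_mono) simp
    also have "\<dots> = epowr 2 (r - 1) * epowr (ennreal b) (r - q) * (ball_int u c R * epowr (ball_int ?v c R) (q - 1))"
      by (simp add: mult_ac)
    also have "\<dots> \<le> epowr 2 (r - 1) * epowr (ennreal b) (r - q) * (ennreal (K * d c R powr N) * epowr (ennreal b) q)"
      unfolding b(2)[symmetric] by (intro mult_left_mono muckenhoupt_ineq[OF u R]) simp
    also have "\<dots> = epowr 2 (r - 1) * ennreal (K * d c R powr N) * (epowr (ennreal b) (r - q) * epowr (ennreal b) q)"
      by (simp add: mult_ac)
    also have "\<dots> = ennreal (2 powr (r - 1) * K * d c R powr N) * epowr (ennreal b) r"
      using epowr_ennreal[of 2 "r - 1"] K by (simp add: epowr_add[symmetric] ennreal_mult mult.assoc)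
    finally show ?thesis
      by (simp only: b(2))
  qed
  then show ?thesis
    using u K by (auto simp: muckenhoupt_def)
qed

text \<open>The uniform convention of \<open>A_infty_estimate\<close> restated for the classes
  \<open>muckenhoupt\<close> with q > 1 and weights valued in the extended reals; the constant is
  chosen before the weight. The exponent 1 is recovered later from the inclusion of A_1 in
  A_2.\<close>

definition pair_estimate :: "(('a \<Rightarrow> ennreal) \<times> ('a \<Rightarrow> ennreal)) set \<Rightarrow> real \<Rightarrow> bool" where
  "pair_estimate F p \<longleftrightarrow> (\<forall>q>1. \<forall>N\<ge>0. \<forall>K>0. \<exists>C>0. \<forall>u. muckenhoupt q N K u \<longrightarrow>
     (\<forall>(f, g)\<in>F. pow_int p f u < top \<longrightarrow> pow_int p f u \<le> ennreal C * pow_int p g u))"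

lemma pair_estimateE:
  assumes "pair_estimate F p" "1 < q" "0 \<le> N" "0 < K"
  obtains C where "0 < C" "\<And>u f g. muckenhoupt q N K u \<Longrightarrow> (f, g) \<in> F \<Longrightarrow> pow_int p f u < top \<Longrightarrow>
    pow_int p f u \<le> ennreal C * pow_int p g u"
  using assms unfolding pair_estimate_def by (metis (mono_tags, lifting) case_prodD)

text \<open>W^(q/p) majorizes both f and g. Hence W^(-\<beta>) reduces the power p_0 of g to at most
  p, and it makes the integral of f^(p_0) with the new weight finite. The way back to f^p uses
  Young's inequality against W^q, whose integral is a multiple of the left-hand side.\<close>

lemma pair_estimate_lower:
  assumes est: "pair_estimate F p\<^sub>0" and p: "0 < p" "p < p\<^sub>0"
    and F_meas: "\<And>f g. (f, g) \<in> F \<Longrightarrow> f \<in> borel_measurable lebesgue \<and> g \<in> borel_measurable lebesgue"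
  shows "pair_estimate F p"
  unfolding pair_estimate_def
proof (intro allI impI)
  fix q N K :: real assume q: "1 < q" and N: "0 \<le> N" and K: "0 < K"
  define \<theta> where "\<theta> = 3 * N / (q - 1)"
  have \<theta>: "0 \<le> \<theta>"
    using q N by (simp add: \<theta>_def)
  obtain B where B: "0 < B" "\<And>u. muckenhoupt q N K u \<Longrightarrow> maxop_bounded \<theta> B q u"
    unfolding \<theta>_def by (rule muckenhoupt_maxop_bounded[OF q N K]) blast
  \<comment> \<open>With this value W^\<beta> = (W^(q/p))^(p_0 - p), and q p_0 / p - \<beta> =
    q.\<close>
  define \<beta> where "\<beta> = (p\<^sub>0 - p) * q / p"
  have \<beta>: "0 < \<beta>"
    using p q by (simp add: \<beta>_def)
  obtain C0 where C0: "0 < C0" "\<And>u f g. muckenhoupt (q + \<beta>) (N + \<theta> * \<beta>) (2 powr (q + \<beta> - 1) * (4 * B) powr \<beta> * K) u \<Longrightarrow>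
      (f, g) \<in> F \<Longrightarrow> pow_int p\<^sub>0 f u < top \<Longrightarrow> pow_int p\<^sub>0 f u \<le> ennreal C0 * pow_int p\<^sub>0 g u"
    using pair_estimateE[OF est, of "q + \<beta>" "N + \<theta> * \<beta>" "2 powr (q + \<beta> - 1) * (4 * B) powr \<beta> * K"]
      q \<beta> N \<theta> K B(1) by auto
  \<comment> \<open>One factor 2^(q+1) bounds the norm of h = f^(p/q) + g^(p/q), the other the norm
    of its majorant.\<close>
  define A2 where "A2 = 2 powr (q + 1) * 2 powr (q + 1)"
  have A2: "0 < A2"
    by (simp add: A2_def)
  define s where "s = p / p\<^sub>0"
  have s: "0 < s" "s < 1"
    using p by (auto simp: s_def)
  obtain C1 where C1: "0 < C1" "\<And>x y. epowr x s * epowr y (1 - s) \<le> ennreal C1 * x + ennreal (1 / (2 * A2)) * y"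
    using epowr_Young_eps[OF s, of "1 / (2 * A2)"] A2 by auto
  show "\<exists>C>0. \<forall>u. muckenhoupt q N K u \<longrightarrow> (\<forall>(f, g)\<in>F. pow_int p f u < top \<longrightarrow> pow_int p f u \<le> ennreal C * pow_int p g u)"
  proof (intro exI[of _ "1 + 2 * (C1 * C0)"] conjI allI impI, safe)
    show "0 < 1 + 2 * (C1 * C0)"
      using C0(1) C1(1) by (simp add: add_pos_pos)
    fix u f g assume u: "muckenhoupt q N K u" and fg: "(f, g) \<in> F" and fin: "pow_int p f u < top"
    have [measurable]: "f \<in> borel_measurable lebesgue" "g \<in> borel_measurable lebesgue" and u_meas [measurable]: "u \<in> borel_measurable lebesgue"
      using F_meas[OF fg] muckenhoupt_measurable[OF u] by auto
    define a b where "a = pow_int p f u" and "b = pow_int p g u"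
    \<comment> \<open>If a <= b the claim is trivial, and the summand 1 in the constant covers it.
      Otherwise b is below a, so b is finite and the norm of h, which contains g, is controlled by a
      alone.\<close>
    have "a \<le> ennreal (2 * (C1 * C0)) * b" if "\<not> a \<le> b"
    proof -
      have ba: "b \<le> a" "a < top" "0 < a"
        using that fin by (auto simp: a_def zero_less_iff_neq_zero)
      define h where "h x = epowr (f x) (p / q) + epowr (g x) (p / q)" for x
      have h_meas [measurable]: "h \<in> borel_measurable lebesgue"
        unfolding h_def[abs_def] by measurable
      have h_int: "(\<integral>\<^sup>+x. epowr (h x) q * u x \<partial>lebesgue) \<le> ennreal (2 powr (q + 1)) * a"
      proof -
        have "(\<integral>\<^sup>+x. epowr (h x) q * u x \<partial>lebesgue) \<le> (\<integral>\<^sup>+x. epowr 2 q * (epowr (f x) p * u x + epowr (g x) p * u x) \<partial>lebesgue)"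
        proof (rule nn_integral_mono)
          fix x
          have "epowr (h x) q \<le> epowr 2 q * (epowr (f x) p + epowr (g x) p)"
            unfolding h_def using epowr_add_le[of q "epowr (f x) (p / q)" "epowr (g x) (p / q)"] q by simp
          then have "epowr (h x) q * u x \<le> epowr 2 q * (epowr (f x) p + epowr (g x) p) * u x"
            by (rule mult_right_mono) simp
          then show "epowr (h x) q * u x \<le> epowr 2 q * (epowr (f x) p * u x + epowr (g x) p * u x)"
            by (simp add: mult.assoc distrib_right)
        qed
        also have "\<dots> = epowr 2 q * (a + b)"
          by (simp add: nn_integral_cmult nn_integral_add a_def b_def pow_int_def)
        also have "\<dots> \<le> epowr 2 q * (a + a)"
          using ba by (intro mult_left_mono add_mono) auto
        also have "\<dots> = ennreal (2 powr (q + 1)) * a"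
          using epowr_ennreal[of 2 q] by (simp add: powr_add ennreal_mult mult.assoc mult_2)
        finally show ?thesis .
      qed
      have h_nz: "\<not> (AE x in lebesgue. h x = 0)"
      proof
        assume "AE x in lebesgue. h x = 0"
        then have "AE x in lebesgue. epowr (f x) p * u x = 0"
          by eventually_elim (simp add: h_def)
        then have "a = 0"
          unfolding a_def pow_int_def by (subst nn_integral_0_iff_AE) auto
        then show False
          using ba by simp
      qed
      have h_fin: "(\<integral>\<^sup>+x. epowr (h x) q * u x \<partial>lebesgue) < top"
        using h_int ba by (auto simp: ennreal_mult_less_top elim: order_le_less_trans)
      obtain W where W: "W \<in> borel_measurable lebesgue" "\<And>x. 0 < W x" "\<And>x. W x < top"
        "AE x in lebesgue. h x \<le> W x" "AE x in lebesgue. maxop1 \<theta> W x \<le> ennreal (4 * B) * W x"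
        "\<And>q u. 1 \<le> q \<Longrightarrow> u \<in> borel_measurable lebesgue \<Longrightarrow> maxop_bounded \<theta> B q u \<Longrightarrow>
         (\<integral>\<^sup>+x. epowr (W x) q * u x \<partial>lebesgue) \<le> ennreal (2 powr (q + 1)) * (\<integral>\<^sup>+x. epowr (h x) q * u x \<partial>lebesgue)"
        by (rule Rubio_de_Francia[OF B(1) h_meas h_nz less_imp_le[OF q] B(2)[OF u] h_fin u_meas muckenhoupt_pos[OF u]]) blast
      have W_meas [measurable]: "W \<in> borel_measurable lebesgue"
        by (rule W)
      define Y where "Y = (\<integral>\<^sup>+x. epowr (W x) q * u x \<partial>lebesgue)"
      have Y: "Y \<le> ennreal A2 * a"
      proof -
        have "Y \<le> ennreal (2 powr (q + 1)) * (\<integral>\<^sup>+x. epowr (h x) q * u x \<partial>lebesgue)"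
          unfolding Y_def using q by (intro W(6) B(2) u) auto
        also have "\<dots> \<le> ennreal (2 powr (q + 1)) * (ennreal (2 powr (q + 1)) * a)"
          by (intro mult_left_mono h_int) simp
        finally show ?thesis
          by (simp add: A2_def ennreal_mult mult.assoc)
      qed
      define w where "w x = epowr (W x) (- \<beta>) * u x" for x
      have [measurable]: "w \<in> borel_measurable lebesgue"
        unfolding w_def[abs_def] by measurable
      have w: "muckenhoupt (q + \<beta>) (N + \<theta> * \<beta>) (2 powr (q + \<beta> - 1) * (4 * B) powr \<beta> * K) w"
        unfolding w_def[abs_def] using B(1) by (intro muckenhoupt_times_A1 u q \<beta> W \<theta>) auto
      have fgW: "AE x in lebesgue. f x \<le> epowr (W x) (q / p) \<and> g x \<le> epowr (W x) (q / p)"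
        using W(4)
      proof eventually_elim
        case (elim x)
        have "epowr (f x) (p / q) \<le> W x" "epowr (g x) (p / q) \<le> W x"
          using elim by (auto simp: h_def intro: order_trans[rotated] add_increasing add_increasing2)
        then show ?case
          using p q by (simp add: epowr_le_iff)
      qed
      have f_int: "pow_int p\<^sub>0 f w \<le> Y"
        unfolding pow_int_def Y_def
      proof (rule nn_integral_mono_AE)
        show "AE x in lebesgue. epowr (f x) p\<^sub>0 * w x \<le> epowr (W x) q * u x"
          using fgW
        proof eventually_elim
          case (elim x)
          have "epowr (f x) p\<^sub>0 * epowr (W x) (- \<beta>) \<le> epowr (epowr (W x) (q / p)) p\<^sub>0 * epowr (W x) (- \<beta>)"
            using elim p by (intro mult_right_mono epowr_mono) auto
          also have "\<dots> = epowr (W x) q"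
          proof -
            have "q / p * p\<^sub>0 + - \<beta> = q"
              using p by (simp add: \<beta>_def field_simps)
            then show ?thesis
              by (simp only: epowr_epowr epowr_add[symmetric])
          qed
          finally show ?case
            unfolding w_def mult.assoc[symmetric] by (rule mult_right_mono) simp
        qed
      qed
      have g_int: "pow_int p\<^sub>0 g w \<le> b"
        unfolding pow_int_def b_def
      proof (rule nn_integral_mono_AE)
        show "AE x in lebesgue. epowr (g x) p\<^sub>0 * w x \<le> epowr (g x) p * u x"
          using fgW
        proof eventually_elim
          case (elim x)
          have "epowr (g x) p\<^sub>0 * epowr (W x) (- \<beta>) = epowr (g x) p * (epowr (g x) (p\<^sub>0 - p) * epowr (W x) (- \<beta>))"
            using epowr_add[of "g x" p "p\<^sub>0 - p"] by (simp add: mult.assoc)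
          also have "\<dots> \<le> epowr (g x) p * (epowr (epowr (W x) (q / p)) (p\<^sub>0 - p) * epowr (W x) (- \<beta>))"
            using elim p by (intro mult_left_mono mult_right_mono epowr_mono) auto
          also have "epowr (epowr (W x) (q / p)) (p\<^sub>0 - p) * epowr (W x) (- \<beta>) = 1"
            unfolding epowr_epowr using W(2,3) by (intro epowr_cancel) (auto simp: \<beta>_def)
          finally show ?case
            unfolding w_def mult.assoc[symmetric] by (intro mult_right_mono) auto
        qed
      qed
      have "Y < top"
        using Y ba by (auto simp: ennreal_mult_less_top elim: order_le_less_trans)
      \<comment> \<open>Finiteness of the integral of W^q is what permits the hypothesis to be used
        for the new weight.\<close>
      then have key: "pow_int p\<^sub>0 f w \<le> ennreal C0 * b"
        using C0(2)[OF w fg order_le_less_trans[OF f_int]] g_int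
        by (meson mult_left_mono order_trans zero_le)
      have "a \<le> (\<integral>\<^sup>+x. ennreal C1 * (epowr (f x) p\<^sub>0 * w x) + ennreal (1 / (2 * A2)) * (epowr (W x) q * u x) \<partial>lebesgue)"
        unfolding a_def pow_int_def
      proof (rule nn_integral_mono)
        fix x
        have "epowr (f x) p = epowr (epowr (f x) p\<^sub>0 * epowr (W x) (- \<beta>)) s * epowr (epowr (W x) q) (1 - s)"
        proof -
          have "epowr (W x) (- \<beta> * s) * epowr (W x) (q * (1 - s)) = 1"
            using W(2,3) p by (intro epowr_cancel) (auto simp: \<beta>_def s_def field_simps)
          then show ?thesis
            using p by (simp add: epowr_mult mult.assoc s_def)
        qed
        also have "\<dots> \<le> ennreal C1 * (epowr (f x) p\<^sub>0 * epowr (W x) (- \<beta>)) + ennreal (1 / (2 * A2)) * epowr (W x) q"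
          by (rule C1)
        finally have "epowr (f x) p * u x \<le> (ennreal C1 * (epowr (f x) p\<^sub>0 * epowr (W x) (- \<beta>)) + ennreal (1 / (2 * A2)) * epowr (W x) q) * u x"
          by (rule mult_right_mono) simp
        then show "epowr (f x) p * u x \<le> ennreal C1 * (epowr (f x) p\<^sub>0 * w x) + ennreal (1 / (2 * A2)) * (epowr (W x) q * u x)"
          by (simp add: w_def distrib_right mult.assoc)
      qed
      also have "\<dots> = ennreal C1 * pow_int p\<^sub>0 f w + ennreal (1 / (2 * A2)) * Y"
        by (simp add: nn_integral_add nn_integral_cmult pow_int_def Y_def)
      also have "\<dots> \<le> ennreal C1 * (ennreal C0 * b) + ennreal (1 / (2 * A2)) * (ennreal A2 * a)"
        by (intro add_mono mult_left_mono key Y) auto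
      also have "ennreal (1 / (2 * A2)) * (ennreal A2 * a) = ennreal (1 / 2) * a"
        using A2 by (simp add: mult.assoc[symmetric] ennreal_mult[symmetric] del: ennreal_half)
      finally have "a \<le> 2 * (ennreal C1 * (ennreal C0 * b))"
        using ba by (intro ennreal_absorb_half)
      also have "\<dots> = ennreal (2 * (C1 * C0)) * b"
        using C0(1) C1(1) by (simp add: ennreal_mult mult.assoc)
      finally show ?thesis .
    qed
    moreover have "ennreal (1 + 2 * (C1 * C0)) = 1 + ennreal (2 * (C1 * C0))"
      using C0(1) C1(1) by (subst ennreal_plus) auto
    ultimately show "pow_int p f u \<le> ennreal (1 + 2 * (C1 * C0)) * pow_int p g u"
      unfolding a_def[symmetric] b_def[symmetric]
      by (cases "a \<le> b") (auto simp: distrib_right add_increasing add_increasing2)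
  qed
qed


text \<open>For r > q the dual weight of u at r lies in A_(r'), so the maximal operator is bounded
  on the corresponding dual space. Two exponents are treated at once, with one majorant bounded in
  both spaces, for the interpolation in the Lorentz estimates; the Lebesgue estimates take them
  equal.\<close>

lemma A1_majorant:
  assumes q: "1 < q" and N: "0 \<le> N" and K: "0 < K" and r: "q < r\<^sub>1" "q < r\<^sub>2"
  obtains \<theta> B A where "0 \<le> \<theta>" "0 < B" "0 < A"
    "\<And>u h. muckenhoupt q N K u \<Longrightarrow> h \<in> borel_measurable lebesgue \<Longrightarrow> \<not> (AE x in lebesgue. h x = 0) \<Longrightarrow>
      (\<integral>\<^sup>+x. epowr (h x) (r\<^sub>1 / (r\<^sub>1 - 1)) * dual_weight r\<^sub>1 u x \<partial>lebesgue) < top \<Longrightarrow>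
      \<exists>H\<in>borel_measurable lebesgue. muckenhoupt 2 \<theta> B H \<and> (AE x in lebesgue. h x \<le> H x) \<and>
        (\<forall>r\<in>{r\<^sub>1, r\<^sub>2}. (\<integral>\<^sup>+x. epowr (H x) (r / (r - 1)) * dual_weight r u x \<partial>lebesgue)
          \<le> ennreal A * (\<integral>\<^sup>+x. epowr (h x) (r / (r - 1)) * dual_weight r u x \<partial>lebesgue))"
proof -
  \<comment> \<open>The class data are those of u seen in A_r and then dualised, hence computable
    from q, N, K and r.\<close>
  have ex: "\<exists>\<theta> B. 0 \<le> \<theta> \<and> 0 < B \<and> (\<forall>u. muckenhoupt q N K u \<longrightarrow> maxop_bounded \<theta> B (r / (r - 1)) (dual_weight r u))"
    if r: "q < r" for r
  proof -
    define r' where "r' = r / (r - 1)"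
    have r': "1 < r'"
      using r q by (simp add: r'_def)
    have pos: "0 \<le> N / (r - 1)" "0 < (2 powr (r - 1) * K) powr (1 / (r - 1))"
      using r q N K by auto
    obtain B where B: "0 < B" "\<And>v. muckenhoupt r' (N / (r - 1)) ((2 powr (r - 1) * K) powr (1 / (r - 1))) v \<Longrightarrow>
        maxop_bounded (3 * (N / (r - 1)) / (r' - 1)) B r' v"
      by (rule muckenhoupt_maxop_bounded[OF r' pos]) blast
    show ?thesis
    proof (intro exI conjI allI impI)
      show "0 \<le> 3 * (N / (r - 1)) / (r' - 1)"
        using r' pos by (intro divide_nonneg_nonneg) auto
      show "0 < B" by (rule B)
      fix u assume u: "muckenhoupt q N K u"
      show "maxop_bounded (3 * (N / (r - 1)) / (r' - 1)) B (r / (r - 1)) (dual_weight r u)"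
        unfolding r'_def[symmetric]
        using muckenhoupt_dual[OF muckenhoupt_mono[OF u q r]] r q by (intro B(2)) (simp add: r'_def)
    qed
  qed
  obtain \<theta>\<^sub>1 B\<^sub>1 where 1: "0 \<le> \<theta>\<^sub>1" "0 < B\<^sub>1" "\<And>u. muckenhoupt q N K u \<Longrightarrow> maxop_bounded \<theta>\<^sub>1 B\<^sub>1 (r\<^sub>1 / (r\<^sub>1 - 1)) (dual_weight r\<^sub>1 u)"
    using ex[OF r(1)] by blast
  obtain \<theta>\<^sub>2 B\<^sub>2 where 2: "0 \<le> \<theta>\<^sub>2" "0 < B\<^sub>2" "\<And>u. muckenhoupt q N K u \<Longrightarrow> maxop_bounded \<theta>\<^sub>2 B\<^sub>2 (r\<^sub>2 / (r\<^sub>2 - 1)) (dual_weight r\<^sub>2 u)"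
    using ex[OF r(2)] by blast
  \<comment> \<open>A common operator for both spaces: a larger gauge exponent only decreases it,
    and a larger norm bound remains valid.\<close>
  define \<theta> B where "\<theta> = max \<theta>\<^sub>1 \<theta>\<^sub>2" and "B = max B\<^sub>1 B\<^sub>2"
  define A where "A = max (2 powr (r\<^sub>1 / (r\<^sub>1 - 1) + 1)) (2 powr (r\<^sub>2 / (r\<^sub>2 - 1) + 1))"
  have \<theta>: "0 \<le> \<theta>" and B: "0 < B"
    using 1 2 by (auto simp: \<theta>_def B_def)
  have r1: "1 \<le> r\<^sub>1 / (r\<^sub>1 - 1)" "1 \<le> r\<^sub>2 / (r\<^sub>2 - 1)"
    using r q by auto
  show thesis
  proof (rule that)
    show "0 \<le> \<theta>" "0 < 4 * B"
      using \<theta> B by auto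
    show "0 < A"
      by (simp add: A_def less_max_iff_disj)
    fix u h
    assume u: "muckenhoupt q N K u" and h: "h \<in> borel_measurable lebesgue" and nz: "\<not> (AE x in lebesgue. h x = 0)"
      and fin: "(\<integral>\<^sup>+x. epowr (h x) (r\<^sub>1 / (r\<^sub>1 - 1)) * dual_weight r\<^sub>1 u x \<partial>lebesgue) < top"
    have u_meas [measurable]: "u \<in> borel_measurable lebesgue"
      by (rule muckenhoupt_measurable[OF u])
    have v_meas: "dual_weight r u \<in> borel_measurable lebesgue" for r
      by measurable
    have v_pos: "0 < dual_weight r u x" for r x
      using muckenhoupt_pos[OF u] by simp
    have bnd: "maxop_bounded \<theta> B (r / (r - 1)) (dual_weight r u)" if "r \<in> {r\<^sub>1, r\<^sub>2}" for r
      using that maxop_bounded_mono[OF 1(3)[OF u], of \<theta> B] maxop_bounded_mono[OF 2(3)[OF u], of \<theta> B] r1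
      by (auto simp: \<theta>_def B_def)
    have bnd1: "maxop_bounded \<theta> B (r\<^sub>1 / (r\<^sub>1 - 1)) (dual_weight r\<^sub>1 u)"
      by (rule bnd) simp
    obtain W where W: "W \<in> borel_measurable lebesgue" "\<And>x. 0 < W x" "\<And>x. W x < top"
      "AE x in lebesgue. h x \<le> W x" "AE x in lebesgue. maxop1 \<theta> W x \<le> ennreal (4 * B) * W x"
      "\<And>q u. 1 \<le> q \<Longrightarrow> u \<in> borel_measurable lebesgue \<Longrightarrow> maxop_bounded \<theta> B q u \<Longrightarrow>
       (\<integral>\<^sup>+x. epowr (W x) q * u x \<partial>lebesgue) \<le> ennreal (2 powr (q + 1)) * (\<integral>\<^sup>+x. epowr (h x) q * u x \<partial>lebesgue)"
      by (rule Rubio_de_Francia[OF B h nz r1(1) bnd1 fin v_meas v_pos]) blast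
    have "(\<integral>\<^sup>+x. epowr (W x) (r / (r - 1)) * dual_weight r u x \<partial>lebesgue)
          \<le> ennreal A * (\<integral>\<^sup>+x. epowr (h x) (r / (r - 1)) * dual_weight r u x \<partial>lebesgue)" if "r \<in> {r\<^sub>1, r\<^sub>2}" for r
    proof -
      have "(\<integral>\<^sup>+x. epowr (W x) (r / (r - 1)) * dual_weight r u x \<partial>lebesgue)
          \<le> ennreal (2 powr (r / (r - 1) + 1)) * (\<integral>\<^sup>+x. epowr (h x) (r / (r - 1)) * dual_weight r u x \<partial>lebesgue)"
        using that r1 by (intro W(6) bnd v_meas) auto
      also have "\<dots> \<le> ennreal A * (\<integral>\<^sup>+x. epowr (h x) (r / (r - 1)) * dual_weight r u x \<partial>lebesgue)"
        using that by (intro mult_right_mono ennreal_leI) (auto simp: A_def)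
      finally show ?thesis .
    qed
    then show "\<exists>H\<in>borel_measurable lebesgue. muckenhoupt 2 \<theta> (4 * B) H \<and> (AE x in lebesgue. h x \<le> H x) \<and>
        (\<forall>r\<in>{r\<^sub>1, r\<^sub>2}. (\<integral>\<^sup>+x. epowr (H x) (r / (r - 1)) * dual_weight r u x \<partial>lebesgue)
          \<le> ennreal A * (\<integral>\<^sup>+x. epowr (h x) (r / (r - 1)) * dual_weight r u x \<partial>lebesgue))"
      using W B \<theta> by (intro bexI[of _ W] conjI A1_imp_muckenhoupt) auto
  qed
qed

text \<open>Prepares the pairing of L^r(u) with its dual for Hoelder or Young: the powers of u in
  the two factors cancel.\<close>

lemma dual_weight_factorization:
  assumes "muckenhoupt q N K u" "1 < r"
  shows "y * z = epowr (epowr y r * u x) (1 / r) * epowr (epowr z (r / (r - 1)) * dual_weight r u x) (1 - 1 / r)"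
proof -
  have "epowr (u x) (1 / r) * epowr (dual_weight r u x) (1 - 1 / r) = 1"
    unfolding dual_weight_def epowr_epowr
    using assms muckenhoupt_pos[OF assms(1)] muckenhoupt_finite[OF assms(1)]
    by (intro epowr_cancel) (auto simp: field_simps)
  moreover have "r / (r - 1) * (1 - 1 / r) = 1"
    using assms by (simp add: field_simps)
  ultimately show ?thesis
    using assms by (simp add: epowr_mult mult_ac)
qed

text \<open>Duality for the index r = p / p_1: the function h = f^(p - p_1) u has dual norm equal to
  the left-hand side, and f^(p_1) h = f^p u. Replacing h by an A_1 majorant H makes the hypothesis
  at p_1 applicable. The order of p and p_0 is irrelevant, as the exponent is lowered first.\<close>

lemma pair_estimate_raise:
  assumes est: "pair_estimate F p\<^sub>0" and p: "0 < p" "0 < p\<^sub>0"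
    and F_meas: "\<And>f g. (f, g) \<in> F \<Longrightarrow> f \<in> borel_measurable lebesgue \<and> g \<in> borel_measurable lebesgue"
  shows "pair_estimate F p"
  unfolding pair_estimate_def
proof (intro allI impI)
  fix q N K :: real assume q: "1 < q" and N: "0 \<le> N" and K: "0 < K"
  \<comment> \<open>The second entry makes r = p / p_1 at least q + 1, hence larger than q.\<close>
  define p\<^sub>1 where "p\<^sub>1 = min p\<^sub>0 (p / (q + 1))"
  have p1: "0 < p\<^sub>1" "p\<^sub>1 \<le> p\<^sub>0" "p\<^sub>1 * (q + 1) \<le> p"
    using p q min.cobounded2[of p\<^sub>0 "p / (q + 1)"] by (auto simp: p\<^sub>1_def pos_le_divide_eq[symmetric])
  have est1: "pair_estimate F p\<^sub>1"
    using est pair_estimate_lower[OF est p1(1) _ F_meas] p1 by (cases "p\<^sub>1 = p\<^sub>0") auto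
  define r where "r = p / p\<^sub>1"
  have r: "q < r"
    using p1 q by (simp add: r_def field_simps)
  have pr: "p = p\<^sub>1 * r"
    using p1 by (simp add: r_def)
  have p_gt: "p\<^sub>1 < p"
    using p1 q r by (simp add: pr)
  obtain \<theta> B A where AB: "0 \<le> \<theta>" "0 < B" "0 < A"
    "\<And>u h. muckenhoupt q N K u \<Longrightarrow> h \<in> borel_measurable lebesgue \<Longrightarrow> \<not> (AE x in lebesgue. h x = 0) \<Longrightarrow>
      (\<integral>\<^sup>+x. epowr (h x) (r / (r - 1)) * dual_weight r u x \<partial>lebesgue) < top \<Longrightarrow>
      \<exists>H\<in>borel_measurable lebesgue. muckenhoupt 2 \<theta> B H \<and> (AE x in lebesgue. h x \<le> H x) \<and>
        (\<forall>s\<in>{r, r}. (\<integral>\<^sup>+x. epowr (H x) (s / (s - 1)) * dual_weight s u x \<partial>lebesgue)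
          \<le> ennreal A * (\<integral>\<^sup>+x. epowr (h x) (s / (s - 1)) * dual_weight s u x \<partial>lebesgue))"
    by (rule A1_majorant[OF q N K r r]) blast
  obtain C0 where C0: "0 < C0" "\<And>u f g. muckenhoupt 2 \<theta> B u \<Longrightarrow> (f, g) \<in> F \<Longrightarrow> pow_int p\<^sub>1 f u < top \<Longrightarrow>
    pow_int p\<^sub>1 f u \<le> ennreal C0 * pow_int p\<^sub>1 g u"
    by (rule pair_estimateE[OF est1 _ AB(1,2), of 2]) (simp, blast)
  define s where "s = 1 / r"
  have s: "0 < s" "s < 1"
    using r q by (auto simp: s_def)
  \<comment> \<open>After multiplication by \<open>C0\<close> and by the norm constant A, this small
    parameter leaves exactly one half of a.\<close>
  obtain C1 where C1: "0 < C1" "\<And>x y. epowr x s * epowr y (1 - s) \<le> ennreal C1 * x + ennreal (1 / (2 * C0 * A)) * y"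
    using epowr_Young_eps[OF s, of "1 / (2 * C0 * A)"] AB C0(1) by auto
  show "\<exists>C>0. \<forall>u. muckenhoupt q N K u \<longrightarrow> (\<forall>(f, g)\<in>F. pow_int p f u < top \<longrightarrow> pow_int p f u \<le> ennreal C * pow_int p g u)"
  proof (intro exI[of _ "2 * (C0 * C1)"] conjI allI impI, simp add: C0 C1, safe)
    fix u f g assume u: "muckenhoupt q N K u" and fg: "(f, g) \<in> F" and fin: "pow_int p f u < top"
    have [measurable]: "f \<in> borel_measurable lebesgue" "g \<in> borel_measurable lebesgue" and u_meas [measurable]: "u \<in> borel_measurable lebesgue"
      using F_meas[OF fg] muckenhoupt_measurable[OF u] by auto
    define a b where "a = pow_int p f u" and "b = pow_int p g u"
    show "pow_int p f u \<le> ennreal (2 * (C0 * C1)) * pow_int p g u"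
    proof (cases "a = 0")
      case False
      define h where "h x = epowr (f x) (p - p\<^sub>1) * u x" for x
      have h_meas [measurable]: "h \<in> borel_measurable lebesgue"
        unfolding h_def[abs_def] by measurable
      have h_nz: "\<not> (AE x in lebesgue. h x = 0)"
      proof
        assume "AE x in lebesgue. h x = 0"
        then have "AE x in lebesgue. epowr (f x) p * u x = 0"
          by eventually_elim (auto simp: h_def)
        then have "a = 0"
          unfolding a_def pow_int_def by (subst nn_integral_0_iff_AE) auto
        then show False
          using False by simp
      qed
      have h_int: "(\<integral>\<^sup>+x. epowr (h x) (r / (r - 1)) * dual_weight r u x \<partial>lebesgue) = a"
        unfolding a_def pow_int_def
      proof (rule nn_integral_cong)
        fix x
        have "p - p\<^sub>1 = p\<^sub>1 * (r - 1)"
          by (simp add: pr algebra_simps)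
        then have "(p - p\<^sub>1) * (r / (r - 1)) = p"
          using r q by (simp add: pr)
        moreover have "epowr (u x) (r / (r - 1)) * dual_weight r u x = u x"
        proof -
          have "r / (r - 1) + - 1 / (r - 1) = 1"
            using r q by (simp add: diff_divide_distrib[symmetric])
          then show ?thesis
            unfolding dual_weight_def by (simp only: epowr_add[symmetric]) simp
        qed
        ultimately show "epowr (h x) (r / (r - 1)) * dual_weight r u x = epowr (f x) p * u x"
          by (simp only: h_def epowr_mult epowr_epowr mult.assoc)
      qed
      obtain H where H_meas [measurable]: "H \<in> borel_measurable lebesgue" and H: "muckenhoupt 2 \<theta> B H" "AE x in lebesgue. h x \<le> H x"
        "(\<integral>\<^sup>+x. epowr (H x) (r / (r - 1)) * dual_weight r u x \<partial>lebesgue) \<le> ennreal A * a"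
        using AB(4)[OF u h_meas h_nz] fin by (auto simp: h_int a_def)
      define Y where "Y = (\<integral>\<^sup>+x. epowr (H x) (r / (r - 1)) * dual_weight r u x \<partial>lebesgue)"
      have Y: "Y \<le> ennreal A * a" "Y < top"
        using H(3) fin by (auto simp: Y_def a_def ennreal_mult_less_top elim: order_le_less_trans)
      have split: "epowr y p\<^sub>1 * H x = epowr (epowr y p * u x) s * epowr (epowr (H x) (r / (r - 1)) * dual_weight r u x) (1 - s)" for x y
        using dual_weight_factorization[OF u, of r "epowr y p\<^sub>1" "H x" x] r q by (simp add: s_def pr)
      have "pow_int p\<^sub>1 f H \<le> (\<integral>\<^sup>+x. epowr (f x) p * u x + epowr (H x) (r / (r - 1)) * dual_weight r u x \<partial>lebesgue)"
        unfolding pow_int_def split by (intro nn_integral_mono epowr_Young s)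
      also have "\<dots> = a + Y"
        by (simp add: nn_integral_add a_def pow_int_def Y_def)
      also have "\<dots> < top"
        using Y fin by (simp add: a_def)
      finally have f_fin: "pow_int p\<^sub>1 f H < top" .
      have "a \<le> pow_int p\<^sub>1 f H"
        unfolding a_def pow_int_def
      proof (rule nn_integral_mono_AE)
        show "AE x in lebesgue. epowr (f x) p * u x \<le> epowr (f x) p\<^sub>1 * H x"
          using H(2)
        proof eventually_elim
          case (elim x)
          have "epowr (f x) p * u x = epowr (f x) p\<^sub>1 * h x"
            using epowr_add[of "f x" p\<^sub>1 "p - p\<^sub>1"] by (simp add: h_def mult.assoc)
          then show ?case
            using elim by (simp add: mult_left_mono)
        qed
      qed
      also have "\<dots> \<le> ennreal C0 * pow_int p\<^sub>1 g H"
        by (rule C0(2)[OF H(1) fg f_fin])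
      also have "\<dots> \<le> ennreal C0 * (ennreal C1 * b + ennreal (1 / (2 * C0 * A)) * (ennreal A * a))"
      proof (rule mult_left_mono)
        have "pow_int p\<^sub>1 g H \<le> (\<integral>\<^sup>+x. ennreal C1 * (epowr (g x) p * u x) + ennreal (1 / (2 * C0 * A)) * (epowr (H x) (r / (r - 1)) * dual_weight r u x) \<partial>lebesgue)"
          unfolding pow_int_def split by (intro nn_integral_mono C1)
        also have "\<dots> = ennreal C1 * b + ennreal (1 / (2 * C0 * A)) * Y"
          by (simp add: nn_integral_add nn_integral_cmult b_def pow_int_def Y_def)
        also have "\<dots> \<le> ennreal C1 * b + ennreal (1 / (2 * C0 * A)) * (ennreal A * a)"
          by (intro add_mono mult_left_mono Y) auto
        finally show "pow_int p\<^sub>1 g H \<le> ennreal C1 * b + ennreal (1 / (2 * C0 * A)) * (ennreal A * a)" .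
      qed simp
      also have "\<dots> = ennreal (C0 * C1) * b + ennreal (1 / 2) * a"
      proof -
        have "ennreal C0 * (ennreal (1 / (2 * C0 * A)) * (ennreal A * a)) = ennreal (C0 * (1 / (2 * C0 * A)) * A) * a"
          using C0(1) AB by (simp only: ennreal_mult mult_nonneg_nonneg less_imp_le mult.assoc divide_nonneg_nonneg zero_le_one zero_le_numeral)
        also have "C0 * (1 / (2 * C0 * A)) * A = 1 / 2"
          using C0(1) AB by (simp add: field_simps)
        finally show ?thesis
          using C0(1) C1(1) by (simp add: distrib_left ennreal_mult mult.assoc del: ennreal_half)
      qed
      finally have "a \<le> 2 * (ennreal (C0 * C1) * b)"
        using fin by (intro ennreal_absorb_half) (auto simp: a_def)
      also have "\<dots> = ennreal (2 * (C0 * C1)) * b"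
        using C0(1) C1(1) by (simp add: ennreal_mult mult.assoc)
      finally show ?thesis
        by (simp add: a_def b_def)
    qed (simp add: a_def)
  qed
qed

end

section \<open>Decreasing rearrangements\<close>

lemma decr_rearrangement_lessD: "l < decr_rearrangement M f t \<Longrightarrow> ennreal t < emeasure M {x \<in> space M. l < f x}"
  unfolding decr_rearrangement_def by (metis (mono_tags) Inf_lower leD mem_Collect_eq not_le)

lemma decr_rearrangement_antimono: "s \<le> t \<Longrightarrow> decr_rearrangement M f t \<le> decr_rearrangement M f s"
  unfolding decr_rearrangement_def
  by (intro Inf_superset_mono Collect_mono impI) (auto intro: order_trans ennreal_leI)

text \<open>The infimum is attained: along levels decreasing to it the superlevel sets increase to
  the superlevel set of the infimum, and measure is continuous from below.\<close>

lemma emeasure_decr_rearrangement_less: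
  assumes [measurable]: "f \<in> borel_measurable M"
  shows "emeasure M {x \<in> space M. decr_rearrangement M f t < f x} \<le> ennreal t"
proof -
  define S where "S = {l. emeasure M {x \<in> space M. l < f x} \<le> ennreal t}"
  have "top \<in> S"
    by (simp add: S_def)
  then obtain l :: "nat \<Rightarrow> ennreal" where l: "decseq l" "range l \<subseteq> S" "Inf S = (INF i. l i)"
    using ennreal_Inf_countable_INF[of S] by auto
  have "{x \<in> space M. Inf S < f x} = (\<Union>i. {x \<in> space M. l i < f x})"
    unfolding l(3) INF_less_iff by auto
  moreover have "incseq (\<lambda>i. {x \<in> space M. l i < f x})"
    using l(1) by (auto simp: incseq_def decseq_def intro: le_less_trans)
  ultimately have "emeasure M {x \<in> space M. Inf S < f x} = (SUP i. emeasure M {x \<in> space M. l i < f x})"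
    by (subst SUP_emeasure_incseq) auto
  also have "\<dots> \<le> ennreal t"
    using l(2) by (intro SUP_least) (auto simp: S_def)
  finally show ?thesis
    by (simp add: decr_rearrangement_def S_def)
qed

text \<open>Monotonicity makes every superlevel set an interval; it extends to negative t, where
  \<open>ennreal t\<close> is 0.\<close>

lemma decr_rearrangement_measurable [measurable]: "decr_rearrangement M f \<in> borel_measurable borel"
proof (rule borel_measurableI_greater)
  fix y
  have "is_interval {t. y < decr_rearrangement M f t}"
    unfolding is_interval_1 using decr_rearrangement_antimono[of _ _ M f] by (auto intro: less_le_trans)
  then show "{t \<in> space borel. y < decr_rearrangement M f t} \<in> sets borel"
    by (simp add: real_interval_borel_measurable)
qed

section \<open>Lorentz norms as norms of the profile with respect to dt / t\<close>

definition lorentz_profile :: "'a measure \<Rightarrow> real \<Rightarrow> ('a \<Rightarrow> ennreal) \<Rightarrow> real \<Rightarrow> ennreal" where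
  "lorentz_profile M p f t = ennreal (t powr (1 / p)) * decr_rearrangement M f t"

lemma lorentz_profile_measurable [measurable]: "lorentz_profile M p f \<in> borel_measurable borel"
  unfolding lorentz_profile_def[abs_def] by measurable

lemma Lorentz_norm_eq:
  "Lorentz_norm M p s f = (if s = \<infinity> then SUP t\<in>{0<..}. lorentz_profile M p f t
     else epowr (\<integral>\<^sup>+t\<in>{0<..}. epowr (lorentz_profile M p f t) (enn2real s) * ennreal (1 / t) \<partial>lborel) (1 / enn2real s))"
  unfolding Lorentz_norm_def lorentz_profile_def ..

text \<open>The inclusion of L^(p,s) in weak L^p. The constant is qualitative: it serves finiteness
  only and does not enter the final estimate.\<close>

lemma lorentz_profile_bounded:
  assumes p: "0 < p" and s: "0 < s" and fin: "Lorentz_norm M p s f < top"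
  obtains c where "0 < c" "\<And>t. 0 < t \<Longrightarrow> lorentz_profile M p f t \<le> ennreal c"
proof -
  have "\<exists>X<top. \<forall>t>0. lorentz_profile M p f t \<le> X"
  proof (cases "s = \<infinity>")
    case True
    then show ?thesis
      using fin by (intro exI[of _ "SUP t\<in>{0<..}. lorentz_profile M p f t"]) (auto simp: Lorentz_norm_eq intro: SUP_upper)
  next
    case False
    define \<sigma> where "\<sigma> = enn2real s"
    have \<sigma>: "0 < \<sigma>"
      using s False by (simp add: \<sigma>_def enn2real_positive_iff less_top)
    define J where "J = (\<integral>\<^sup>+t\<in>{0<..}. epowr (lorentz_profile M p f t) \<sigma> * ennreal (1 / t) \<partial>lborel)"
    have J: "J < top"
      using fin False by (simp add: Lorentz_norm_eq J_def \<sigma>_def)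
    have "lorentz_profile M p f t \<le> ennreal (2 powr (1 / p)) * epowr (2 * J) (1 / \<sigma>)" if t: "0 < t" for t
    proof -
      \<comment> \<open>The rearrangement is at least D on [t/2, t], an interval on which 1 / x
        integrates to at least 1/2.\<close>
      define D where "D = decr_rearrangement M f t"
      have "epowr (ennreal ((t / 2) powr (1 / p)) * D) \<sigma> * ennreal (1 / 2)
         = (\<integral>\<^sup>+x. epowr (ennreal ((t / 2) powr (1 / p)) * D) \<sigma> * ennreal (1 / t) * indicator {t / 2..t} x \<partial>lborel)"
        using t by (simp add: nn_integral_cmult mult.assoc ennreal_mult[symmetric] del: ennreal_half)
      also have "\<dots> \<le> J"
        unfolding J_def
      proof (rule nn_integral_mono)
        fix x
        show "epowr (ennreal ((t / 2) powr (1 / p)) * D) \<sigma> * ennreal (1 / t) * indicator {t / 2..t} x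
          \<le> epowr (lorentz_profile M p f x) \<sigma> * ennreal (1 / x) * indicator {0<..} x"
        proof (cases "x \<in> {t / 2..t}")
          case True
          have "epowr (ennreal ((t / 2) powr (1 / p)) * D) \<sigma> * ennreal (1 / t) \<le> epowr (lorentz_profile M p f x) \<sigma> * ennreal (1 / x)"
            unfolding lorentz_profile_def D_def using True t p \<sigma>
            by (intro mult_mono epowr_mono ennreal_leI powr_mono2 decr_rearrangement_antimono) (auto simp: field_simps)
          then show ?thesis
            using True t by simp
        qed simp
      qed
      finally have "2 * (epowr (ennreal ((t / 2) powr (1 / p)) * D) \<sigma> * ennreal (1 / 2)) \<le> 2 * J"
        by (rule mult_left_mono) simp
      moreover have "2 * (X * ennreal (1 / 2)) = X" for X
      proof -
        have "2 * ennreal (1 / 2) = 1"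
          using ennreal_mult[of 2 "1 / 2"] by (simp del: ennreal_half)
        then show ?thesis
          by (metis mult.commute mult.left_commute mult.right_neutral)
      qed
      ultimately have "ennreal ((t / 2) powr (1 / p)) * D \<le> epowr (2 * J) (1 / \<sigma>)"
        using \<sigma> by (simp only: epowr_le_iff)
      then have "ennreal (2 powr (1 / p)) * (ennreal ((t / 2) powr (1 / p)) * D) \<le> ennreal (2 powr (1 / p)) * epowr (2 * J) (1 / \<sigma>)"
        by (rule mult_left_mono) simp
      moreover have "ennreal (2 powr (1 / p)) * (ennreal ((t / 2) powr (1 / p)) * D) = lorentz_profile M p f t"
        using t by (simp add: lorentz_profile_def D_def mult.assoc[symmetric] ennreal_mult[symmetric] powr_mult[symmetric])
      ultimately show ?thesis
        by simp
    qed
    moreover have "ennreal (2 powr (1 / p)) * epowr (2 * J) (1 / \<sigma>) < top"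
      using J by (simp add: ennreal_mult_less_top)
    ultimately show ?thesis
      by blast
  qed
  then obtain X where X: "X < top" "\<And>t. 0 < t \<Longrightarrow> lorentz_profile M p f t \<le> X"
    by blast
  show thesis
  proof
    show "0 < enn2real X + 1"
      by (simp add: add_nonneg_pos)
    show "lorentz_profile M p f t \<le> ennreal (enn2real X + 1)" if "0 < t" for t
    proof -
      have "X \<le> ennreal (enn2real X + 1)"
        using X(1) by (cases X) (auto intro: ennreal_leI)
      then show ?thesis
        using X(2)[OF that] by simp
    qed
  qed
qed

lemma decr_rearrangement_eq_profile:
  "0 < t \<Longrightarrow> decr_rearrangement M f t = ennreal (t powr (- (1 / p))) * lorentz_profile M p f t"
  by (simp add: lorentz_profile_def mult.assoc[symmetric] ennreal_mult[symmetric] powr_add[symmetric])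

text \<open>A bounded profile makes the rearrangement decay like t^(-1/p); this yields level sets of
  finite measure.\<close>

lemma decr_rearrangement_small:
  assumes p: "0 < p" and bnd: "\<And>t. 0 < t \<Longrightarrow> lorentz_profile M p f t \<le> ennreal c" and l: "0 < l" and c: "0 < c"
  shows "\<exists>t0>0. \<forall>t\<ge>t0. decr_rearrangement M f t < l"
proof -
  obtain y where y: "0 < y" "ennreal y < l"
  proof (cases l)
    case (real r)
    then show thesis
      using l by (intro that[of "r / 2"]) (auto simp: ennreal_less_iff)
  qed (use that[of 1] in auto)
  define t0 where "t0 = (c / y) powr p"
  have t0: "0 < t0"
    using y c by (simp add: t0_def)
  have "decr_rearrangement M f t < l" if "t0 \<le> t" for t
  proof -
    have "decr_rearrangement M f t \<le> decr_rearrangement M f t0"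
      by (rule decr_rearrangement_antimono[OF that])
    also have "\<dots> = ennreal (t0 powr (- (1 / p))) * lorentz_profile M p f t0"
      by (rule decr_rearrangement_eq_profile[OF t0])
    also have "\<dots> \<le> ennreal (t0 powr (- (1 / p))) * ennreal c"
      by (intro mult_left_mono bnd t0) simp
    also have "\<dots> = ennreal y"
      using c y p by (simp add: t0_def powr_powr powr_minus ennreal_mult[symmetric])
    finally show ?thesis
      using y by simp
  qed
  then show ?thesis
    using t0 by blast
qed

text \<open>The dyadic scales \<open>2\<^sup>k\<close>, \<open>k\<close> an integer, are enumerated by \<open>k = int_decode n\<close>.\<close>

definition dyadic_coeff :: "real \<Rightarrow> nat \<Rightarrow> ennreal" where
  "dyadic_coeff \<epsilon> n = ennreal (2 powr (- \<epsilon> * \<bar>real_of_int (int_decode n)\<bar>))"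

text \<open>The enumeration alternates as 0, -1, 1, -2, ..., so two-sided geometric sums over the
  integers are dominated by one-sided ones in n.\<close>

lemma abs_int_decode_ge: "real n / 2 \<le> \<bar>real_of_int (int_decode n)\<bar>"
  by (cases "even n") (auto simp: int_decode_def sum_decode_def elim!: evenE oddE)

lemma dyadic_coeff_summable:
  assumes "0 < \<epsilon>"
  shows "(\<Sum>n. dyadic_coeff \<epsilon> n) < top"
proof -
  define x where "x = 2 powr (- \<epsilon> / 2)"
  have x: "0 < x" "x < 1"
    using assms by (auto simp: x_def powr_less_one)
  have "(\<Sum>n. dyadic_coeff \<epsilon> n) \<le> (\<Sum>n. ennreal (x ^ n))"
  proof (rule suminf_le)
    fix n
    have "2 powr (- \<epsilon> * \<bar>real_of_int (int_decode n)\<bar>) \<le> 2 powr (- \<epsilon> / 2 * real n)"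
      using mult_left_mono[OF abs_int_decode_ge[of n], of \<epsilon>] assms by (intro powr_mono) auto
    also have "\<dots> = x powr real n"
      by (simp add: x_def powr_powr)
    also have "\<dots> = x ^ n"
      using x by (simp add: powr_realpow)
    finally show "dyadic_coeff \<epsilon> n \<le> ennreal (x ^ n)"
      unfolding dyadic_coeff_def by (rule ennreal_leI)
  qed auto
  also have "\<dots> < top"
    using x by (subst suminf_ennreal2) (auto simp: summable_geometric)
  finally show ?thesis .
qed

lemma epowr_dyadic_coeff: "epowr (dyadic_coeff \<epsilon> n) a = dyadic_coeff (\<epsilon> * a) n"
  by (simp add: dyadic_coeff_def epowr_ennreal powr_powr mult_ac)

text \<open>The measure dt / t is invariant under dilations, so all dyadic dilates of a profile have
  the same norm.\<close>

lemma nn_integral_dilate: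
  assumes [measurable]: "f \<in> borel_measurable borel" and a: "0 < a"
  shows "(\<integral>\<^sup>+t\<in>{0<..}. f (a * t) * ennreal (1 / t) \<partial>lborel) = (\<integral>\<^sup>+t\<in>{0<..}. f t * ennreal (1 / t) \<partial>lborel)"
proof -
  have "(\<integral>\<^sup>+t\<in>{0<..}. f t * ennreal (1 / t) \<partial>lborel)
      = ennreal \<bar>a\<bar> * (\<integral>\<^sup>+t. f (0 + a * t) * ennreal (1 / (0 + a * t)) * indicator {0<..} (0 + a * t) \<partial>lborel)"
    using a by (intro nn_integral_real_affine) auto
  also have "\<dots> = (\<integral>\<^sup>+t. ennreal a * (f (a * t) * ennreal (1 / (a * t)) * indicator {0<..} (a * t)) \<partial>lborel)"
    using a by (simp add: nn_integral_cmult)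
  also have "\<dots> = (\<integral>\<^sup>+t\<in>{0<..}. f (a * t) * ennreal (1 / t) \<partial>lborel)"
  proof (rule nn_integral_cong)
    fix t :: real
    show "ennreal a * (f (a * t) * ennreal (1 / (a * t)) * indicator {0<..} (a * t)) = f (a * t) * ennreal (1 / t) * indicator {0<..} t"
    proof (cases "0 < t")
      case True
      then have "ennreal (1 / t) = ennreal a * ennreal (1 / (a * t))"
        using a by (simp add: ennreal_mult[symmetric])
      then show ?thesis
        using True a by (simp add: mult_ac)
    qed (use a in \<open>auto simp: indicator_def zero_less_mult_iff\<close>)
  qed
  finally show ?thesis ..
qed

text \<open>Takes the norm of a geometric sum of dilates. As s may be below 1, the sum is handled by
  \<open>epowr_suminf_le\<close>. The constant is spelled out to exhibit that it involves neither
  the functions nor the measure.\<close>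

lemma Lorentz_norm_le_of_profile:
  assumes p1: "0 < p\<^sub>1" and s: "0 < s" and \<epsilon>: "0 < \<epsilon>" and C: "C < top"
    and le: "\<And>t. 0 < t \<Longrightarrow> epowr (lorentz_profile M p f t) p\<^sub>1
      \<le> C * (\<Sum>n. dyadic_coeff \<epsilon> n * epowr (lorentz_profile M p g (2 powr (real_of_int (int_decode n) - 1) * t)) p\<^sub>1)"
  shows "Lorentz_norm M p s f
    \<le> (if s = \<infinity> then epowr (C * (\<Sum>n. dyadic_coeff \<epsilon> n)) (1 / p\<^sub>1)
       else epowr (epowr (C * (\<Sum>n. dyadic_coeff (\<epsilon> / 2) n)) (enn2real s / p\<^sub>1)
         * (\<Sum>n. dyadic_coeff (\<epsilon> * (enn2real s / p\<^sub>1 / 2)) n)) (1 / enn2real s)) * Lorentz_norm M p s g"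
proof (cases "s = \<infinity>")
  case True
  define S where "S = (SUP t\<in>{0<..}. lorentz_profile M p g t)"
  have "lorentz_profile M p f t \<le> epowr (C * (\<Sum>n. dyadic_coeff \<epsilon> n)) (1 / p\<^sub>1) * S" if t: "0 < t" for t
  proof -
    have "epowr (lorentz_profile M p f t) p\<^sub>1
      \<le> C * (\<Sum>n. dyadic_coeff \<epsilon> n * epowr (lorentz_profile M p g (2 powr (real_of_int (int_decode n) - 1) * t)) p\<^sub>1)"
      by (rule le[OF t])
    also have "\<dots> \<le> C * (\<Sum>n. dyadic_coeff \<epsilon> n * epowr S p\<^sub>1)"
      unfolding S_def using p1 t by (intro mult_left_mono suminf_le epowr_mono SUP_upper) auto
    also have "\<dots> = C * (\<Sum>n. dyadic_coeff \<epsilon> n) * epowr S p\<^sub>1"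
      by (simp add: mult.assoc)
    finally show ?thesis
      using p1 by (simp add: epowr_le_iff epowr_mult)
  qed
  then show ?thesis
    using True by (auto simp: Lorentz_norm_eq S_def intro!: SUP_least)
next
  case False
  define \<sigma> where "\<sigma> = enn2real s"
  have \<sigma>: "0 < \<sigma>"
    using s False by (simp add: \<sigma>_def enn2real_positive_iff less_top)
  define a where "a n = 2 powr (real_of_int (int_decode n) - 1)" for n
  have a: "0 < a n" for n
    by (simp add: a_def)
  define J where "J h = (\<integral>\<^sup>+t\<in>{0<..}. epowr (lorentz_profile M p h t) \<sigma> * ennreal (1 / t) \<partial>lborel)" for h
  define D where "D = epowr (C * (\<Sum>n. dyadic_coeff (\<epsilon> / 2) n)) (\<sigma> / p\<^sub>1)"
  define c where "c n = dyadic_coeff (\<epsilon> * (\<sigma> / p\<^sub>1 / 2)) n" for n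
  have "J f \<le> (\<integral>\<^sup>+t. (\<Sum>n. D * (c n * (epowr (lorentz_profile M p g (a n * t)) \<sigma> * ennreal (1 / t) * indicator {0<..} t))) \<partial>lborel)"
    unfolding J_def
  proof (rule nn_integral_mono)
    fix t :: real
    show "epowr (lorentz_profile M p f t) \<sigma> * ennreal (1 / t) * indicator {0<..} t
      \<le> (\<Sum>n. D * (c n * (epowr (lorentz_profile M p g (a n * t)) \<sigma> * ennreal (1 / t) * indicator {0<..} t)))"
    proof (cases "0 < t")
      case True
      let ?G = "\<lambda>n. epowr (lorentz_profile M p g (a n * t)) p\<^sub>1"
      have "epowr (lorentz_profile M p f t) \<sigma> = epowr (epowr (lorentz_profile M p f t) p\<^sub>1) (\<sigma> / p\<^sub>1)"
        using p1 by simp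
      also have "\<dots> \<le> epowr (C * (\<Sum>n. dyadic_coeff \<epsilon> n * ?G n)) (\<sigma> / p\<^sub>1)"
        unfolding a_def using p1 \<sigma> by (intro epowr_mono le True) auto
      also have "\<dots> \<le> epowr C (\<sigma> / p\<^sub>1) * (epowr (\<Sum>n. epowr (dyadic_coeff \<epsilon> n) (1 / 2)) (\<sigma> / p\<^sub>1)
          * (\<Sum>n. epowr (dyadic_coeff \<epsilon> n) (\<sigma> / p\<^sub>1 / 2) * epowr (?G n) (\<sigma> / p\<^sub>1)))"
        unfolding epowr_mult using p1 \<sigma> by (intro mult_left_mono epowr_suminf_le) auto
      also have "\<dots> = D * (\<Sum>n. c n * epowr (lorentz_profile M p g (a n * t)) \<sigma>)"
        using p1 by (simp add: epowr_dyadic_coeff D_def c_def epowr_mult mult.assoc)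
      finally have "epowr (lorentz_profile M p f t) \<sigma> * ennreal (1 / t)
         \<le> D * (\<Sum>n. c n * epowr (lorentz_profile M p g (a n * t)) \<sigma>) * ennreal (1 / t)"
        by (rule mult_right_mono) simp
      also have "\<dots> = (\<Sum>n. D * (c n * (epowr (lorentz_profile M p g (a n * t)) \<sigma> * ennreal (1 / t))))"
        by (simp only: mult.assoc ennreal_suminf_multc[symmetric] ennreal_suminf_cmult[symmetric])
      finally show ?thesis
        using True by simp
    qed simp
  qed
  also have "\<dots> = (\<Sum>n. D * (c n * J g))"
  proof -
    have "(\<integral>\<^sup>+t\<in>{0<..}. epowr (lorentz_profile M p g (a n * t)) \<sigma> * ennreal (1 / t) \<partial>lborel) = J g" for n
      unfolding J_def by (rule nn_integral_dilate[where f = "\<lambda>t. epowr (lorentz_profile M p g t) \<sigma>"]) (auto simp: a)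
    then show ?thesis
      by (subst nn_integral_suminf) (auto simp: nn_integral_cmult)
  qed
  also have "\<dots> = D * (\<Sum>n. c n) * J g"
    by (simp only: ennreal_suminf_cmult ennreal_suminf_multc mult.assoc)
  finally have "epowr (J f) (1 / \<sigma>) \<le> epowr (D * (\<Sum>n. c n)) (1 / \<sigma>) * epowr (J g) (1 / \<sigma>)"
    using \<sigma> epowr_mono[of "1 / \<sigma>" "J f" "D * (\<Sum>n. c n) * J g"] by (simp add: epowr_mult)
  then show ?thesis
    using False by (simp add: Lorentz_norm_eq J_def D_def c_def \<sigma>_def)
qed

section \<open>Dyadic level sets and the pointwise comparison of rearrangements\<close>

context ball_gauge
begin

text \<open>Since r' + (1 - r') = 1, the function u restricted to S has dual integral u(S) for every
  r; this lets one test function serve two dual spaces.\<close>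

lemma dual_weight_indicator_cancel:
  assumes "muckenhoupt q N K u" "1 < r"
  shows "epowr (indicator S x * u x) (r / (r - 1)) * dual_weight r u x = u x * indicator S x"
proof -
  have "r / (r - 1) + - 1 / (r - 1) = 1"
    using assms by (simp add: diff_divide_distrib[symmetric])
  then have "epowr (u x) (r / (r - 1)) * dual_weight r u x = u x"
    unfolding dual_weight_def by (simp only: epowr_add[symmetric]) simp
  then show ?thesis
    by (simp add: indicator_def)
qed

text \<open>Hoelder between u(S)^(1/r) and the dual norm of H. The assumption A >= 1 replaces a
  power of A below 1 by A itself.\<close>

lemma level_set_integral_le:
  assumes u: "muckenhoupt q N K u" and H [measurable]: "H \<in> borel_measurable lebesgue"
    and A: "1 \<le> A" and \<tau>: "0 < \<tau>" and r: "1 < r"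
    and H_int: "(\<integral>\<^sup>+x. epowr (H x) (r / (r - 1)) * dual_weight r u x \<partial>lebesgue) \<le> ennreal (A * \<tau>)"
    and S [measurable]: "S \<in> sets lebesgue" and S_le: "emeasure (density lebesgue u) S \<le> ennreal (2 powr k * \<tau>)"
  shows "(\<integral>\<^sup>+x. H x * indicator S x \<partial>lebesgue) \<le> ennreal (2 * A * \<tau> * 2 powr (k / r))"
proof -
  have [measurable]: "u \<in> borel_measurable lebesgue"
    by (rule muckenhoupt_measurable[OF u])
  have "(\<integral>\<^sup>+x. H x * indicator S x \<partial>lebesgue)
     = (\<integral>\<^sup>+x. epowr (u x * indicator S x) (1 / r) * epowr (epowr (H x) (r / (r - 1)) * dual_weight r u x) (1 - 1 / r) \<partial>lebesgue)"
  proof (rule nn_integral_cong)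
    fix x
    show "H x * indicator S x = epowr (u x * indicator S x) (1 / r) * epowr (epowr (H x) (r / (r - 1)) * dual_weight r u x) (1 - 1 / r)"
      using dual_weight_factorization[OF u r, of 1 "H x" x] by (auto simp: indicator_def)
  qed
  also have "\<dots> \<le> 2 * (epowr (\<integral>\<^sup>+x. u x * indicator S x \<partial>lebesgue) (1 / r)
     * epowr (\<integral>\<^sup>+x. epowr (H x) (r / (r - 1)) * dual_weight r u x \<partial>lebesgue) (1 - 1 / r))"
    using r by (intro nn_integral_Hoelder) auto
  also have "\<dots> \<le> 2 * (epowr (ennreal (2 powr k * \<tau>)) (1 / r) * epowr (ennreal (A * \<tau>)) (1 - 1 / r))"
    using r S_le H_int by (intro mult_left_mono mult_mono epowr_mono) (auto simp: emeasure_density)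
  also have "\<dots> = ennreal (2 * ((2 powr k * \<tau>) powr (1 / r) * (A * \<tau>) powr (1 - 1 / r)))"
    using \<tau> A by (subst (1 2) epowr_ennreal) (auto simp: ennreal_mult)
  also have "\<dots> \<le> ennreal (2 * A * \<tau> * 2 powr (k / r))"
  proof (rule ennreal_leI)
    have "A powr (1 - 1 / r) \<le> A powr 1"
      using A r by (intro powr_mono) auto
    then have "A powr (1 - 1 / r) \<le> A"
      using A by simp
    have "(2 powr k * \<tau>) powr (1 / r) * (A * \<tau>) powr (1 - 1 / r) = 2 powr (k / r) * A powr (1 - 1 / r) * (\<tau> powr (1 / r) * \<tau> powr (1 - 1 / r))"
      using \<tau> A by (simp add: powr_mult powr_powr mult_ac)
    also have "\<tau> powr (1 / r) * \<tau> powr (1 - 1 / r) = \<tau>"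
      using \<tau> by (simp only: powr_add[symmetric]) simp
    also have "2 powr (k / r) * A powr (1 - 1 / r) * \<tau> \<le> 2 powr (k / r) * A * \<tau>"
      using \<tau> \<open>A powr (1 - 1 / r) \<le> A\<close> by (intro mult_right_mono mult_left_mono) auto
    finally show "2 * ((2 powr k * \<tau>) powr (1 / r) * (A * \<tau>) powr (1 - 1 / r)) \<le> 2 * A * \<tau> * 2 powr (k / r)"
      by (simp add: mult_ac)
  qed
  finally show ?thesis .
qed

text \<open>The space is cut into the layers between consecutive sets S_k where \<phi> exceeds its
  rearrangement at 2^k \<tau>. On a layer \<phi> is at most the rearrangement at 2^(k-1) \<tau>, and
  u(S_k) is at most 2^k \<tau>. Having H in two dual spaces gains the decay in |k|.\<close>

lemma integral_le_rearrangement_sum: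
  assumes u: "muckenhoupt q N K u" and H [measurable]: "H \<in> borel_measurable lebesgue"
    and A: "1 \<le> A" and \<tau>: "0 < \<tau>" and r: "1 < r\<^sub>1" "r\<^sub>1 < r" "r < r\<^sub>2"
    and \<epsilon>: "\<epsilon> \<le> 1 / r\<^sub>1 - 1 / r" "\<epsilon> \<le> 1 / r - 1 / r\<^sub>2"
    and H_int: "\<And>\<rho>. \<rho> \<in> {r\<^sub>1, r\<^sub>2} \<Longrightarrow> (\<integral>\<^sup>+x. epowr (H x) (\<rho> / (\<rho> - 1)) * dual_weight \<rho> u x \<partial>lebesgue) \<le> ennreal (A * \<tau>)"
    and \<phi> [measurable]: "\<phi> \<in> borel_measurable lebesgue" and p: "0 < p" "0 < p\<^sub>1"
    and c: "0 < c" and bnd: "\<And>t. 0 < t \<Longrightarrow> lorentz_profile (density lebesgue u) p \<phi> t \<le> ennreal c"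
  shows "pow_int p\<^sub>1 \<phi> H \<le> ennreal (2 * A * \<tau>) * (\<Sum>n. dyadic_coeff \<epsilon> n *
    (ennreal (2 powr (real_of_int (int_decode n) / r))
      * epowr (decr_rearrangement (density lebesgue u) \<phi> (2 powr (real_of_int (int_decode n) - 1) * \<tau>)) p\<^sub>1))"
proof -
  define \<mu> where "\<mu> = density lebesgue u"
  have u_meas [measurable]: "u \<in> borel_measurable lebesgue"
    by (rule muckenhoupt_measurable[OF u])
  define D where "D k = decr_rearrangement \<mu> \<phi> (2 powr real_of_int k * \<tau>)" for k :: int
  define S where "S k = {x. D k < \<phi> x}" for k
  have [measurable]: "S k \<in> sets lebesgue" for k
  proof -
    have "{x \<in> space lebesgue. D k < \<phi> x} \<in> sets lebesgue"
      by measurable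
    then show ?thesis
      by (simp add: S_def)
  qed
  have \<phi>_\<mu>: "\<phi> \<in> borel_measurable \<mu>"
    by (simp add: \<mu>_def)
  have S_le: "emeasure \<mu> (S k) \<le> ennreal (2 powr real_of_int k * \<tau>)" for k
    using emeasure_decr_rearrangement_less[OF \<phi>_\<mu>, of "2 powr real_of_int k * \<tau>"] by (simp add: S_def D_def \<mu>_def)
  define T where "T x n = epowr (D (int_decode n - 1)) p\<^sub>1 * (H x * indicator (S (int_decode n)) x)" for x n
  \<comment> \<open>The intersection of all S_k has measure at most 2^(-n) \<tau> for every n, so
    almost every point leaves the sets as k decreases.\<close>
  have null: "AE x in lebesgue. \<not> (\<forall>k. x \<in> S k)"
  proof -
    define Z where "Z = (\<Inter>k. S k)"
    have Z [measurable]: "Z \<in> sets lebesgue"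
      unfolding Z_def by measurable
    have "emeasure \<mu> Z \<le> 0"
    proof (rule ennreal_le_epsilon)
      fix e :: real assume e: "0 < e"
      obtain n :: nat where n: "inverse 2 ^ n < e / \<tau>"
        using real_arch_pow_inv[of "e / \<tau>" "inverse 2"] e \<tau> by auto
      have "emeasure \<mu> Z \<le> emeasure \<mu> (S (- int n))"
        by (rule emeasure_mono) (auto simp: Z_def \<mu>_def)
      also have "\<dots> \<le> ennreal (2 powr real_of_int (- int n) * \<tau>)"
        by (rule S_le)
      also have "\<dots> \<le> ennreal e"
        using n \<tau> by (intro ennreal_leI) (simp add: powr_minus powr_realpow field_simps power_inverse)
      finally show "emeasure \<mu> Z \<le> 0 + ennreal e"
        by simp
    qed
    then have "AE x in lebesgue. u x * indicator Z x = 0"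
      by (simp add: \<mu>_def emeasure_density nn_integral_0_iff_AE)
    then show ?thesis
    proof eventually_elim
      case (elim x)
      then have "x \<notin> Z"
        using muckenhoupt_pos[OF u, of x] by (auto simp: indicator_def split: if_splits)
      then show ?case
        by (auto simp: Z_def)
    qed
  qed
  have "pow_int p\<^sub>1 \<phi> H \<le> (\<integral>\<^sup>+x. (\<Sum>n. T x n) \<partial>lebesgue)"
    unfolding pow_int_def
  proof (rule nn_integral_mono_AE)
    show "AE x in lebesgue. epowr (\<phi> x) p\<^sub>1 * H x \<le> (\<Sum>n. T x n)"
      using null
    proof eventually_elim
      case (elim x)
      then obtain j where j: "x \<notin> S j"
        by auto
      show ?case
      proof (cases "\<phi> x = 0")
        case False
        then obtain t0 where t0: "0 < t0" "\<And>t. t0 \<le> t \<Longrightarrow> decr_rearrangement \<mu> \<phi> t < \<phi> x"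
          using decr_rearrangement_small[OF p(1), of \<mu> \<phi> c "\<phi> x"] bnd c by (auto simp: \<mu>_def zero_less_iff_neq_zero)
        obtain m0 :: nat where m0: "t0 / \<tau> < 2 ^ m0"
          using real_arch_pow[of 2 "t0 / \<tau>"] by auto
        then have "t0 \<le> 2 powr real_of_int (int m0) * \<tau>"
          using \<tau> by (simp add: powr_realpow field_simps)
        then have m0': "x \<in> S (int m0)"
          using t0(2) by (simp add: S_def D_def)
        \<comment> \<open>Otherwise membership would descend from \<open>m0\<close> to all smaller
          indices and, the sets being monotone, reach j.\<close>
        have "\<exists>k. x \<in> S k \<and> x \<notin> S (k - 1)"
        proof (rule ccontr)
          assume "\<not> ?thesis"
          then have step: "x \<in> S k \<Longrightarrow> x \<in> S (k - 1)" for k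
            by blast
          have "x \<in> S (int m0 - int n)" for n
          proof (induction n)
            case (Suc n)
            then show ?case
              using step[of "int m0 - int n"] by (simp add: algebra_simps)
          qed (use m0' in simp)
          moreover have "S a \<subseteq> S b" if "a \<le> b" for a b
          proof -
            have "D b \<le> D a"
              unfolding D_def using that \<tau> by (intro decr_rearrangement_antimono mult_right_mono) auto
            then show ?thesis
              unfolding S_def by (auto intro: le_less_trans)
          qed
          moreover have "int m0 - int (nat (int m0 - j)) \<le> j"
            by linarith
          ultimately have "x \<in> S j"
            by blast
          then show False
            using j by simp
        qed
        then obtain k where k: "x \<in> S k" "x \<notin> S (k - 1)"
          by blast
        obtain n where n: "int_decode n = k"
          by (metis int_encode_inverse)
        have "epowr (\<phi> x) p\<^sub>1 * H x \<le> T x n"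
          unfolding T_def n using k p by (auto intro!: mult_right_mono epowr_mono simp: S_def not_less)
        also have "\<dots> \<le> (\<Sum>n. T x n)"
          using sum_le_suminf[of "T x" "{n}"] by simp
        finally show ?thesis .
      qed simp
    qed
  qed
  also have "\<dots> = (\<Sum>n. \<integral>\<^sup>+x. T x n \<partial>lebesgue)"
    unfolding T_def by (rule nn_integral_suminf) measurable
  also have "\<dots> \<le> (\<Sum>n. ennreal (2 * A * \<tau>) * (dyadic_coeff \<epsilon> n *
    (ennreal (2 powr (real_of_int (int_decode n) / r)) * epowr (D (int_decode n - 1)) p\<^sub>1)))"
  proof (rule suminf_le)
    fix n
    define k where "k = int_decode n"
    have "(\<integral>\<^sup>+x. H x * indicator (S k) x \<partial>lebesgue) \<le> ennreal (2 * A * \<tau> * (2 powr (- \<epsilon> * \<bar>real_of_int k\<bar>) * 2 powr (real_of_int k / r)))"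
    proof -
      \<comment> \<open>The interpolation: the larger exponent r_2 is used on large sets (k >= 0),
        the smaller r_1 on small ones; either beats r by the factor 2^(-\<epsilon>|k|).\<close>
      obtain \<rho> where \<rho>: "\<rho> \<in> {r\<^sub>1, r\<^sub>2}" "real_of_int k / \<rho> \<le> - \<epsilon> * \<bar>real_of_int k\<bar> + real_of_int k / r"
      proof (cases "0 \<le> k")
        case True
        then show thesis
          using mult_left_mono[OF \<epsilon>(2), of "real_of_int k"] by (intro that[of r\<^sub>2]) (auto simp: algebra_simps)
      next
        case False
        then show thesis
          using mult_left_mono[OF \<epsilon>(1), of "- real_of_int k"] by (intro that[of r\<^sub>1]) (auto simp: algebra_simps)
      qed
      have "(\<integral>\<^sup>+x. H x * indicator (S k) x \<partial>lebesgue) \<le> ennreal (2 * A * \<tau> * 2 powr (real_of_int k / \<rho>))"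
        using \<rho>(1) r S_le unfolding \<mu>_def by (intro level_set_integral_le[OF u H A \<tau> _ H_int]) auto
      also have "\<dots> \<le> ennreal (2 * A * \<tau> * (2 powr (- \<epsilon> * \<bar>real_of_int k\<bar>) * 2 powr (real_of_int k / r)))"
        using \<rho>(2) A \<tau> by (intro ennreal_leI mult_left_mono) (auto simp: powr_add[symmetric])
      finally show ?thesis .
    qed
    also have "\<dots> = ennreal (2 * A * \<tau>) * (dyadic_coeff \<epsilon> n * ennreal (2 powr (real_of_int k / r)))"
      using A \<tau> by (simp add: ennreal_mult dyadic_coeff_def k_def)
    finally have le: "epowr (D (k - 1)) p\<^sub>1 * (\<integral>\<^sup>+x. H x * indicator (S k) x \<partial>lebesgue)
        \<le> epowr (D (k - 1)) p\<^sub>1 * (ennreal (2 * A * \<tau>) * (dyadic_coeff \<epsilon> n * ennreal (2 powr (real_of_int k / r))))"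
      by (rule mult_left_mono) simp
    then show "(\<integral>\<^sup>+x. T x n \<partial>lebesgue) \<le> ennreal (2 * A * \<tau>) * (dyadic_coeff \<epsilon> n *
      (ennreal (2 powr (real_of_int (int_decode n) / r)) * epowr (D (int_decode n - 1)) p\<^sub>1))"
    proof -
      have "(\<integral>\<^sup>+x. T x n \<partial>lebesgue) = epowr (D (k - 1)) p\<^sub>1 * (\<integral>\<^sup>+x. H x * indicator (S k) x \<partial>lebesgue)"
        unfolding T_def k_def by (rule nn_integral_cmult) measurable
      then show ?thesis
        using le by (simp add: k_def mult_ac)
    qed
  qed auto
  finally show ?thesis
    by (simp add: D_def \<mu>_def)
qed

text \<open>With S a level set of f at height l below the rearrangement of f at t, and \<tau> = u(S)
  > t, testing against a majorant H of u on S bounds \<tau> l^(p_1) by C \<tau> times a sum over the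
  rearrangement of g; \<tau> cancels. The bounds c and c' make the integrals finite without entering
  C.\<close>

lemma lorentz_profile_estimate:
  assumes est: "\<And>p. 0 < p \<Longrightarrow> pair_estimate F p" and p: "0 < p"
    and F_meas: "\<And>f g. (f, g) \<in> F \<Longrightarrow> f \<in> borel_measurable lebesgue \<and> g \<in> borel_measurable lebesgue"
    and q: "1 < q" and N: "0 \<le> N" and K: "0 < K"
  obtains p\<^sub>1 \<epsilon> C where "0 < p\<^sub>1" "0 < \<epsilon>" "0 < C"
    "\<And>u f g c c' t. muckenhoupt q N K u \<Longrightarrow> (f, g) \<in> F \<Longrightarrow> 0 < c \<Longrightarrow> 0 < c' \<Longrightarrow>
      (\<And>s. 0 < s \<Longrightarrow> lorentz_profile (density lebesgue u) p f s \<le> ennreal c) \<Longrightarrow>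
      (\<And>s. 0 < s \<Longrightarrow> lorentz_profile (density lebesgue u) p g s \<le> ennreal c') \<Longrightarrow> 0 < t \<Longrightarrow>
      epowr (lorentz_profile (density lebesgue u) p f t) p\<^sub>1 \<le> ennreal C * (\<Sum>n. dyadic_coeff \<epsilon> n *
        epowr (lorentz_profile (density lebesgue u) p g (2 powr (real_of_int (int_decode n) - 1) * t)) p\<^sub>1)"
proof -
  \<comment> \<open>Any three numbers above q with r strictly in the middle would serve.\<close>
  define r\<^sub>1 r r\<^sub>2 where "r\<^sub>1 = q + 1" and "r = q + 2" and "r\<^sub>2 = q + 3"
  have r: "q < r\<^sub>1" "q < r\<^sub>2" "1 < r\<^sub>1" "r\<^sub>1 < r" "r < r\<^sub>2" "1 < r\<^sub>2" "0 < r"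
    using q by (auto simp: r\<^sub>1_def r_def r\<^sub>2_def)
  \<comment> \<open>Then the power p_1 turns t^(1/p) into t^(1/r), matching the factor 2^(k/r)
    produced by the level sets.\<close>
  define p\<^sub>1 where "p\<^sub>1 = p / r"
  have p1: "0 < p\<^sub>1" and p1p: "p\<^sub>1 / p = 1 / r"
    using p r by (auto simp: p\<^sub>1_def)
  define \<epsilon> where "\<epsilon> = min (1 / r\<^sub>1 - 1 / r) (1 / r - 1 / r\<^sub>2)"
  have \<epsilon>: "0 < \<epsilon>" "\<epsilon> \<le> 1 / r\<^sub>1 - 1 / r" "\<epsilon> \<le> 1 / r - 1 / r\<^sub>2"
    using r by (auto simp: \<epsilon>_def divide_strict_left_mono)
  obtain \<theta> B A0 where AB: "0 \<le> \<theta>" "0 < B" "0 < A0"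
    "\<And>u h. muckenhoupt q N K u \<Longrightarrow> h \<in> borel_measurable lebesgue \<Longrightarrow> \<not> (AE x in lebesgue. h x = 0) \<Longrightarrow>
      (\<integral>\<^sup>+x. epowr (h x) (r\<^sub>1 / (r\<^sub>1 - 1)) * dual_weight r\<^sub>1 u x \<partial>lebesgue) < top \<Longrightarrow>
      \<exists>H\<in>borel_measurable lebesgue. muckenhoupt 2 \<theta> B H \<and> (AE x in lebesgue. h x \<le> H x) \<and>
        (\<forall>s\<in>{r\<^sub>1, r\<^sub>2}. (\<integral>\<^sup>+x. epowr (H x) (s / (s - 1)) * dual_weight s u x \<partial>lebesgue)
          \<le> ennreal A0 * (\<integral>\<^sup>+x. epowr (h x) (s / (s - 1)) * dual_weight s u x \<partial>lebesgue))"
    by (rule A1_majorant[OF q N K r(1,2)]) blast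
  define A where "A = max 1 A0"
  have A: "1 \<le> A" "A0 \<le> A"
    by (auto simp: A_def)
  obtain C0 where C0: "0 < C0" "\<And>u f g. muckenhoupt 2 \<theta> B u \<Longrightarrow> (f, g) \<in> F \<Longrightarrow> pow_int p\<^sub>1 f u < top \<Longrightarrow>
    pow_int p\<^sub>1 f u \<le> ennreal C0 * pow_int p\<^sub>1 g u"
    by (rule pair_estimateE[OF est[OF p1] _ AB(1,2), of 2]) (simp, blast)
  define C2 where "C2 = C0 * (2 * A)"
  have C2: "0 < C2"
    using C0(1) A by (simp add: C2_def)
  define k where "k n = real_of_int (int_decode n)" for n
  show thesis
  proof (rule that[OF p1 \<epsilon>(1)])
    show "0 < C2 * 2 powr (1 / r)"
      using C2 by simp
    fix u f g c c' and t :: real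
    assume u: "muckenhoupt q N K u" and fg: "(f, g) \<in> F" and c: "0 < c" "0 < c'"
      and f_bnd: "\<And>s. 0 < s \<Longrightarrow> lorentz_profile (density lebesgue u) p f s \<le> ennreal c"
      and g_bnd: "\<And>s. 0 < s \<Longrightarrow> lorentz_profile (density lebesgue u) p g s \<le> ennreal c'"
      and t: "0 < t"
    define \<mu> where "\<mu> = density lebesgue u"
    have f_meas [measurable]: "f \<in> borel_measurable lebesgue" and g_meas [measurable]: "g \<in> borel_measurable lebesgue"
      and u_meas [measurable]: "u \<in> borel_measurable lebesgue"
      using F_meas[OF fg] muckenhoupt_measurable[OF u] by auto
    have space_\<mu>: "space \<mu> = UNIV"
      by (simp add: \<mu>_def)
    define X where "X = ennreal C2 * (\<Sum>n. dyadic_coeff \<epsilon> n *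
      (ennreal (2 powr (k n / r)) * epowr (decr_rearrangement \<mu> g (2 powr (k n - 1) * t)) p\<^sub>1))"
    have level: "l \<le> epowr X (1 / p\<^sub>1)" if l: "l < decr_rearrangement \<mu> f t" for l
    proof (cases "l = 0")
      case False
      then have "0 < l"
        by (simp add: zero_less_iff_neq_zero)
      define S where "S = {x. l < f x}"
      have S [measurable]: "S \<in> sets lebesgue"
      proof -
        have "{x \<in> space lebesgue. l < f x} \<in> sets lebesgue"
          by measurable
        then show ?thesis
          by (simp add: S_def)
      qed
      have S_gt: "ennreal t < emeasure \<mu> S"
        using decr_rearrangement_lessD[OF l] by (simp add: S_def space_\<mu>)
      \<comment> \<open>Beyond t0 the rearrangement is below l, so the level set S has measure at
        most t0, in particular finite.\<close>
      obtain t0 where t0: "decr_rearrangement \<mu> f t0 < l"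
        using decr_rearrangement_small[OF p f_bnd \<open>0 < l\<close> c(1)] unfolding \<mu>_def by blast
      have "emeasure \<mu> S \<le> emeasure \<mu> {x \<in> space \<mu>. decr_rearrangement \<mu> f t0 < f x}"
      proof (rule emeasure_mono)
        show "{x \<in> space \<mu>. decr_rearrangement \<mu> f t0 < f x} \<in> sets \<mu>"
          unfolding \<mu>_def by measurable
      qed (use t0 in \<open>auto simp: S_def space_\<mu>\<close>)
      also have "\<dots> \<le> ennreal t0"
        by (rule emeasure_decr_rearrangement_less) (simp add: \<mu>_def)
      also have "\<dots> < top"
        by simp
      finally obtain \<tau> where \<tau>': "emeasure \<mu> S = ennreal \<tau>" "0 \<le> \<tau>"
        by (cases "emeasure \<mu> S") auto
      then have \<tau>: "t < \<tau>" "0 < \<tau>"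
        using S_gt t by (auto simp: ennreal_less_iff)
      define h where "h x = indicator S x * u x" for x
      have h_meas [measurable]: "h \<in> borel_measurable lebesgue"
        unfolding h_def[abs_def] by measurable
      have h_int: "(\<integral>\<^sup>+x. epowr (h x) (s / (s - 1)) * dual_weight s u x \<partial>lebesgue) = ennreal \<tau>" if "1 < s" for s
        unfolding h_def dual_weight_indicator_cancel[OF u that] \<tau>'(1)[symmetric] \<mu>_def
        by (simp add: emeasure_density)
      have h_fin: "(\<integral>\<^sup>+x. epowr (h x) (r\<^sub>1 / (r\<^sub>1 - 1)) * dual_weight r\<^sub>1 u x \<partial>lebesgue) < top"
        by (simp add: h_int[OF r(3)])
      have h_nz: "\<not> (AE x in lebesgue. h x = 0)"
      proof
        assume "AE x in lebesgue. h x = 0"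
        then have "AE x in lebesgue. u x * indicator S x = 0"
          by eventually_elim (simp add: h_def mult.commute)
        then have "emeasure \<mu> S = 0"
          unfolding \<mu>_def by (subst emeasure_density) (auto simp: nn_integral_0_iff_AE)
        then show False
          using \<tau> \<tau>' by simp
      qed
      obtain H where H_meas [measurable]: "H \<in> borel_measurable lebesgue" and H: "muckenhoupt 2 \<theta> B H"
        "AE x in lebesgue. h x \<le> H x"
        "\<And>s. s \<in> {r\<^sub>1, r\<^sub>2} \<Longrightarrow> (\<integral>\<^sup>+x. epowr (H x) (s / (s - 1)) * dual_weight s u x \<partial>lebesgue)
          \<le> ennreal A0 * (\<integral>\<^sup>+x. epowr (h x) (s / (s - 1)) * dual_weight s u x \<partial>lebesgue)"
        using AB(4)[OF u h_meas h_nz h_fin] by blast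
      have H_int: "(\<integral>\<^sup>+x. epowr (H x) (s / (s - 1)) * dual_weight s u x \<partial>lebesgue) \<le> ennreal (A * \<tau>)"
        if s: "s \<in> {r\<^sub>1, r\<^sub>2}" for s
      proof -
        have "(\<integral>\<^sup>+x. epowr (H x) (s / (s - 1)) * dual_weight s u x \<partial>lebesgue) \<le> ennreal A0 * ennreal \<tau>"
          using H(3)[OF s] h_int[of s] s r by auto
        also have "\<dots> \<le> ennreal (A * \<tau>)"
          using A AB \<tau> by (auto simp: ennreal_mult[symmetric] intro!: ennreal_leI mult_right_mono)
        finally show ?thesis .
      qed
      \<comment> \<open>The same layer decomposition, applied to f with its qualitative bound c,
        shows that the hypothesis may be used: the powers of 2^k cancel and the geometric
        coefficients remain summable.\<close>
      have f_fin: "pow_int p\<^sub>1 f H < top"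
      proof -
        have "pow_int p\<^sub>1 f H \<le> ennreal (2 * A * \<tau>) * (\<Sum>n. dyadic_coeff \<epsilon> n *
          (ennreal (2 powr (k n / r)) * epowr (decr_rearrangement \<mu> f (2 powr (k n - 1) * \<tau>)) p\<^sub>1))"
          unfolding \<mu>_def k_def
          by (rule integral_le_rearrangement_sum[OF u H_meas A(1) \<tau>(2) r(3-5) \<epsilon>(2,3) H_int f_meas p p1 c(1) f_bnd])
        also have "\<dots> \<le> ennreal (2 * A * \<tau>) * (\<Sum>n. dyadic_coeff \<epsilon> n * ennreal (2 powr (1 / r) * \<tau> powr (- (1 / r)) * c powr p\<^sub>1))"
        proof (intro mult_left_mono suminf_le)
          fix n
          define a where "a = 2 powr (k n - 1) * \<tau>"
          have a: "0 < a"
            using \<tau> by (simp add: a_def)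
          have "epowr (decr_rearrangement \<mu> f a) p\<^sub>1 = ennreal (a powr (- (1 / r))) * epowr (lorentz_profile \<mu> p f a) p\<^sub>1"
            using a p1p by (simp add: decr_rearrangement_eq_profile[of a \<mu> f p] epowr_mult epowr_ennreal powr_powr)
          also have "\<dots> \<le> ennreal (a powr (- (1 / r))) * epowr (ennreal c) p\<^sub>1"
            unfolding \<mu>_def using p1 a by (intro mult_left_mono epowr_mono f_bnd) auto
          finally have "ennreal (2 powr (k n / r)) * epowr (decr_rearrangement \<mu> f a) p\<^sub>1
              \<le> ennreal (2 powr (k n / r)) * (ennreal (a powr (- (1 / r))) * epowr (ennreal c) p\<^sub>1)"
            by (rule mult_left_mono) simp
          also have "\<dots> = ennreal (2 powr (k n / r) * a powr (- (1 / r)) * c powr p\<^sub>1)"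
            using c by (simp add: epowr_ennreal ennreal_mult mult.assoc)
          also have "2 powr (k n / r) * a powr (- (1 / r)) = 2 powr (1 / r) * \<tau> powr (- (1 / r))"
          proof -
            have "2 powr (k n / r) * 2 powr ((k n - 1) * (- (1 / r))) = 2 powr (1 / r)"
              by (simp only: powr_add[symmetric]) (simp add: diff_divide_distrib left_diff_distrib)
            then show ?thesis
              using \<tau> by (simp only: a_def powr_mult powr_powr mult.assoc[symmetric])
          qed
          finally show "ennreal (2 powr (k n / r)) * epowr (decr_rearrangement \<mu> f (2 powr (k n - 1) * \<tau>)) p\<^sub>1
             \<le> ennreal (2 powr (1 / r) * \<tau> powr (- (1 / r)) * c powr p\<^sub>1)"
            by (simp only: a_def)
        qed auto
        also have "\<dots> < top"
          using dyadic_coeff_summable[OF \<epsilon>(1)] by (simp add: ennreal_mult_less_top)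
        finally show ?thesis .
      qed
      have "ennreal \<tau> * epowr l p\<^sub>1 = (\<integral>\<^sup>+x. epowr l p\<^sub>1 * h x \<partial>lebesgue)"
      proof -
        have "(\<integral>\<^sup>+x. epowr l p\<^sub>1 * h x \<partial>lebesgue) = epowr l p\<^sub>1 * (\<integral>\<^sup>+x. h x \<partial>lebesgue)"
          by (rule nn_integral_cmult) measurable
        also have "(\<integral>\<^sup>+x. h x \<partial>lebesgue) = emeasure \<mu> S"
          by (simp add: \<mu>_def emeasure_density h_def mult.commute)
        finally show ?thesis
          by (simp add: \<tau>'(1) mult.commute)
      qed
      also have "\<dots> \<le> pow_int p\<^sub>1 f H"
        unfolding pow_int_def
      proof (rule nn_integral_mono_AE)
        show "AE x in lebesgue. epowr l p\<^sub>1 * h x \<le> epowr (f x) p\<^sub>1 * H x"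
          using H(2)
        proof eventually_elim
          case (elim x)
          show ?case
          proof (cases "x \<in> S")
            case True
            then show ?thesis
              using elim p1 by (intro mult_mono epowr_mono) (auto simp: S_def)
          qed (simp add: h_def)
        qed
      qed
      also have "\<dots> \<le> ennreal C0 * pow_int p\<^sub>1 g H"
        by (rule C0(2)[OF H(1) fg f_fin])
      also have "\<dots> \<le> ennreal C0 * (ennreal (2 * A * \<tau>) * (\<Sum>n. dyadic_coeff \<epsilon> n *
          (ennreal (2 powr (k n / r)) * epowr (decr_rearrangement \<mu> g (2 powr (k n - 1) * \<tau>)) p\<^sub>1)))"
        unfolding \<mu>_def k_def
        by (intro mult_left_mono integral_le_rearrangement_sum[OF u H_meas A(1) \<tau>(2) r(3-5) \<epsilon>(2,3) H_int g_meas p p1 c(2) g_bnd]) auto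
      \<comment> \<open>Since t < \<tau>, passing from \<tau> to t enlarges the rearrangement and
        removes the dependence on the level.\<close>
      also have "\<dots> \<le> ennreal C0 * (ennreal (2 * A * \<tau>) * (\<Sum>n. dyadic_coeff \<epsilon> n *
          (ennreal (2 powr (k n / r)) * epowr (decr_rearrangement \<mu> g (2 powr (k n - 1) * t)) p\<^sub>1)))"
        using \<tau> p1 by (intro mult_left_mono suminf_le epowr_mono decr_rearrangement_antimono) auto
      also have "\<dots> = ennreal \<tau> * X"
        unfolding X_def C2_def using C0(1) A \<tau> by (simp add: ennreal_mult mult_ac)
      finally have "epowr l p\<^sub>1 \<le> X"
        using \<tau> by (simp add: ennreal_mult_le_mult_iff)
      then show ?thesis
        using p1 by (simp add: epowr_le_iff)
    qed simp
    have "decr_rearrangement \<mu> f t \<le> epowr X (1 / p\<^sub>1)"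
      by (rule dense_le) (rule level)
    then have "epowr (decr_rearrangement \<mu> f t) p\<^sub>1 \<le> X"
      using p1 by (simp add: epowr_le_iff)
    then have "ennreal (t powr (1 / r)) * epowr (decr_rearrangement \<mu> f t) p\<^sub>1 \<le> ennreal (t powr (1 / r)) * X"
      by (rule mult_left_mono) simp
    also have "ennreal (t powr (1 / r)) * X = ennreal (C2 * 2 powr (1 / r)) * (\<Sum>n. dyadic_coeff \<epsilon> n *
        epowr (lorentz_profile \<mu> p g (2 powr (k n - 1) * t)) p\<^sub>1)"
    proof -
      \<comment> \<open>The arguments of the rearrangement are 2^(k-1) t instead of 2^k t; this
        shift costs 2^(1/r).\<close>
      have term_eq: "ennreal (t powr (1 / r)) * ennreal (2 powr (k n / r)) * Y
        = ennreal (2 powr (1 / r)) * (ennreal ((2 powr (k n - 1) * t) powr (1 / r)) * Y)" for n Y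
      proof -
        have "t powr (1 / r) * 2 powr (k n / r) = 2 powr (1 / r) * (2 powr (k n - 1) * t) powr (1 / r)"
          using t by (simp add: powr_mult powr_powr powr_add[symmetric] diff_divide_distrib mult.left_commute)
        then show ?thesis
          by (simp add: ennreal_mult[symmetric] mult.assoc[symmetric])
      qed
      have prof: "epowr (lorentz_profile \<mu> p g s) p\<^sub>1 = ennreal (s powr (1 / r)) * epowr (decr_rearrangement \<mu> g s) p\<^sub>1" for s
        using p1p by (simp add: lorentz_profile_def epowr_mult epowr_ennreal powr_powr)
      have "ennreal (t powr (1 / r)) * X = ennreal C2 * (\<Sum>n. ennreal (t powr (1 / r)) * (dyadic_coeff \<epsilon> n *
        (ennreal (2 powr (k n / r)) * epowr (decr_rearrangement \<mu> g (2 powr (k n - 1) * t)) p\<^sub>1)))"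
        unfolding X_def ennreal_suminf_cmult by (rule mult.left_commute)
      also have "(\<lambda>n. ennreal (t powr (1 / r)) * (dyadic_coeff \<epsilon> n *
          (ennreal (2 powr (k n / r)) * epowr (decr_rearrangement \<mu> g (2 powr (k n - 1) * t)) p\<^sub>1)))
        = (\<lambda>n. ennreal (2 powr (1 / r)) * (dyadic_coeff \<epsilon> n * epowr (lorentz_profile \<mu> p g (2 powr (k n - 1) * t)) p\<^sub>1))"
        unfolding prof using term_eq by (simp add: mult.left_commute[of _ "dyadic_coeff \<epsilon> _"] mult.assoc)
      also have "ennreal C2 * (\<Sum>n. ennreal (2 powr (1 / r)) * (dyadic_coeff \<epsilon> n * epowr (lorentz_profile \<mu> p g (2 powr (k n - 1) * t)) p\<^sub>1))
        = ennreal (C2 * 2 powr (1 / r)) * (\<Sum>n. dyadic_coeff \<epsilon> n * epowr (lorentz_profile \<mu> p g (2 powr (k n - 1) * t)) p\<^sub>1)"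
        using C2 by (simp add: ennreal_mult mult.assoc)
      finally show ?thesis .
    qed
    finally show "epowr (lorentz_profile (density lebesgue u) p f t) p\<^sub>1 \<le> ennreal (C2 * 2 powr (1 / r)) * (\<Sum>n. dyadic_coeff \<epsilon> n *
        epowr (lorentz_profile (density lebesgue u) p g (2 powr (real_of_int (int_decode n) - 1) * t)) p\<^sub>1)"
      using p1p by (simp add: lorentz_profile_def epowr_mult epowr_ennreal powr_powr \<mu>_def k_def)
  qed
qed

end

section \<open>Positivity of the critical radius\<close>

lemma set_integral_eq_ball_int:
  assumes [measurable]: "f \<in> borel_measurable lebesgue" and "\<And>y. 0 \<le> f y"
  shows "(LINT y:ball x r|lebesgue. f y) = enn2real (ball_int (\<lambda>y. ennreal (f y)) x r)"
proof -
  have "(LINT y:ball x r|lebesgue. f y) = enn2real (\<integral>\<^sup>+y. ennreal (indicat_real (ball x r) y *\<^sub>R f y) \<partial>lebesgue)"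
    unfolding set_lebesgue_integral_def
  proof (rule integral_eq_nn_integral)
    show "(\<lambda>y. indicat_real (ball x r) y *\<^sub>R f y) \<in> borel_measurable lebesgue"
      by measurable
  qed (use assms(2) in auto)
  also have "(\<integral>\<^sup>+y. ennreal (indicat_real (ball x r) y *\<^sub>R f y) \<partial>lebesgue) = ball_int (\<lambda>y. ennreal (f y)) x r"
    unfolding ball_int_def by (intro nn_integral_cong) (simp add: indicator_def)
  finally show ?thesis .
qed

lemma locally_integrable_ball_int_finite:
  assumes [measurable]: "f \<in> borel_measurable lebesgue" and nn: "\<And>y. 0 \<le> f y" and "locally_integrable f"
  shows "ball_int (\<lambda>y. ennreal (f y)) x r < top"
proof -
  have "integrable lebesgue (\<lambda>y. indicat_real (cball x r) y *\<^sub>R f y)"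
    using assms(3) compact_cball[of x r] by (auto simp: locally_integrable_def set_integrable_def)
  then have "(\<integral>\<^sup>+y. ennreal (norm (indicat_real (cball x r) y *\<^sub>R f y)) \<partial>lebesgue) < top"
    by (simp add: integrable_iff_bounded)
  moreover have "ball_int (\<lambda>y. ennreal (f y)) x r \<le> (\<integral>\<^sup>+y. ennreal (norm (indicat_real (cball x r) y *\<^sub>R f y)) \<partial>lebesgue)"
    unfolding ball_int_def using nn by (intro nn_integral_mono) (auto simp: indicator_def)
  ultimately show ?thesis
    by (rule order_le_less_trans[rotated])
qed

lemma locally_integrable_of_ball_int_finite:
  fixes f :: "real^'n \<Rightarrow> real"
  assumes [measurable]: "f \<in> borel_measurable lebesgue" and nn: "\<And>y. 0 \<le> f y"
    and fin: "\<And>r. 0 < r \<Longrightarrow> ball_int (\<lambda>y. ennreal (f y)) 0 r < top"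
  shows "locally_integrable f"
  unfolding locally_integrable_def
proof (intro allI impI)
  fix K :: "(real^'n) set" assume K: "compact K"
  then obtain r where r: "0 < r" "K \<subseteq> ball 0 r"
    using compact_imp_bounded bounded_subset_ballD by blast
  have K_sets [measurable]: "K \<in> sets lebesgue"
    using K by (intro sets_completionI_sets) (auto intro: borel_compact)
  have "(\<integral>\<^sup>+y. ennreal (norm (indicat_real K y *\<^sub>R f y)) \<partial>lebesgue) \<le> ball_int (\<lambda>y. ennreal (f y)) 0 r"
    unfolding ball_int_def using r nn by (intro nn_integral_mono) (auto simp: indicator_def)
  also have "\<dots> < top"
    by (rule fin[OF r(1)])
  finally show "set_integrable lebesgue K f"
    unfolding set_integrable_def by (simp add: integrable_iff_bounded)
qed

text \<open>The supremum is meaningful only if the set of admissible radii is nonempty and bounded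
  above. At the exponent q = n/2 Hoelder and the reverse Hoelder inequality make r^(2-n) J(r)
  comparable to I(r)^(1/q), where I and J integrate V^q and V over the ball. Small balls have small
  I. Large balls must be shown to make I exceed a fixed threshold.\<close>

lemma crit_radius_pos:
  fixes V :: "real^'n \<Rightarrow> real"
  assumes n: "CARD('n) \<ge> 3" and V: "V \<in> reverse_Holder (real CARD('n) / 2)"
    and nz: "\<not> (AE x in lebesgue. V x = 0)"
  shows "0 < crit_radius V x"
proof -
  define q where "q = real CARD('n) / 2"
  have q: "1 < q"
    using n by (simp add: q_def)
  have V_meas [measurable]: "V \<in> borel_measurable lebesgue" and V_nn: "\<And>y. 0 \<le> V y"
    and V_loc: "locally_integrable (\<lambda>y. V y powr q)"
    using V by (auto simp: reverse_Holder_def q_def)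
  have Vq_meas [measurable]: "(\<lambda>y. V y powr q) \<in> borel_measurable lebesgue"
    by measurable
  obtain C where C: "0 < C" "\<And>r. 0 < r \<Longrightarrow>
      ((LINT y:ball x r|lebesgue. V y powr q) / measure lebesgue (ball x r)) powr (1 / q)
          \<le> C * ((LINT y:ball x r|lebesgue. V y) / measure lebesgue (ball x r))"
    using V by (auto simp: reverse_Holder_def q_def)
  define I J b where "I r = (LINT y:ball x r|lebesgue. V y powr q)"
    and "J r = (LINT y:ball x r|lebesgue. V y)" and "b r = measure lebesgue (ball x r)" for r
  define i where "i r = ball_int (\<lambda>y. ennreal (V y powr q)) x r" for r
  have i_I: "i r = ennreal (I r)" and I_nn: "0 \<le> I r" for r
    using locally_integrable_ball_int_finite[OF Vq_meas _ V_loc, of x r]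
    by (auto simp: i_def I_def set_integral_eq_ball_int[OF Vq_meas] less_top[symmetric])
  have J_nn: "0 \<le> J r" for r
    by (simp add: J_def set_integral_eq_ball_int[OF V_meas V_nn])
  have b_eq: "emeasure lebesgue (ball x r) = ennreal (b r)" for r
    by (simp add: b_def emeasure_eq_measure2 fmeasurableD2)
  have b_pos: "0 < r \<Longrightarrow> 0 < b r" for r
    by (simp add: b_def content_ball_pos)
  have b_nn: "0 \<le> b r" for r
    by (simp add: b_def)
  \<comment> \<open>Stated for subsets of the ball, since it is later applied to an annulus.\<close>
  have Hoelder: "(\<integral>\<^sup>+y\<in>S. ennreal (V y) \<partial>lebesgue)
      \<le> ennreal (2 * (enn2real (\<integral>\<^sup>+y\<in>S. ennreal (V y powr q) \<partial>lebesgue) powr (1 / q) * b r powr (1 - 1 / q)))"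
    if [measurable]: "S \<in> sets lebesgue" and S: "S \<subseteq> ball x r" for S r
  proof -
    have fin: "(\<integral>\<^sup>+y\<in>S. ennreal (V y powr q) \<partial>lebesgue) < top"
    proof -
      have "(\<integral>\<^sup>+y\<in>S. ennreal (V y powr q) \<partial>lebesgue) \<le> i r"
        unfolding i_def ball_int_def using S by (intro nn_integral_mono) (auto simp: indicator_def)
      then show ?thesis
        by (auto simp: i_I intro: order_le_less_trans)
    qed
    have "(\<integral>\<^sup>+y\<in>S. ennreal (V y) \<partial>lebesgue)
        = (\<integral>\<^sup>+y. epowr (ennreal (V y powr q) * indicator S y) (1 / q) * epowr (indicator S y) (1 - 1 / q) \<partial>lebesgue)"
      using V_nn q by (intro nn_integral_cong) (simp add: indicator_def epowr_ennreal powr_powr)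
    also have "\<dots> \<le> 2 * (epowr (\<integral>\<^sup>+y\<in>S. ennreal (V y powr q) \<partial>lebesgue) (1 / q) * epowr (\<integral>\<^sup>+y. indicator S y \<partial>lebesgue) (1 - 1 / q))"
      using q by (intro nn_integral_Hoelder) auto
    also have "\<dots> \<le> 2 * (epowr (ennreal (enn2real (\<integral>\<^sup>+y\<in>S. ennreal (V y powr q) \<partial>lebesgue))) (1 / q) * epowr (ennreal (b r)) (1 - 1 / q))"
    proof -
      have "(\<integral>\<^sup>+y. indicator S y \<partial>lebesgue) \<le> ennreal (b r)"
        unfolding b_eq[symmetric]
        by (simp only: nn_integral_indicator[OF that(1)] emeasure_mono[OF S ball_sets_lebesgue])
      then show ?thesis
        using q fin by (intro mult_left_mono mult_mono epowr_mono) auto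
    qed
    also have "\<dots> = ennreal (2 * (enn2real (\<integral>\<^sup>+y\<in>S. ennreal (V y powr q) \<partial>lebesgue) powr (1 / q) * b r powr (1 - 1 / q)))"
      using b_nn[of r] by (simp add: epowr_ennreal ennreal_mult)
    finally show ?thesis .
  qed
  have j_J: "ball_int (\<lambda>y. ennreal (V y)) x r = ennreal (J r)" for r
  proof -
    have "ball_int (\<lambda>y. ennreal (V y)) x r < top"
      using Hoelder[of "ball x r" r] unfolding ball_int_def[symmetric] by (auto intro: order_le_less_trans)
    then show ?thesis
      by (simp add: J_def set_integral_eq_ball_int[OF V_meas V_nn])
  qed
  have upper: "J r \<le> 2 * (I r powr (1 / q) * b r powr (1 - 1 / q))" for r
    using Hoelder[of "ball x r" r] i_I[of r] I_nn[of r] b_nn[of r] unfolding ball_int_def[symmetric] j_J i_def[symmetric]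
    by (simp add: ennreal_le_iff)
  have lower: "I r powr (1 / q) * b r powr (1 - 1 / q) \<le> C * J r" if r: "0 < r" for r
  proof -
    have "I r powr (1 / q) * b r powr (1 - 1 / q) = b r * ((I r / b r) powr (1 / q))"
      using b_pos[OF r] I_nn[of r] by (simp add: powr_divide powr_diff)
    also have "\<dots> \<le> b r * (C * (J r / b r))"
      using C(2)[OF r] b_pos[OF r] by (intro mult_left_mono) (auto simp: I_def J_def b_def)
    also have "\<dots> = C * J r"
      using b_pos[OF r] by simp
    finally show ?thesis .
  qed
  \<comment> \<open>Because q = n/2, the power 1 - 1/q of the volume of the ball is \<kappa>
    r^(n-2), the scaling in the definition of the critical radius.\<close>
  define \<kappa> where "\<kappa> = (unit_ball_vol (real CARD('n))) powr (1 - 1 / q)"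
  have \<kappa>: "0 < \<kappa>"
    using unit_ball_vol_pos[of "real CARD('n)"] unfolding \<kappa>_def by (subst powr_gt_zero) linarith
  have b_powr: "b r powr (1 - 1 / q) = \<kappa> * r powr (real CARD('n) - 2)" if r: "0 < r" for r
  proof -
    have "b r = unit_ball_vol (real CARD('n)) * r powr real CARD('n)"
      using r by (simp add: b_def content_ball powr_realpow)
    moreover have "real CARD('n) * (1 - 1 / q) = real CARD('n) - 2"
      by (simp add: q_def field_simps)
    ultimately show ?thesis
      using r by (simp add: \<kappa>_def powr_mult powr_powr)
  qed
  have I_mono: "I r \<le> I s" if "r \<le> s" for r s
  proof -
    have "ennreal (I r) \<le> ennreal (I s)"
      unfolding i_I[symmetric] i_def ball_int_def using that
      by (intro nn_integral_mono) (auto simp: indicator_def)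
    then show ?thesis
      using I_nn by simp
  qed
  define R where "R = {r. 0 < r \<and> r powr (2 - real CARD('n)) * J r \<le> 1}"
  have crit: "crit_radius V x = Sup R"
    by (simp add: crit_radius_def R_def J_def)
  obtain r0 where r0: "r0 \<in> R"
  proof -
    \<comment> \<open>Once I(r) < e, the Hoelder bound 2 \<kappa> I(r)^(1/q) is at most 1 and r is
      admissible; I(r) tends to 0 as the balls shrink to a null point.\<close>
    define e where "e = (1 / (2 * \<kappa>)) powr q"
    have e: "0 < e"
      using \<kappa> by (simp add: e_def)
    define m where "m = density lebesgue (\<lambda>y. ennreal (V y powr q))"
    have m_ball: "emeasure m (ball x r) = ennreal (I r)" for r
      unfolding m_def i_I[symmetric] i_def ball_int_def by (subst emeasure_density) auto
    have "(\<lambda>k. emeasure m (ball x (1 / (real k + 1)))) \<longlonglongrightarrow> emeasure m (\<Inter>k. ball x (1 / (real k + 1)))"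
    proof (rule Lim_emeasure_decseq)
      show "range (\<lambda>k. ball x (1 / (real k + 1))) \<subseteq> sets m"
        by (auto simp: m_def)
      show "decseq (\<lambda>k. ball x (1 / (real k + 1)))"
        by (intro decseq_SucI subset_ball) (simp add: frac_le)
    qed (simp add: m_ball)
    moreover have "emeasure m (\<Inter>k. ball x (1 / (real k + 1))) = 0"
    proof -
      have "(\<Inter>k. ball x (1 / (real k + 1))) = {x}"
      proof (intro equalityI subsetI)
        fix y assume y: "y \<in> (\<Inter>k. ball x (1 / (real k + 1)))"
        have "\<not> 0 < dist x y"
        proof
          assume "0 < dist x y"
          then obtain k where "inverse (real (Suc k)) < dist x y"
            using reals_Archimedean by blast
          moreover have "dist x y < 1 / (real k + 1)"
            using y by auto
          ultimately show False
            by (simp add: inverse_eq_divide add.commute)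
        qed
        then show "y \<in> {x}"
          by simp
      qed auto
      moreover have "emeasure m {x} = 0"
      proof -
        have "{x} \<in> null_sets lebesgue"
          by (intro null_sets_completionI finite_imp_null_set_lborel) simp
        then have "AE y in lebesgue. y \<notin> {x}"
          by (rule AE_not_in)
        then have "AE y in lebesgue. ennreal (V y powr q) * indicator {x} y = 0"
          by eventually_elim simp
        then show ?thesis
          unfolding m_def by (subst emeasure_density) (auto simp: nn_integral_0_iff_AE)
      qed
      ultimately show ?thesis
        by simp
    qed
    ultimately have "(\<lambda>k. emeasure m (ball x (1 / (real k + 1)))) \<longlonglongrightarrow> 0"
      by simp
    then have "eventually (\<lambda>k. emeasure m (ball x (1 / (real k + 1))) < ennreal e) sequentially"
      by (rule order_tendstoD(2)) (simp add: e)
    then obtain k where k: "emeasure m (ball x (1 / (real k + 1))) < ennreal e"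
      by (auto simp: eventually_sequentially)
    define r where "r = 1 / (real k + 1)"
    have r: "0 < r"
      by (simp add: r_def)
    have "I r < e"
      using k I_nn by (simp add: m_ball r_def ennreal_less_iff)
    then have "I r powr (1 / q) \<le> e powr (1 / q)"
      using I_nn q by (intro powr_mono2) auto
    also have "\<dots> = 1 / (2 * \<kappa>)"
      using q \<kappa> by (simp add: e_def powr_powr)
    finally have "2 * (I r powr (1 / q) * b r powr (1 - 1 / q)) \<le> 2 * (1 / (2 * \<kappa>) * b r powr (1 - 1 / q))"
      by (intro mult_left_mono mult_right_mono) auto
    then have "J r \<le> r powr (real CARD('n) - 2)"
      using upper[of r] \<kappa> b_powr[OF r] by simp
    then have "r powr (2 - real CARD('n)) * J r \<le> r powr (2 - real CARD('n)) * r powr (real CARD('n) - 2)"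
      by (rule mult_left_mono) simp
    also have "\<dots> = 1"
      using r by (simp flip: powr_add)
    finally show thesis
      using r that[of r] by (simp add: R_def)
  qed
  \<comment> \<open>If I stayed bounded, V^q would be integrable and its tail small. For large balls
    the reverse Hoelder inequality then forces a fixed ball to carry an integral of V growing like
    s^(n-2), which is absurd.\<close>
  have "\<exists>r>0. (C / \<kappa>) powr q < I r"
  proof (rule ccontr)
    assume "\<not> ?thesis"
    then have bd: "I r \<le> (C / \<kappa>) powr q" if "0 < r" for r
      using that by (meson not_less)
    define A where "A = (SUP r\<in>{0<..}. I r)"
    have bdd: "bdd_above (I ` {0<..})"
      using bd by (intro bdd_aboveI2) auto
    have I_le_A: "I r \<le> A" if "0 < r" for r
      unfolding A_def using that bdd by (intro cSUP_upper) auto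
    have A_pos: "0 < A"
    proof -
      have "\<not> (AE y in lebesgue. ennreal (V y powr q) = 0)"
      proof
        assume "AE y in lebesgue. ennreal (V y powr q) = 0"
        then have "AE y in lebesgue. V y = 0"
          by eventually_elim simp
        then show False
          using nz by simp
      qed
      then obtain k :: nat where "0 < ball_int (\<lambda>y. ennreal (V y powr q)) x (real k + 1)"
        using ex_ball_int_pos[of "\<lambda>y. ennreal (V y powr q)" x] by auto
      then have "0 < I (real k + 1)"
        using i_I[of "real k + 1"] by (simp add: i_def)
      then show ?thesis
        using I_le_A[of "real k + 1"] by simp
    qed
    define a where "a = (A / 2) powr (1 / q)"
    have a: "0 < a"
      using A_pos by (simp add: a_def)
    \<comment> \<open>The first entry keeps I(s) above A / 2; the second makes the contribution of
      the annulus at most half of the left side of the reverse Hoelder bound.\<close>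
    define \<delta> where "\<delta> = min (A / 2) ((a / (4 * C)) powr q)"
    have \<delta>: "0 < \<delta>" "\<delta> \<le> A / 2"
      using A_pos a C(1) by (auto simp: \<delta>_def)
    have \<delta>_powr: "\<delta> powr (1 / q) \<le> a / (4 * C)"
    proof -
      have "\<delta> powr (1 / q) \<le> ((a / (4 * C)) powr q) powr (1 / q)"
        using q \<delta> by (intro powr_mono2) (auto simp: \<delta>_def)
      then show ?thesis
        using q a C(1) by (simp add: powr_powr)
    qed
    obtain r where r: "0 < r" "A - \<delta> < I r"
      using less_cSUP_iff[OF _ bdd, of "A - \<delta>"] \<delta> by (auto simp: A_def)
    \<comment> \<open>The right side does not depend on s: the integral of V over the annulus beyond
      r has been absorbed.\<close>
    have bound: "b s powr (1 - 1 / q) \<le> 2 * C * J r / a" if s: "r \<le> s" for s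
    proof -
      have s0: "0 < s"
        using r s by simp
      let ?S = "ball x s - ball x r"
      have sub: "ball x r \<subseteq> ball x s"
        using s by auto
      have split: "indicator (ball x s) y = indicator (ball x r) y + (indicator ?S y :: ennreal)" for y
        using sub by (auto simp: indicator_def)
      have "ennreal (I s) = ennreal (I r) + (\<integral>\<^sup>+y\<in>?S. ennreal (V y powr q) \<partial>lebesgue)"
        unfolding i_I[symmetric] i_def ball_int_def split[of _] by (simp add: distrib_left nn_integral_add)
      then have diff: "(\<integral>\<^sup>+y\<in>?S. ennreal (V y powr q) \<partial>lebesgue) \<le> ennreal \<delta>"
      proof (cases "\<integral>\<^sup>+y\<in>?S. ennreal (V y powr q) \<partial>lebesgue")
        case (real z)
        then have "ennreal (I s) = ennreal (I r + z)"
          using \<open>ennreal (I s) = _\<close> I_nn by simp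
        then have "I s = I r + z"
          using I_nn real by (subst (asm) ennreal_inj) auto
        then show ?thesis
          using real r(2) I_le_A[OF s0] by (auto intro!: ennreal_leI)
      qed auto
      then have "enn2real (\<integral>\<^sup>+y\<in>?S. ennreal (V y powr q) \<partial>lebesgue) \<le> \<delta>"
        using \<delta> by (simp add: enn2real_leI)
      then have "enn2real (\<integral>\<^sup>+y\<in>?S. ennreal (V y powr q) \<partial>lebesgue) powr (1 / q) \<le> \<delta> powr (1 / q)"
        using q by (intro powr_mono2) auto
      then have small: "enn2real (\<integral>\<^sup>+y\<in>?S. ennreal (V y powr q) \<partial>lebesgue) powr (1 / q) \<le> a / (4 * C)"
        using \<delta>_powr by simp
      have "ennreal (J s) = ennreal (J r) + (\<integral>\<^sup>+y\<in>?S. ennreal (V y) \<partial>lebesgue)"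
        unfolding j_J[symmetric] ball_int_def split[of _] by (simp add: distrib_left nn_integral_add)
      also have "\<dots> \<le> ennreal (J r) + ennreal (2 * (a / (4 * C) * b s powr (1 - 1 / q)))"
        using small b_nn[of s] by (intro add_left_mono order_trans[OF Hoelder[of _ s]] ennreal_leI mult_left_mono mult_right_mono) auto
      also have "\<dots> = ennreal (J r + 2 * (a / (4 * C) * b s powr (1 - 1 / q)))"
        using J_nn a C(1) by (subst ennreal_plus) auto
      finally have Js: "J s \<le> J r + 2 * (a / (4 * C) * b s powr (1 - 1 / q))"
        using J_nn[of r] a C(1) by (subst (asm) ennreal_le_iff) auto
      have "A / 2 \<le> I s"
        using r(2) \<delta>(2) I_mono[OF s] by linarith
      then have "a \<le> I s powr (1 / q)"
        unfolding a_def using A_pos q by (intro powr_mono2) auto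
      then have "a * b s powr (1 - 1 / q) \<le> I s powr (1 / q) * b s powr (1 - 1 / q)"
        by (rule mult_right_mono) simp
      also have "\<dots> \<le> C * J s"
        by (rule lower[OF s0])
      also have "\<dots> \<le> C * (J r + 2 * (a / (4 * C) * b s powr (1 - 1 / q)))"
        using C(1) by (intro mult_left_mono Js) auto
      also have "\<dots> = C * J r + a * b s powr (1 - 1 / q) / 2"
        using C(1) by (simp add: field_simps)
      finally show ?thesis
        using a by (simp add: field_simps)
    qed
    define L where "L = 2 * C * J r / a"
    define s where "s = max (max r 1) (L / \<kappa> + 1)"
    have s: "r \<le> s" "1 \<le> s" "L / \<kappa> < s"
      by (auto simp: s_def less_max_iff_disj)
    have "\<kappa> * s powr 1 \<le> \<kappa> * s powr (real CARD('n) - 2)"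
      using s(2) n \<kappa> by (intro mult_left_mono powr_mono) auto
    also have "\<dots> \<le> L"
      using bound[OF s(1)] b_powr[of s] s(2) by (simp add: L_def)
    finally have "s \<le> L / \<kappa>"
      using \<kappa> s(2) by (simp add: field_simps)
    then show False
      using s(3) by simp
  qed
  then obtain r1 where r1: "0 < r1" "(C / \<kappa>) powr q < I r1"
    by blast
  \<comment> \<open>Above the threshold (C / \<kappa>)^q the reverse Hoelder inequality gives
    r^(2-n) J(r) > 1, so no larger radius is admissible.\<close>
  have "r \<le> r1" if r: "r \<in> R" for r
  proof (rule ccontr)
    assume "\<not> r \<le> r1"
    then have gt: "(C / \<kappa>) powr q < I r"
      using r1(2) I_mono[of r1 r] by simp
    have r_pos: "0 < r" and le: "r powr (2 - real CARD('n)) * J r \<le> 1"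
      using r by (auto simp: R_def)
    have "C / \<kappa> < I r powr (1 / q)"
    proof -
      have "((C / \<kappa>) powr q) powr (1 / q) < I r powr (1 / q)"
        using gt q by (intro powr_less_mono2) auto
      then show ?thesis
        using q C(1) \<kappa> by (simp add: powr_powr)
    qed
    then have "C < I r powr (1 / q) * \<kappa>"
      using \<kappa> by (simp add: field_simps)
    then have "C * r powr (real CARD('n) - 2) < I r powr (1 / q) * \<kappa> * r powr (real CARD('n) - 2)"
      using r_pos by (intro mult_strict_right_mono) auto
    also have "\<dots> \<le> C * J r"
      using lower[OF r_pos] b_powr[OF r_pos] by (simp add: mult.assoc)
    finally have "r powr (real CARD('n) - 2) < J r"
      using C(1) by simp
    then have "r powr (2 - real CARD('n)) * r powr (real CARD('n) - 2) < r powr (2 - real CARD('n)) * J r"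
      using r_pos by (intro mult_strict_left_mono) auto
    moreover have "r powr (2 - real CARD('n)) * r powr (real CARD('n) - 2) = 1"
      using r_pos by (simp flip: powr_add)
    ultimately show False
      using le by simp
  qed
  then have "bdd_above R"
    by (rule bdd_aboveI)
  then have "r0 \<le> Sup R"
    using r0 by (rule cSup_upper[rotated])
  then show ?thesis
    using r0 by (simp add: crit R_def)
qed

section \<open>Vector-valued and Lorentz estimates\<close>

text \<open>Brings sums over an arbitrary index set into the form needed for monotone convergence
  and measurability.\<close>

lemma infsum_ennreal_eq_suminf:
  fixes g :: "nat \<Rightarrow> ennreal"
  shows "(\<Sum>\<^sub>\<infinity>j\<in>J. g j) = (\<Sum>j. g j * indicator J j)"
proof -
  have "(\<Sum>\<^sub>\<infinity>j\<in>J. g j) = (\<Sum>\<^sub>\<infinity>j. g j * indicator J j)"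
    by (rule infsum_cong_neutral) auto
  moreover have "((\<lambda>j. g j * indicator J j) has_sum (\<Sum>\<^sub>\<infinity>j. g j * indicator J j)) UNIV"
    by (intro has_sum_infsum nonneg_summable_on_complete) simp
  ultimately show ?thesis
    using has_sum_imp_sums sums_unique by metis
qed

lemma le_suminf_ennreal: "f j \<le> (\<Sum>j. f j :: ennreal)"
  using sum_le_suminf[of f "{j}"] by simp

lemma lq_sum_measurable:
  assumes "\<And>j. j \<in> J \<Longrightarrow> f j \<in> borel_measurable M"
  shows "lq_sum q J f \<in> borel_measurable M"
proof -
  have [measurable]: "(\<lambda>x. epowr (f j x) q * indicator J j) \<in> borel_measurable M" for j
    using assms[of j] by (cases "j \<in> J") auto
  show ?thesis
    unfolding lq_sum_def[abs_def] infsum_ennreal_eq_suminf by measurable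
qed

lemma pow_int_lq_sum:
  assumes q: "0 < q" and [measurable]: "u \<in> borel_measurable lebesgue"
    and f: "\<And>j. j \<in> J \<Longrightarrow> f j \<in> borel_measurable lebesgue"
  shows "pow_int q (lq_sum q J f) u = (\<Sum>j. pow_int q (f j) u * indicator J j)"
proof -
  have meas: "(\<lambda>x. epowr (f j x) q * u x * indicator J j) \<in> borel_measurable lebesgue" for j
    using f[of j] by (cases "j \<in> J") auto
  have "pow_int q (lq_sum q J f) u = (\<integral>\<^sup>+x. (\<Sum>j. epowr (f j x) q * u x * indicator J j) \<partial>lebesgue)"
    unfolding pow_int_def using q
    by (intro nn_integral_cong) (simp add: lq_sum_def infsum_ennreal_eq_suminf ennreal_suminf_multc[symmetric] mult_ac)
  also have "\<dots> = (\<Sum>j. \<integral>\<^sup>+x. epowr (f j x) q * u x * indicator J j \<partial>lebesgue)"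
    by (rule nn_integral_suminf) (rule meas)
  also have "\<dots> = (\<Sum>j. pow_int q (f j) u * indicator J j)"
    unfolding pow_int_def by (intro suminf_cong) (auto simp: indicator_def)
  finally show ?thesis .
qed

text \<open>Collects the l^q sums into an ordinary family of pairs, so that the scalar results apply
  to it.\<close>

definition lq_family :: "real \<Rightarrow> (('a \<Rightarrow> ennreal) \<times> ('a \<Rightarrow> ennreal)) set \<Rightarrow> (('a \<Rightarrow> ennreal) \<times> ('a \<Rightarrow> ennreal)) set" where
  "lq_family q F = {(lq_sum q J (\<lambda>j. fst (h j)), lq_sum q J (\<lambda>j. snd (h j))) | J h. (J, h) \<in> pair_seqs F}"

lemma lq_family_measurable:
  assumes F_meas: "\<And>f g. (f, g) \<in> F \<Longrightarrow> f \<in> borel_measurable M \<and> g \<in> borel_measurable M"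
    and "(f, g) \<in> lq_family q F"
  shows "f \<in> borel_measurable M \<and> g \<in> borel_measurable M"
proof -
  obtain J h where h: "f = lq_sum q J (\<lambda>j. fst (h j))" "g = lq_sum q J (\<lambda>j. snd (h j))" "\<And>j. j \<in> J \<Longrightarrow> h j \<in> F"
    using assms(2) by (auto simp: lq_family_def pair_seqs_def)
  show ?thesis
    unfolding h(1,2) using h(3) F_meas by (intro conjI lq_sum_measurable) (metis prod.collapse)+
qed

context ball_gauge
begin

lemma muckenhoupt_weaken:
  assumes u: "muckenhoupt q N K u" and "K \<le> K'"
  shows "muckenhoupt q N K' u"
  unfolding muckenhoupt_def
proof (intro conjI allI impI)
  fix c :: 'a and r :: real assume r: "0 < r"
  have "ball_int u c r * epowr (ball_int (dual_weight q u) c r) (q - 1)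
      \<le> ennreal (K * d c r powr N) * epowr (emeasure lebesgue (ball c r)) q"
    by (rule muckenhoupt_ineq[OF u r])
  also have "\<dots> \<le> ennreal (K' * d c r powr N) * epowr (emeasure lebesgue (ball c r)) q"
    using assms(2) by (intro mult_right_mono ennreal_leI) auto
  finally show "ball_int u c r * epowr (ball_int (dual_weight q u) c r) (q - 1)
      \<le> ennreal (K' * d c r powr N) * epowr (emeasure lebesgue (ball c r)) q" .
qed (use assms in \<open>auto simp: muckenhoupt_def\<close>)

text \<open>At p = q the integral of the q-th power of an l^q sum is the sum of the integrals, and
  the estimate adds up term by term; finiteness of the sum passes to each term.\<close>

lemma pair_estimate_lq_family:
  assumes est: "pair_estimate F q" and q: "0 < q"
    and F_meas: "\<And>f g. (f, g) \<in> F \<Longrightarrow> f \<in> borel_measurable lebesgue \<and> g \<in> borel_measurable lebesgue"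
  shows "pair_estimate (lq_family q F) q"
  unfolding pair_estimate_def
proof (intro allI impI)
  fix r N K :: real assume "1 < r" "0 \<le> N" "0 < K"
  then obtain C where C: "0 < C" "\<And>u f g. muckenhoupt r N K u \<Longrightarrow> (f, g) \<in> F \<Longrightarrow> pow_int q f u < top \<Longrightarrow>
    pow_int q f u \<le> ennreal C * pow_int q g u"
    using pair_estimateE[OF est] by blast
  show "\<exists>C>0. \<forall>u. muckenhoupt r N K u \<longrightarrow> (\<forall>(f, g)\<in>lq_family q F. pow_int q f u < top \<longrightarrow> pow_int q f u \<le> ennreal C * pow_int q g u)"
  proof (intro exI[of _ C] conjI allI impI C(1), safe)
    fix u f g assume u: "muckenhoupt r N K u" and fg: "(f, g) \<in> lq_family q F" and fin: "pow_int q f u < top"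
    obtain J h where h: "f = lq_sum q J (\<lambda>j. fst (h j))" "g = lq_sum q J (\<lambda>j. snd (h j))" "\<And>j. j \<in> J \<Longrightarrow> h j \<in> F"
      using fg by (auto simp: lq_family_def pair_seqs_def)
    have meas: "fst (h j) \<in> borel_measurable lebesgue" "snd (h j) \<in> borel_measurable lebesgue" if "j \<in> J" for j
      using h(3)[OF that] F_meas by (metis prod.collapse)+
    have u_meas: "u \<in> borel_measurable lebesgue"
      by (rule muckenhoupt_measurable[OF u])
    have f_eq: "pow_int q f u = (\<Sum>j. pow_int q (fst (h j)) u * indicator J j)"
      unfolding h(1) by (intro pow_int_lq_sum q u_meas meas)
    have g_eq: "pow_int q g u = (\<Sum>j. pow_int q (snd (h j)) u * indicator J j)"
      unfolding h(2) by (intro pow_int_lq_sum q u_meas meas)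
    have "pow_int q f u \<le> (\<Sum>j. ennreal C * (pow_int q (snd (h j)) u * indicator J j))"
      unfolding f_eq
    proof (rule suminf_le)
      fix j
      show "pow_int q (fst (h j)) u * indicator J j \<le> ennreal C * (pow_int q (snd (h j)) u * indicator J j)"
      proof (cases "j \<in> J")
        case True
        have "pow_int q (fst (h j)) u * indicator J j \<le> pow_int q f u"
          unfolding f_eq by (rule le_suminf_ennreal)
        then have "pow_int q (fst (h j)) u < top"
          using True fin by (auto intro: order_le_less_trans)
        then show ?thesis
          using C(2)[OF u, of "fst (h j)" "snd (h j)"] h(3)[OF True] True by simp
      qed simp
    qed auto
    then show "pow_int q f u \<le> ennreal C * pow_int q g u"
      by (simp add: g_eq)
  qed
qed

text \<open>An infinite right side is trivial because the constant is positive. Otherwise both norms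
  are finite and both profiles bounded, as the profile estimate requires.\<close>

lemma Lorentz_estimate:
  assumes est: "\<And>p. 0 < p \<Longrightarrow> pair_estimate F p" and p: "0 < p" and s: "0 < s"
    and F_meas: "\<And>f g. (f, g) \<in> F \<Longrightarrow> f \<in> borel_measurable lebesgue \<and> g \<in> borel_measurable lebesgue"
    and q: "1 < q" and N: "0 \<le> N" and K: "0 < K"
  shows "\<exists>C>0. \<forall>u. muckenhoupt q N K u \<longrightarrow> (\<forall>(f, g)\<in>F. Lorentz_norm (density lebesgue u) p s f < top \<longrightarrow>
    Lorentz_norm (density lebesgue u) p s f \<le> ennreal C * Lorentz_norm (density lebesgue u) p s g)"
proof -
  obtain p\<^sub>1 \<epsilon> C where C: "0 < p\<^sub>1" "0 < \<epsilon>" "0 < C"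
    "\<And>u f g c c' t. muckenhoupt q N K u \<Longrightarrow> (f, g) \<in> F \<Longrightarrow> 0 < c \<Longrightarrow> 0 < c' \<Longrightarrow>
      (\<And>s. 0 < s \<Longrightarrow> lorentz_profile (density lebesgue u) p f s \<le> ennreal c) \<Longrightarrow>
      (\<And>s. 0 < s \<Longrightarrow> lorentz_profile (density lebesgue u) p g s \<le> ennreal c') \<Longrightarrow> 0 < t \<Longrightarrow>
      epowr (lorentz_profile (density lebesgue u) p f t) p\<^sub>1 \<le> ennreal C * (\<Sum>n. dyadic_coeff \<epsilon> n *
        epowr (lorentz_profile (density lebesgue u) p g (2 powr (real_of_int (int_decode n) - 1) * t)) p\<^sub>1)"
    by (rule lorentz_profile_estimate[OF est p F_meas q N K]) (assumption | blast)+
  define D where "D = (if s = \<infinity> then epowr (ennreal C * (\<Sum>n. dyadic_coeff \<epsilon> n)) (1 / p\<^sub>1)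
       else epowr (epowr (ennreal C * (\<Sum>n. dyadic_coeff (\<epsilon> / 2) n)) (enn2real s / p\<^sub>1)
         * (\<Sum>n. dyadic_coeff (\<epsilon> * (enn2real s / p\<^sub>1 / 2)) n)) (1 / enn2real s))"
  have s_pos: "0 < enn2real s" if "s \<noteq> \<infinity>"
    using s that by (simp add: enn2real_positive_iff less_top)
  have "D < top"
    unfolding D_def using C(1-3) s_pos by (auto simp: ennreal_mult_less_top dyadic_coeff_summable)
  show ?thesis
  proof (intro exI[of _ "enn2real D + 1"] conjI allI impI, safe)
    show "0 < enn2real D + 1"
      by (simp add: add_nonneg_pos)
    fix u f g assume u: "muckenhoupt q N K u" and fg: "(f, g) \<in> F"
      and fin: "Lorentz_norm (density lebesgue u) p s f < top"
    let ?\<mu> = "density lebesgue u"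
    show "Lorentz_norm ?\<mu> p s f \<le> ennreal (enn2real D + 1) * Lorentz_norm ?\<mu> p s g"
    proof (cases "Lorentz_norm ?\<mu> p s g < top")
      case True
      obtain c where c: "0 < c" "\<And>t. 0 < t \<Longrightarrow> lorentz_profile ?\<mu> p f t \<le> ennreal c"
        by (rule lorentz_profile_bounded[OF p s fin]) blast
      obtain c' where c': "0 < c'" "\<And>t. 0 < t \<Longrightarrow> lorentz_profile ?\<mu> p g t \<le> ennreal c'"
        by (rule lorentz_profile_bounded[OF p s True]) blast
      have "Lorentz_norm ?\<mu> p s f \<le> D * Lorentz_norm ?\<mu> p s g"
        unfolding D_def using C(4)[OF u fg c(1) c'(1) c(2) c'(2)]
        by (intro Lorentz_norm_le_of_profile C(1,2) s) auto
      also have "\<dots> \<le> ennreal (enn2real D + 1) * Lorentz_norm ?\<mu> p s g"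
        using \<open>D < top\<close> by (intro mult_right_mono) (cases D, auto intro: ennreal_leI)
      finally show ?thesis .
    next
      case False
      have "0 < enn2real D + 1"
        by (simp add: add_nonneg_pos)
      then show ?thesis
        using False by (simp add: less_top[symmetric] ennreal_mult_top)
    qed
  qed
qed

end

section \<open>The gauge of the critical radius\<close>

text \<open>Local integrability gives measurability of the cut-offs to compact sets only; the weight
  is their pointwise limit.\<close>

lemma weight_measurable:
  fixes \<omega> :: "real^'n \<Rightarrow> real"
  assumes "weight \<omega>" shows "\<omega> \<in> borel_measurable lebesgue"
proof (rule borel_measurable_LIMSEQ_real)
  fix x :: "real^'n"
  obtain k :: nat where k: "dist 0 x \<le> real k"
    using real_arch_simple by blast
  have "eventually (\<lambda>k. indicat_real (cball 0 (real k)) x * \<omega> x = \<omega> x) sequentially"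
    unfolding eventually_sequentially using k by (intro exI[of _ k]) (auto intro: order_trans)
  then show "(\<lambda>k. indicat_real (cball 0 (real k)) x * \<omega> x) \<longlonglongrightarrow> \<omega> x"
    by (rule tendsto_eventually)
next
  fix k :: nat
  have "set_integrable lebesgue (cball 0 (real k)) \<omega>"
    using assms by (auto simp: weight_def locally_integrable_def)
  then show "(\<lambda>x. indicat_real (cball 0 (real k)) x * \<omega> x) \<in> borel_measurable lebesgue"
    by (auto simp: set_integrable_def dest: borel_measurable_integrable)
qed

definition crit_gauge :: "(real^'n \<Rightarrow> real) \<Rightarrow> real^'n \<Rightarrow> real \<Rightarrow> real" where
  "crit_gauge V x r = 1 + r / crit_radius V x"

locale positive_crit_radius =
  fixes V :: "real^'n \<Rightarrow> real"
  assumes crit_pos: "0 < crit_radius V x"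
begin

sublocale ball_gauge "crit_gauge V"
  by unfold_locales (auto simp: crit_gauge_def less_imp_le[OF crit_pos])

lemma Psi_average_eq:
  assumes r: "0 < r" and f: "\<And>y. 0 \<le> f y"
  shows "Psi_average V \<theta> f c r
    = ball_int (\<lambda>y. ennreal (f y)) c r / (ennreal (crit_gauge V c r powr \<theta>) * ball_int (\<lambda>_. 1) c r)"
proof -
  have "emeasure lebesgue (ball c r) = ennreal (measure lebesgue (ball c r))"
    by (simp add: emeasure_eq_measure2 fmeasurableD2)
  then show ?thesis
    using f by (simp only: Psi_average_def Psi_def crit_gauge_def ball_int_one)
      (simp add: ball_int_def ennreal_mult)
qed

lemma maximal_fun_eq:
  "(\<And>y. 0 \<le> f y) \<Longrightarrow> maximal_fun V \<theta> f x = maxop1 \<theta> (\<lambda>y. ennreal (f y)) x"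
  unfolding maximal_fun_def maxop_def by (intro SUP_cong refl) (auto simp: Psi_average_eq simp del: ball_int_one)

text \<open>The two averages carry the denominator Z = Psi |B| to the powers 1 and t - 1, together
  Z^t; this is the origin of the growth exponent \<theta> t.\<close>

lemma Ap_condition_iff:
  assumes t: "1 < t" and \<omega>: "\<And>y. 0 \<le> \<omega> y"
  shows "Ap_condition V \<theta> t \<omega> L \<longleftrightarrow> (\<forall>c r. 0 < r \<longrightarrow>
    ball_int (\<lambda>y. ennreal (\<omega> y)) c r * epowr (ball_int (dual_weight t (\<lambda>y. ennreal (\<omega> y))) c r) (t - 1)
      \<le> L * (ennreal (crit_gauge V c r powr (\<theta> * t)) * epowr (emeasure lebesgue (ball c r)) t))"
proof -
  have "Psi_average V \<theta> \<omega> c r * epowr (Psi_average V \<theta> (\<lambda>x. \<omega> x powr (- 1 / (t - 1))) c r) (t - 1) \<le> L \<longleftrightarrow>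
    ball_int (\<lambda>y. ennreal (\<omega> y)) c r * epowr (ball_int (dual_weight t (\<lambda>y. ennreal (\<omega> y))) c r) (t - 1)
      \<le> L * (ennreal (crit_gauge V c r powr (\<theta> * t)) * epowr (emeasure lebesgue (ball c r)) t)" if r: "0 < r" for c r
  proof -
    obtain b where b: "0 < b" "emeasure lebesgue (ball c r) = ennreal b"
      using emeasure_ball_real[OF r] by blast
    define \<delta> where "\<delta> = crit_gauge V c r"
    have \<delta>: "0 < \<delta>"
      using gauge_ge_one[OF r, of c] by (simp add: \<delta>_def)
    define Z where "Z = \<delta> powr \<theta> * b"
    have Z: "0 < Z" and Zt: "Z powr t = \<delta> powr (\<theta> * t) * b powr t"
      using \<delta> b by (simp_all add: Z_def powr_mult powr_powr)
    define X where "X = ball_int (\<lambda>y. ennreal (\<omega> y)) c r * epowr (ball_int (dual_weight t (\<lambda>y. ennreal (\<omega> y))) c r) (t - 1)"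
    have dual: "(\<lambda>y. ennreal (\<omega> y powr (- 1 / (t - 1)))) = dual_weight t (\<lambda>y. ennreal (\<omega> y))"
      using \<omega> by (intro ext) (simp add: dual_weight_def epowr_ennreal)
    have Zden: "ennreal (\<delta> powr \<theta>) * ball_int (\<lambda>_. 1) c r = ennreal Z"
      using b by (simp only: ball_int_one Z_def ennreal_mult powr_ge_zero less_imp_le)
    have "Psi_average V \<theta> \<omega> c r * epowr (Psi_average V \<theta> (\<lambda>x. \<omega> x powr (- 1 / (t - 1))) c r) (t - 1)
        = X * (ennreal (1 / Z) * epowr (ennreal (1 / Z)) (t - 1))"
      unfolding Psi_average_eq[OF r \<omega>] Psi_average_eq[OF r powr_ge_zero] dual \<delta>_def[symmetric] Zden
        ennreal_divide_conv_mult[OF Z] epowr_mult X_def by (simp only: mult_ac)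
    also have "ennreal (1 / Z) * epowr (ennreal (1 / Z)) (t - 1) = ennreal (1 / Z powr t)"
      using epowr_add[of "ennreal (1 / Z)" 1 "t - 1"] Z by (simp add: epowr_ennreal powr_divide)
    finally have eq: "Psi_average V \<theta> \<omega> c r * epowr (Psi_average V \<theta> (\<lambda>x. \<omega> x powr (- 1 / (t - 1))) c r) (t - 1)
        = X * ennreal (1 / Z powr t)" .
    have "X * ennreal (1 / Z powr t) \<le> L \<longleftrightarrow> ennreal (Z powr t) * (X * ennreal (1 / Z powr t)) \<le> ennreal (Z powr t) * L"
      using Z by (subst ennreal_mult_le_mult_iff) auto
    also have "ennreal (Z powr t) * (X * ennreal (1 / Z powr t)) = X"
      using Z by (simp add: mult.left_commute[of _ X] ennreal_mult[symmetric])
    also have "ennreal (Z powr t) * L = L * (ennreal (\<delta> powr (\<theta> * t)) * epowr (ennreal b) t)"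
      using b by (simp add: Zt epowr_ennreal ennreal_mult mult_ac)
    finally show ?thesis
      unfolding eq X_def \<delta>_def b(2) .
  qed
  then show ?thesis
    using t by (simp add: Ap_condition_def)
qed

text \<open>Passing from t to t + 1 treats t = 1 on the same footing as t > 1: A_1 lies in A_2, and
  A_t in A_(t+1) at the cost of 2^t.\<close>

lemma A_p_imp_muckenhoupt:
  assumes t: "1 \<le> t" and \<theta>: "0 \<le> \<theta>" and K: "0 < K"
    and \<omega>: "\<omega> \<in> A_p V \<theta> t" and const: "Ap_const V \<theta> t \<omega> \<le> ennreal K"
  shows "muckenhoupt (t + 1) (\<theta> * t) (2 powr t * (K + 1)) (\<lambda>x. ennreal (\<omega> x))"
proof -
  have w: "weight \<omega>"
    using \<omega> by (simp add: A_p_def)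
  have [measurable]: "\<omega> \<in> borel_measurable lebesgue"
    by (rule weight_measurable[OF w])
  have pos: "0 < \<omega> x" for x
    using w by (simp add: weight_def)
  \<comment> \<open>\<open>Ap_const\<close> is an infimum; enlarging K to K + 1 gives strict
    inequality and with it an actual admissible constant.\<close>
  have "Ap_const V \<theta> t \<omega> < ennreal (K + 1)"
    using const K by (intro order_le_less_trans[OF const]) (simp add: ennreal_less_iff)
  then obtain L where L: "Ap_condition V \<theta> t \<omega> L" "L \<le> ennreal (K + 1)"
    by (auto simp: Ap_const_def Inf_less_iff less_imp_le)
  show ?thesis
  proof (cases "t = 1")
    case True
    have "AE x in lebesgue. maxop1 \<theta> (\<lambda>x. ennreal (\<omega> x)) x \<le> ennreal (K + 1) * ennreal (\<omega> x)"
    proof -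
      have "AE x in lebesgue. maximal_fun V \<theta> \<omega> x \<le> L * ennreal (\<omega> x)"
        using L(1) True by (simp add: Ap_condition_def)
      then show ?thesis
      proof eventually_elim
        case (elim x)
        also have "L * ennreal (\<omega> x) \<le> ennreal (K + 1) * ennreal (\<omega> x)"
          by (intro mult_right_mono L) simp
        finally show ?case
          by (simp add: maximal_fun_eq less_imp_le[OF pos])
      qed
    qed
    then have "muckenhoupt 2 \<theta> (K + 1) (\<lambda>x. ennreal (\<omega> x))"
      using pos K \<theta> by (intro A1_imp_muckenhoupt) auto
    then have "muckenhoupt 2 \<theta> (2 * (K + 1)) (\<lambda>x. ennreal (\<omega> x))"
      by (rule muckenhoupt_weaken) (use K in simp)
    then show ?thesis
      using True by simp
  next
    case False
    then have t: "1 < t"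
      using t by simp
    have "muckenhoupt t (\<theta> * t) (K + 1) (\<lambda>x. ennreal (\<omega> x))"
      unfolding muckenhoupt_def
    proof (intro conjI allI impI)
      fix c :: "real^'n" and r :: real assume r: "0 < r"
      have "ball_int (\<lambda>y. ennreal (\<omega> y)) c r * epowr (ball_int (dual_weight t (\<lambda>y. ennreal (\<omega> y))) c r) (t - 1)
        \<le> L * (ennreal (crit_gauge V c r powr (\<theta> * t)) * epowr (emeasure lebesgue (ball c r)) t)"
        using L(1) r unfolding Ap_condition_iff[OF t less_imp_le[OF pos]] by blast
      also have "\<dots> \<le> ennreal (K + 1) * (ennreal (crit_gauge V c r powr (\<theta> * t)) * epowr (emeasure lebesgue (ball c r)) t)"
        by (intro mult_right_mono L) simp
      also have "\<dots> = ennreal ((K + 1) * crit_gauge V c r powr (\<theta> * t)) * epowr (emeasure lebesgue (ball c r)) t"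
        using K by (subst ennreal_mult) (auto simp: mult.assoc)
      finally show "ball_int (\<lambda>y. ennreal (\<omega> y)) c r * epowr (ball_int (dual_weight t (\<lambda>y. ennreal (\<omega> y))) c r) (t - 1)
        \<le> ennreal ((K + 1) * crit_gauge V c r powr (\<theta> * t)) * epowr (emeasure lebesgue (ball c r)) t" .
    qed (use K \<theta> t pos in auto)
    from muckenhoupt_mono[OF this t, of "t + 1"] show ?thesis
      by simp
  qed
qed

text \<open>The way back, with \<theta> = N / q undoing N = \<theta> q. It lets the hypothesis on
  real weights be applied to the auxiliary weights W^(-\<beta>) u and H.\<close>

lemma muckenhoupt_imp_A_p:
  assumes u: "muckenhoupt q N K u" and q: "1 < q"
  shows "(\<lambda>x. enn2real (u x)) \<in> A_p V (N / q) q" and "Ap_const V (N / q) q (\<lambda>x. enn2real (u x)) \<le> ennreal K"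
proof -
  have u_eq: "(\<lambda>x. ennreal (enn2real (u x))) = u"
    using muckenhoupt_finite[OF u] by auto
  have K: "0 < K" and [measurable]: "u \<in> borel_measurable lebesgue"
    using u by (auto simp: muckenhoupt_def)
  have cond: "Ap_condition V (N / q) q (\<lambda>x. enn2real (u x)) (ennreal K)"
  proof (subst Ap_condition_iff[OF q enn2real_nonneg], unfold u_eq, intro allI impI)
    fix c :: "real^'n" and r :: real assume r: "0 < r"
    have "ball_int u c r * epowr (ball_int (dual_weight q u) c r) (q - 1)
      \<le> ennreal (K * crit_gauge V c r powr N) * epowr (emeasure lebesgue (ball c r)) q"
      by (rule muckenhoupt_ineq[OF u r])
    also have "\<dots> = ennreal K * (ennreal (crit_gauge V c r powr (N / q * q)) * epowr (emeasure lebesgue (ball c r)) q)"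
      using K q by (subst ennreal_mult) (auto simp: mult.assoc)
    finally show "ball_int u c r * epowr (ball_int (dual_weight q u) c r) (q - 1)
      \<le> ennreal K * (ennreal (crit_gauge V c r powr (N / q * q)) * epowr (emeasure lebesgue (ball c r)) q)" .
  qed
  have "locally_integrable (\<lambda>x. enn2real (u x))"
    using muckenhoupt_ball_finite[OF u q] by (intro locally_integrable_of_ball_int_finite) (auto simp: u_eq)
  then have "weight (\<lambda>x. enn2real (u x))"
    using u by (auto simp: weight_def muckenhoupt_def enn2real_positive_iff)
  then show "(\<lambda>x. enn2real (u x)) \<in> A_p V (N / q) q"
    using cond by (auto simp: A_p_def intro!: exI[of _ "ennreal K"])
  show "Ap_const V (N / q) q (\<lambda>x. enn2real (u x)) \<le> ennreal K"
    unfolding Ap_const_def using cond by (intro Inf_lower) simp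
qed

text \<open>Every admissible triple t, \<theta>, K is translated into data of a class with exponent
  above 1, whose constant then serves all weights of the triple.\<close>

lemma A_infty_estimateI:
  assumes "\<And>q N K. 1 < q \<Longrightarrow> 0 \<le> N \<Longrightarrow> 0 < K \<Longrightarrow> \<exists>C>0. \<forall>\<omega>. muckenhoupt q N K (\<lambda>x. ennreal (\<omega> x)) \<longrightarrow>
    (\<forall>i\<in>I. lhs \<omega> i < \<infinity> \<longrightarrow> lhs \<omega> i \<le> ennreal C * rhs \<omega> i)"
  shows "A_infty_estimate V I lhs rhs"
  unfolding A_infty_estimate_def
proof (intro allI impI)
  fix t \<theta> K :: real assume *: "1 \<le> t" "0 \<le> \<theta>" "0 < K"
  then obtain C where "0 < C" "\<And>\<omega>. muckenhoupt (t + 1) (\<theta> * t) (2 powr t * (K + 1)) (\<lambda>x. ennreal (\<omega> x)) \<Longrightarrow>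
    (\<forall>i\<in>I. lhs \<omega> i < \<infinity> \<longrightarrow> lhs \<omega> i \<le> ennreal C * rhs \<omega> i)"
    using assms[of "t + 1" "\<theta> * t" "2 powr t * (K + 1)"] by auto
  then show "\<exists>C>0. \<forall>\<omega>\<in>A_infty V. \<omega> \<in> A_p V \<theta> t \<and> Ap_const V \<theta> t \<omega> \<le> ennreal K \<longrightarrow>
      (\<forall>i\<in>I. lhs \<omega> i < \<infinity> \<longrightarrow> lhs \<omega> i \<le> ennreal C * rhs \<omega> i)"
    using A_p_imp_muckenhoupt[OF *] by blast
qed

lemma pair_estimate_of_A_infty_estimate:
  assumes "A_infty_estimate V F
    (\<lambda>\<omega> (f, g). \<integral>\<^sup>+x. epowr (f x) p * ennreal (\<omega> x) \<partial>lebesgue)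
    (\<lambda>\<omega> (f, g). \<integral>\<^sup>+x. epowr (g x) p * ennreal (\<omega> x) \<partial>lebesgue)"
  shows "pair_estimate F p"
  unfolding pair_estimate_def
proof (intro allI impI)
  fix q N K :: real assume q: "1 < q" and N: "0 \<le> N" and K: "0 < K"
  then obtain C where C: "0 < C" "\<And>\<omega> f g. \<omega> \<in> A_infty V \<Longrightarrow> \<omega> \<in> A_p V (N / q) q \<Longrightarrow>
      Ap_const V (N / q) q \<omega> \<le> ennreal K \<Longrightarrow> (f, g) \<in> F \<Longrightarrow>
      pow_int p f (\<lambda>x. ennreal (\<omega> x)) < \<infinity> \<Longrightarrow>
      pow_int p f (\<lambda>x. ennreal (\<omega> x)) \<le> ennreal C * pow_int p g (\<lambda>x. ennreal (\<omega> x))"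
    using assms unfolding A_infty_estimate_def pow_int_def
    by (elim allE[of _ q] allE[of _ "N / q"] allE[of _ K] impE) (simp, simp, simp, fastforce)
  show "\<exists>C>0. \<forall>u. muckenhoupt q N K u \<longrightarrow> (\<forall>(f, g)\<in>F. pow_int p f u < top \<longrightarrow> pow_int p f u \<le> ennreal C * pow_int p g u)"
  proof (intro exI[of _ C] conjI allI impI C(1), safe)
    fix u f g assume u: "muckenhoupt q N K u" and fg: "(f, g) \<in> F" and fin: "pow_int p f u < top"
    have u_eq: "(\<lambda>x. ennreal (enn2real (u x))) = u"
      using muckenhoupt_finite[OF u] by auto
    note A = muckenhoupt_imp_A_p[OF u q]
    have "(\<lambda>x. enn2real (u x)) \<in> A_infty V"
      unfolding A_infty_def using A(1) q N by (intro UN_I[of q] UN_I[of "N / q"]) auto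
    from C(2)[OF this A fg, unfolded u_eq] fin
    show "pow_int p f u \<le> ennreal C * pow_int p g u"
      by simp
  qed
qed

lemma A_infty_estimate_of_pair_estimate:
  assumes "pair_estimate F p"
  shows "A_infty_estimate V F
    (\<lambda>\<omega> (f, g). \<integral>\<^sup>+x. epowr (f x) p * ennreal (\<omega> x) \<partial>lebesgue)
    (\<lambda>\<omega> (f, g). \<integral>\<^sup>+x. epowr (g x) p * ennreal (\<omega> x) \<partial>lebesgue)"
proof (rule A_infty_estimateI)
  fix q N K :: real assume "1 < q" "0 \<le> N" "0 < K"
  then obtain C where "0 < C" "\<And>u f g. muckenhoupt q N K u \<Longrightarrow> (f, g) \<in> F \<Longrightarrow> pow_int p f u < top \<Longrightarrow>
    pow_int p f u \<le> ennreal C * pow_int p g u"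
    using pair_estimateE[OF assms] by blast
  then show "\<exists>C>0. \<forall>\<omega>. muckenhoupt q N K (\<lambda>x. ennreal (\<omega> x)) \<longrightarrow> (\<forall>i\<in>F.
      (case i of (f, g) \<Rightarrow> \<integral>\<^sup>+x. epowr (f x) p * ennreal (\<omega> x) \<partial>lebesgue) < \<infinity> \<longrightarrow>
      (case i of (f, g) \<Rightarrow> \<integral>\<^sup>+x. epowr (f x) p * ennreal (\<omega> x) \<partial>lebesgue)
        \<le> ennreal C * (case i of (f, g) \<Rightarrow> \<integral>\<^sup>+x. epowr (g x) p * ennreal (\<omega> x) \<partial>lebesgue))"
    unfolding pow_int_def by (intro exI[of _ C]) auto
qed

lemma Lp_norm_weighted:
  assumes f: "f \<in> borel_measurable lebesgue" and w: "(\<lambda>x. ennreal (\<omega> x)) \<in> borel_measurable lebesgue"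
  shows "Lp_norm (weighted \<omega>) p f = epowr (pow_int p f (\<lambda>x. ennreal (\<omega> x))) (1 / p)"
  unfolding Lp_norm_def weighted_def pow_int_def using f w
  by (subst nn_integral_density) (auto simp: mult.commute)

lemma Lp_estimate:
  assumes est: "pair_estimate (lq_family q F) p" and p: "0 < p"
    and F_meas: "\<And>f g. (f, g) \<in> F \<Longrightarrow> f \<in> borel_measurable lebesgue \<and> g \<in> borel_measurable lebesgue"
  shows "A_infty_estimate V (pair_seqs F)
    (\<lambda>\<omega> (J, h). Lp_norm (weighted \<omega>) p (lq_sum q J (\<lambda>j. fst (h j))))
    (\<lambda>\<omega> (J, h). Lp_norm (weighted \<omega>) p (lq_sum q J (\<lambda>j. snd (h j))))"
proof (rule A_infty_estimateI)
  fix r N K :: real assume "1 < r" "0 \<le> N" "0 < K"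
  then obtain C where C: "0 < C" "\<And>u f g. muckenhoupt r N K u \<Longrightarrow> (f, g) \<in> lq_family q F \<Longrightarrow> pow_int p f u < top \<Longrightarrow>
    pow_int p f u \<le> ennreal C * pow_int p g u"
    using pair_estimateE[OF est] by blast
  have "Lp_norm (weighted \<omega>) p (lq_sum q J (\<lambda>j. fst (h j))) \<le> ennreal (C powr (1 / p)) * Lp_norm (weighted \<omega>) p (lq_sum q J (\<lambda>j. snd (h j)))"
    if w: "muckenhoupt r N K (\<lambda>x. ennreal (\<omega> x))" and h: "(J, h) \<in> pair_seqs F"
      and fin: "Lp_norm (weighted \<omega>) p (lq_sum q J (\<lambda>j. fst (h j))) < \<infinity>" for \<omega> J h
  proof -
    let ?f = "lq_sum q J (\<lambda>j. fst (h j))" and ?g = "lq_sum q J (\<lambda>j. snd (h j))"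
    have fg: "(?f, ?g) \<in> lq_family q F"
      using h by (auto simp: lq_family_def)
    have meas: "?f \<in> borel_measurable lebesgue" "?g \<in> borel_measurable lebesgue"
      using lq_family_measurable[OF F_meas fg] by auto
    note Lp = Lp_norm_weighted[OF meas(1) muckenhoupt_measurable[OF w]] Lp_norm_weighted[OF meas(2) muckenhoupt_measurable[OF w]]
    have "pow_int p ?f (\<lambda>x. ennreal (\<omega> x)) < top"
      using fin by (simp add: Lp)
    then have "epowr (pow_int p ?f (\<lambda>x. ennreal (\<omega> x))) (1 / p) \<le> epowr (ennreal C * pow_int p ?g (\<lambda>x. ennreal (\<omega> x))) (1 / p)"
      using p by (intro epowr_mono C(2)[OF w fg]) auto
    then show ?thesis
      using C(1) by (simp add: Lp epowr_mult epowr_ennreal)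
  qed
  then show "\<exists>C>0. \<forall>\<omega>. muckenhoupt r N K (\<lambda>x. ennreal (\<omega> x)) \<longrightarrow> (\<forall>i\<in>pair_seqs F.
      (case i of (J, h) \<Rightarrow> Lp_norm (weighted \<omega>) p (lq_sum q J (\<lambda>j. fst (h j)))) < \<infinity> \<longrightarrow>
      (case i of (J, h) \<Rightarrow> Lp_norm (weighted \<omega>) p (lq_sum q J (\<lambda>j. fst (h j))))
        \<le> ennreal C * (case i of (J, h) \<Rightarrow> Lp_norm (weighted \<omega>) p (lq_sum q J (\<lambda>j. snd (h j)))))"
    using C(1) by (intro exI[of _ "C powr (1 / p)"]) auto
qed

lemma Lorentz_A_infty_estimate:
  assumes est: "\<And>p. 0 < p \<Longrightarrow> pair_estimate F p" and p: "0 < p" and s: "0 < s"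
    and F_meas: "\<And>f g. (f, g) \<in> F \<Longrightarrow> f \<in> borel_measurable lebesgue \<and> g \<in> borel_measurable lebesgue"
  shows "A_infty_estimate V F
    (\<lambda>\<omega> (f, g). Lorentz_norm (weighted \<omega>) p s f) (\<lambda>\<omega> (f, g). Lorentz_norm (weighted \<omega>) p s g)"
proof (rule A_infty_estimateI)
  fix q N K :: real assume *: "1 < q" "0 \<le> N" "0 < K"
  have "\<exists>C>0. \<forall>u. muckenhoupt q N K u \<longrightarrow> (\<forall>(f, g)\<in>F. Lorentz_norm (density lebesgue u) p s f < top \<longrightarrow>
      Lorentz_norm (density lebesgue u) p s f \<le> ennreal C * Lorentz_norm (density lebesgue u) p s g)"
    by (rule Lorentz_estimate[OF est p s F_meas *])
  then show "\<exists>C>0. \<forall>\<omega>. muckenhoupt q N K (\<lambda>x. ennreal (\<omega> x)) \<longrightarrow> (\<forall>i\<in>F.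
      (case i of (f, g) \<Rightarrow> Lorentz_norm (weighted \<omega>) p s f) < \<infinity> \<longrightarrow>
      (case i of (f, g) \<Rightarrow> Lorentz_norm (weighted \<omega>) p s f)
        \<le> ennreal C * (case i of (f, g) \<Rightarrow> Lorentz_norm (weighted \<omega>) p s g))"
    unfolding weighted_def by fastforce
qed

lemma A_infty_estimate_lq_family:
  assumes "A_infty_estimate V (lq_family q F) (\<lambda>\<omega> (f, g). L \<omega> f) (\<lambda>\<omega> (f, g). L \<omega> g)"
  shows "A_infty_estimate V (pair_seqs F)
    (\<lambda>\<omega> (J, h). L \<omega> (lq_sum q J (\<lambda>j. fst (h j)))) (\<lambda>\<omega> (J, h). L \<omega> (lq_sum q J (\<lambda>j. snd (h j))))"
  unfolding A_infty_estimate_def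
proof (intro allI impI)
  fix t \<theta> K :: real assume "1 \<le> t" "0 \<le> \<theta>" "0 < K"
  then obtain C where C: "0 < C" "\<And>\<omega> f g. \<omega> \<in> A_infty V \<Longrightarrow> \<omega> \<in> A_p V \<theta> t \<Longrightarrow> Ap_const V \<theta> t \<omega> \<le> ennreal K \<Longrightarrow>
      (f, g) \<in> lq_family q F \<Longrightarrow> L \<omega> f < \<infinity> \<Longrightarrow> L \<omega> f \<le> ennreal C * L \<omega> g"
    using assms unfolding A_infty_estimate_def by (elim allE[of _ t] allE[of _ \<theta>] allE[of _ K] impE) (simp, simp, simp, fastforce)
  show "\<exists>C>0. \<forall>\<omega>\<in>A_infty V. \<omega> \<in> A_p V \<theta> t \<and> Ap_const V \<theta> t \<omega> \<le> ennreal K \<longrightarrow> (\<forall>i\<in>pair_seqs F.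
      (case i of (J, h) \<Rightarrow> L \<omega> (lq_sum q J (\<lambda>j. fst (h j)))) < \<infinity> \<longrightarrow>
      (case i of (J, h) \<Rightarrow> L \<omega> (lq_sum q J (\<lambda>j. fst (h j)))) \<le> ennreal C * (case i of (J, h) \<Rightarrow> L \<omega> (lq_sum q J (\<lambda>j. snd (h j)))))"
  proof -
    have "(lq_sum q J (\<lambda>j. fst (h j)), lq_sum q J (\<lambda>j. snd (h j))) \<in> lq_family q F" if "(J, h) \<in> pair_seqs F" for J h
      using that by (auto simp: lq_family_def)
    then show ?thesis
      using C(1) by (intro exI[of _ C]) (auto intro!: C(2))
  qed
qed

end

theorem theorem3p1:
  fixes V :: "real^'n \<Rightarrow> real"
    and F :: "((real^'n \<Rightarrow> ennreal) \<times> (real^'n \<Rightarrow> ennreal)) set"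
    and p\<^sub>0 :: real
  assumes "CARD('n) \<ge> 3"
    and "V \<in> reverse_Holder (real CARD('n) / 2)"
    and "\<not> (AE x in lebesgue. V x = 0)"
    and "\<And>f g. (f, g) \<in> F \<Longrightarrow> f \<in> borel_measurable lebesgue \<and> g \<in> borel_measurable lebesgue"
    and "0 < p\<^sub>0"
    and "A_infty_estimate V F
           (\<lambda>\<omega> (f, g). \<integral>\<^sup>+x. epowr (f x) p\<^sub>0 * ennreal (\<omega> x) \<partial>lebesgue)
           (\<lambda>\<omega> (f, g). \<integral>\<^sup>+x. epowr (g x) p\<^sub>0 * ennreal (\<omega> x) \<partial>lebesgue)"
  shows "(\<forall>p>0. A_infty_estimate V F
            (\<lambda>\<omega> (f, g). \<integral>\<^sup>+x. epowr (f x) p * ennreal (\<omega> x) \<partial>lebesgue)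
            (\<lambda>\<omega> (f, g). \<integral>\<^sup>+x. epowr (g x) p * ennreal (\<omega> x) \<partial>lebesgue))
       \<and> (\<forall>p>0. \<forall>s>0. A_infty_estimate V F
            (\<lambda>\<omega> (f, g). Lorentz_norm (weighted \<omega>) p s f)
            (\<lambda>\<omega> (f, g). Lorentz_norm (weighted \<omega>) p s g))
       \<and> (\<forall>p>0. \<forall>q>0. A_infty_estimate V (pair_seqs F)
            (\<lambda>\<omega> (J, h). Lp_norm (weighted \<omega>) p (lq_sum q J (\<lambda>j. fst (h j))))
            (\<lambda>\<omega> (J, h). Lp_norm (weighted \<omega>) p (lq_sum q J (\<lambda>j. snd (h j)))))
       \<and> (\<forall>p>0. \<forall>q>0. \<forall>s>0. A_infty_estimate V (pair_seqs F)
            (\<lambda>\<omega> (J, h). Lorentz_norm (weighted \<omega>) p s (lq_sum q J (\<lambda>j. fst (h j))))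
            (\<lambda>\<omega> (J, h). Lorentz_norm (weighted \<omega>) p s (lq_sum q J (\<lambda>j. snd (h j)))))"
proof -
  interpret positive_crit_radius V
    by unfold_locales (rule crit_radius_pos[OF assms(1-3)])
  have est: "pair_estimate F p" if "0 < p" for p
    by (rule pair_estimate_raise[OF pair_estimate_of_A_infty_estimate[OF assms(6)] that assms(5,4)])
  \<comment> \<open>The l^q sums satisfy the estimate at the exponent q by summation; the scalar
    change of exponent then reaches p.\<close>
  have est_seq: "pair_estimate (lq_family q F) p" if "0 < p" "0 < q" for p q
    by (rule pair_estimate_raise[OF pair_estimate_lq_family[OF est[OF that(2)] that(2) assms(4)] that(1,2)
          lq_family_measurable[OF assms(4)]])
  show ?thesis
  proof (intro conjI allI impI)
    fix p :: real assume "0 < p"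
    then show "A_infty_estimate V F
        (\<lambda>\<omega> (f, g). \<integral>\<^sup>+x. epowr (f x) p * ennreal (\<omega> x) \<partial>lebesgue)
        (\<lambda>\<omega> (f, g). \<integral>\<^sup>+x. epowr (g x) p * ennreal (\<omega> x) \<partial>lebesgue)"
      by (intro A_infty_estimate_of_pair_estimate est)
  next
    fix p :: real and s :: ennreal assume "0 < p" "0 < s"
    then show "A_infty_estimate V F
        (\<lambda>\<omega> (f, g). Lorentz_norm (weighted \<omega>) p s f) (\<lambda>\<omega> (f, g). Lorentz_norm (weighted \<omega>) p s g)"
      by (intro Lorentz_A_infty_estimate est assms(4))
  next
    fix p q :: real assume "0 < p" "0 < q"
    then show "A_infty_estimate V (pair_seqs F)
        (\<lambda>\<omega> (J, h). Lp_norm (weighted \<omega>) p (lq_sum q J (\<lambda>j. fst (h j))))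
        (\<lambda>\<omega> (J, h). Lp_norm (weighted \<omega>) p (lq_sum q J (\<lambda>j. snd (h j))))"
      by (intro Lp_estimate est_seq assms(4))
  next
    fix p q :: real and s :: ennreal assume "0 < p" "0 < q" "0 < s"
    then have "A_infty_estimate V (lq_family q F)
        (\<lambda>\<omega> (f, g). Lorentz_norm (weighted \<omega>) p s f) (\<lambda>\<omega> (f, g). Lorentz_norm (weighted \<omega>) p s g)"
      by (intro Lorentz_A_infty_estimate est_seq lq_family_measurable[OF assms(4)])
    then show "A_infty_estimate V (pair_seqs F)
        (\<lambda>\<omega> (J, h). Lorentz_norm (weighted \<omega>) p s (lq_sum q J (\<lambda>j. fst (h j))))
        (\<lambda>\<omega> (J, h). Lorentz_norm (weighted \<omega>) p s (lq_sum q J (\<lambda>j. snd (h j))))"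
      by (rule A_infty_estimate_lq_family)
  qed
qed

end
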